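(* Let $n,N\ge 1$, let $M_1,\dots,M_{n+N}$ be $2\times 2$ monodromy matrices (with $\operatorname{Tr}M_i=0$, $\det M_i=1$) with the Korotkin--Samtleben bracket described in the context, put $M_h:=M_{n+1}M_{n+2}\cdots M_{n+N}$ and, for $1\le i,j\le n$, $k\in\mathbb Z$, $$G^{(k)}_{i,j}:=-\operatorname{Tr}\bigl(M_iM_h^kM_jM_h^{-k}\bigr),$$ so that $G^{(k)}_{i,j}=G^{(-k)}_{j,i}$ and $G^{(0)}_{i,i}=2$. Then the following hold. (1) For all $k\ge 0$ and $1\le i,j,p,l\le n$, $$\{G_{j,i}^{(0)},G_{p,l}^{(k)}\}=\bigl(\epsilon(j-l)-\epsilon(i-l)\bigr)\bigl(G_{l,i}^{(0)}G_{p,j}^{(k)}-G_{l,j}^{(0)}G_{p,i}^{(k)}\bigr)+\bigl(\epsilon(j-p)-\epsilon(i-p)\bigr)\bigl(G_{p,i}^{(0)}G_{j,l}^{(k)}-G_{p,j}^{(0)}G_{i,l}^{(k)}\bigr),$$ and for $0<m\le k$, $$\begin{aligned}\{G_{j,i}^{(m)},G_{p,l}^{(k)}\}={}&\epsilon(i-l)\bigl(G^{(k)}_{p,i}G^{(m)}_{j,l}-G^{(0)}_{i,l}G^{(k-m)}_{p,j}\bigr)+\epsilon(i-p)\bigl(G^{(m)}_{j,p}G^{(k)}_{i,l}-G^{(0)}_{i,p}G^{(k+m)}_{j,l}\bigr)\\ &+\epsilon(j-l)\bigl(G^{(k)}_{p,j}G^{(m)}_{l,i}-G^{(0)}_{j,l}G^{(k+m)}_{p,i}\bigr)+\epsilon(j-p)\bigl(G^{(m)}_{p,i}G^{(k)}_{j,l}-G^{(0)}_{j,p}G^{(k-m)}_{i,l}\bigr)\\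 &+G^{(k+m)}_{p,i}G^{(0)}_{j,l}+2\sum_{a=1}^{m-1}G^{(k+m-a)}_{p,i}G^{(a)}_{j,l}+G^{(k)}_{p,i}G^{(m)}_{j,l}\\ &-G^{(m)}_{p,i}G^{(k)}_{j,l}-2\sum_{a=1}^{m-1}G^{(m-a)}_{p,i}G^{(k+a)}_{j,l}-G^{(0)}_{p,i}G^{(k+m)}_{j,l}\\ &+G^{(k-m)}_{i,l}G^{(0)}_{j,p}+2\sum_{a=1}^{m-1}G^{(k-m+a)}_{i,l}G^{(a)}_{j,p}+G^{(k)}_{i,l}G^{(m)}_{j,p}\\ &-G^{(0)}_{l,i}G^{(k-m)}_{p,j}-2\sum_{a=1}^{m-1}G^{(a)}_{l,i}G^{(k-m+a)}_{p,j}-G^{(m)}_{l,i}G^{(k)}_{p,j}.\end{aligned}$$ (2) With the generating functions $\mathcal G_{i,j}(\lambda):=\mathcal A^{(0)}_{i,j}+\sum_{k=1}^\infty G^{(k)}_{i,j}\lambda^{-k}$, where $\mathcal A^{(0)}_{i,j}=G^{(0)}_{i,j}$ for $i<j$, $\mathcal A^{(0)}_{i,i}=1$, $\mathcal A^{(0)}_{i,j}=0$ for $i>j$, the bracket becomes $$\begin{aligned}\{\mathcal G_{j,i}(\lambda),\mathcal G_{p,l}(\mu)\}={}&\Bigl(\epsilon(j-p)-\tfrac{\lambda+\mu}{\lambda-\mu}\Bigr)\mathcal G_{p,i}(\lambda)\mathcal G_{j,l}(\mu)+\Bigl(\epsilon(i-l)+\tfrac{\lambda+\mu}{\lambda-\mu}\Bigr)\mathcal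 G_{p,i}(\mu)\mathcal G_{j,l}(\lambda)\\&+\Bigl(\epsilon(i-p)-\tfrac{1+\lambda\mu}{1-\lambda\mu}\Bigr)\mathcal G_{j,p}(\lambda)\mathcal G_{i,l}(\mu)+\Bigl(\epsilon(j-l)+\tfrac{1+\lambda\mu}{1-\lambda\mu}\Bigr)\mathcal G_{l,i}(\lambda)\mathcal G_{p,j}(\mu).\end{aligned}$$ (3) These formulas define an abstract infinite-dimensional Poisson algebra: if $G^{(0)}_{i,j}$ ($i<j$) and $G^{(k)}_{i,j}$ ($k\ge1$, $1\le i,j\le n$) are regarded as independent commuting generators (with the conventions $G^{(-k)}_{j,i}=G^{(k)}_{i,j}$, $G^{(0)}_{i,i}=2$), the bracket is skew-symmetric and satisfies the Jacobi identity.
   Context: $\epsilon(x)$ is the sign function: $\epsilon(x)=-1,0,1$ for $x<0$, $x=0$, $x>0$. Tensor notation: for a $2\times2$ matrix $A$, $\overset{1}{A}=A\otimes 1$, $\overset{2}{A}=1\otimes A$; $\{A\otimes_, B\}$ is the matrix of brackets of the entries of $A$ (space 1) and $B$ (space 2); $\Omega=\sum_{i,j}E_{ij}\otimes E_{ji}$ is the exchange matrix. The Korotkin--Samtleben bracket is the skew-symmetric biderivation on functions of the entries of $M_1,\dots,M_{n+N}$ given by $$\{M_i\otimes_, M_i\}=\tfrac12\bigl(\overset{2}{M_i}\Omega\overset{1}{M_i}-\overset{1}{M_i}\Omega\overset{2}{M_i}\bigr),$$ $$\{M_i\otimes_, M_j\}=\tfrac12\bigl(\overset{1}{M_i}\Omega\overset{2}{M_j}+\overset{2}{M_j}\Omega\overset{1}{M_i}-\Omega\overset{1}{M_i}\overset{2}{M_j}-\overset{2}{M_j}\overset{1}{M_i}\Omega\bigr),\quad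 i<j.$$ It need not satisfy the Jacobi identity on matrix entries, but it restricts to a Poisson bracket on functions invariant under simultaneous conjugation. The generating-function identity is understood as an identity of formal series in $\lambda^{-1},\mu^{-1}$ (equivalently, after multiplication by $(\lambda-\mu)(1-\lambda\mu)$). Sums $\sum_{a=1}^{m-1}$ are empty when $m=1$. The abstract Poisson algebra in (3) is called $\mathfrak D_n$. *)

theory Defs
  imports
    "HOL-Analysis.Analysis"
    "HOL-Computational_Algebra.Formal_Laurent_Series"
    "HOL-Library.Poly_Mapping"
begin

subsection \<open>The Korotkin--Samtleben bracket\<close>

type_synonym mat2 = "complex^2^2"
type_synonym mat4 = "complex^(2 \<times> 2)^(2 \<times> 2)"

text \<open>A point of the phase space is a tuple \<open>M 1, \<dots>, M r\<close> of matrices; the values of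
  \<open>M\<close> outside \<open>{1..r}\<close> are irrelevant.\<close>

type_synonym point = "nat \<Rightarrow> mat2"

text \<open>In a matrix on the tensor product, row and column indices are pairs (space 1, space 2),
  so \<open>X $ (a, c) $ (b, d)\<close> is the coefficient of \<open>E\<^sub>a\<^sub>b \<otimes> E\<^sub>c\<^sub>d\<close>.\<close>

definition kron :: "mat2 \<Rightarrow> mat2 \<Rightarrow> mat4" where
  "kron A B = (\<chi> r s. A $ fst r $ fst s * B $ snd r $ snd s)"

definition space1 :: "mat2 \<Rightarrow> mat4" where
  "space1 A = kron A (mat 1)"

definition space2 :: "mat2 \<Rightarrow> mat4" where
  "space2 A = kron (mat 1) A"

definition unit_mat :: "2 \<Rightarrow> 2 \<Rightarrow> mat2" where
  "unit_mat i j = (\<chi> a b. if a = i \<and> b = j then 1 else 0)"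

definition exchange :: mat4 where
  "exchange = (\<Sum>i\<in>UNIV. \<Sum>j\<in>UNIV. kron (unit_mat i j) (unit_mat j i))"

definition ks_same :: "mat2 \<Rightarrow> mat4" where
  "ks_same A = (1/2) *\<^sub>R
     (space2 A ** exchange ** space1 A - space1 A ** exchange ** space2 A)"

definition ks_less :: "mat2 \<Rightarrow> mat2 \<Rightarrow> mat4" where
  "ks_less A B = (1/2) *\<^sub>R
     (space1 A ** exchange ** space2 B + space2 B ** exchange ** space1 A
      - exchange ** space1 A ** space2 B - space2 B ** space1 A ** exchange)"

text \<open>The bracket of the entry \<open>(a, b)\<close> of \<open>M i\<close> with the entry \<open>(c, d)\<close> of \<open>M j\<close>. For
  \<open>i > j\<close> it is given by skew-symmetry, which also exchanges the two tensor factors.\<close>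

definition ks_entry :: "point \<Rightarrow> nat \<Rightarrow> 2 \<Rightarrow> 2 \<Rightarrow> nat \<Rightarrow> 2 \<Rightarrow> 2 \<Rightarrow> complex" where
  "ks_entry M i a b j c d =
     (if i = j then ks_same (M i) $ (a, c) $ (b, d)
      else if i < j then ks_less (M i) (M j) $ (a, c) $ (b, d)
      else - ks_less (M j) (M i) $ (c, a) $ (d, b))"

definition set_entry :: "point \<Rightarrow> nat \<Rightarrow> 2 \<Rightarrow> 2 \<Rightarrow> complex \<Rightarrow> point" where
  "set_entry M i a b t = M(i := (\<chi> c d. if c = a \<and> d = b then t else M i $ c $ d))"

definition entry_deriv :: "(point \<Rightarrow> complex) \<Rightarrow> nat \<Rightarrow> 2 \<Rightarrow> 2 \<Rightarrow> point \<Rightarrow> complex" where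
  "entry_deriv F i a b M = deriv (\<lambda>t. F (set_entry M i a b t)) (M i $ a $ b)"

text \<open>The biderivation on holomorphic functions of the entries of \<open>r\<close> arbitrary matrices whose
  values on the coordinate functions are \<open>ks_entry\<close>. Traces and determinants of the \<open>M i\<close> are
  Casimirs, so on the surface \<open>Tr M\<^sub>i = 0\<close>, \<open>det M\<^sub>i = 1\<close> the value of the bracket only depends on
  the restrictions of the two functions to this surface.\<close>

definition ks_bracket ::
    "nat \<Rightarrow> (point \<Rightarrow> complex) \<Rightarrow> (point \<Rightarrow> complex) \<Rightarrow> point \<Rightarrow> complex" where
  "ks_bracket r F H M =
     (\<Sum>i\<in>{1..r}. \<Sum>j\<in>{1..r}. \<Sum>a\<in>UNIV. \<Sum>b\<in>UNIV. \<Sum>c\<in>UNIV. \<Sum>d\<in>UNIV.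
        entry_deriv F i a b M * entry_deriv H j c d M * ks_entry M i a b j c d)"

lemma entry_deriv_coordinate:
  "entry_deriv (\<lambda>X. X i $ a $ b) i' a' b' M = (if i' = i \<and> a' = a \<and> b' = b then 1 else 0)"
proof (cases "i' = i \<and> a' = a \<and> b' = b")
  case True
  then show ?thesis by (simp add: entry_deriv_def set_entry_def)
next
  case False
  then have "(\<lambda>t. set_entry M i' a' b' t i $ a $ b) = (\<lambda>t. M i $ a $ b)"
    by (auto simp: set_entry_def)
  with False show ?thesis by (auto simp: entry_deriv_def)
qed

lemma ks_bracket_coordinates:
  assumes "i \<in> {1..r}" "j \<in> {1..r}"
  shows "ks_bracket r (\<lambda>X. X i $ a $ b) (\<lambda>X. X j $ c $ d) M = ks_entry M i a b j c d"
proof -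
  have delta: "(if i' = i \<and> a' = a \<and> b' = b then 1 else 0) *
        (if j' = j \<and> c' = c \<and> d' = d then 1 else 0) * ks_entry M i' a' b' j' c' d' =
      (if d' = d then if c' = c then if b' = b then if a' = a then if j' = j then if i' = i
        then ks_entry M i a b j c d else 0 else 0 else 0 else 0 else 0 else 0)"
    for i' a' b' j' c' d' by auto
  show ?thesis
    using assms unfolding ks_bracket_def entry_deriv_coordinate delta by simp
qed

lemma ks_same_skew: "ks_same A $ (c, a) $ (d, b) = - ks_same A $ (a, c) $ (b, d)"
proof -
  have sum_prod: "(\<Sum>x\<in>UNIV. f x) = (\<Sum>a\<in>UNIV. \<Sum>c\<in>UNIV. f (a, c))"
    for f :: "2 \<times> 2 \<Rightarrow> complex"
    by (simp add: sum.cartesian_product flip: UNIV_Times_UNIV)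
  have "\<forall>a c b d. ks_same A $ (c, a) $ (d, b) = - ks_same A $ (a, c) $ (b, d)"
    by (simp add: forall_2 ks_same_def space1_def space2_def exchange_def kron_def unit_mat_def
        mat_def matrix_matrix_mult_def sum_prod sum_2 algebra_simps)
  then show ?thesis by blast
qed

lemma ks_entry_skew: "ks_entry M j c d i a b = - ks_entry M i a b j c d"
  by (cases i j rule: linorder_cases) (auto simp: ks_entry_def ks_same_skew[of _ c])

lemma ks_bracket_skew: "ks_bracket r H F M = - ks_bracket r F H M"
proof -
  have "ks_bracket r H F M =
     (\<Sum>j\<in>{1..r}. \<Sum>i\<in>{1..r}. \<Sum>c\<in>UNIV. \<Sum>d\<in>UNIV. \<Sum>a\<in>UNIV. \<Sum>b\<in>UNIV.
        - (entry_deriv F i a b M * entry_deriv H j c d M * ks_entry M i a b j c d))"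
    unfolding ks_bracket_def
    by (intro sum.cong refl) (subst ks_entry_skew, simp)
  also have "\<dots> = (\<Sum>i\<in>{1..r}. \<Sum>j\<in>{1..r}. \<Sum>c\<in>UNIV. \<Sum>d\<in>UNIV. \<Sum>a\<in>UNIV. \<Sum>b\<in>UNIV.
        - (entry_deriv F i a b M * entry_deriv H j c d M * ks_entry M i a b j c d))"
    by (rule sum.swap)
  also have "\<dots> = - ks_bracket r F H M"
    unfolding ks_bracket_def sum_negf [symmetric]
    by (rule sum.cong[OF refl], rule sum.cong[OF refl], simp add: sum_2)
  finally show ?thesis .
qed

lemma ks_bracket_Leibniz:
  assumes F: "\<And>i a b. (\<lambda>t. F (set_entry M i a b t)) field_differentiable at (M i $ a $ b)"
    and F': "\<And>i a b. (\<lambda>t. F' (set_entry M i a b t)) field_differentiable at (M i $ a $ b)"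
  shows "ks_bracket r (\<lambda>X. F X * F' X) H M = F M * ks_bracket r F' H M + ks_bracket r F H M * F' M"
proof -
  have self: "set_entry M i a b (M i $ a $ b) = M" for i a b
    by (auto simp: set_entry_def vec_eq_iff)
  have "entry_deriv (\<lambda>X. F X * F' X) i a b M =
      F M * entry_deriv F' i a b M + entry_deriv F i a b M * F' M" for i a b
    unfolding entry_deriv_def by (simp add: deriv_mult[OF F F'] self)
  then show ?thesis
    unfolding ks_bracket_def
    by (simp add: sum_distrib_left sum_distrib_right algebra_simps flip: sum.distrib)
qed

subsection \<open>The functions \<open>G\<close>\<close>

text \<open>The library's \<open>*\<close> and \<open>^\<close> on \<open>complex^2^2\<close> are entrywise, hence a separate power.\<close>

definition matrix_powi :: "mat2 \<Rightarrow> int \<Rightarrow> mat2" where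
  "matrix_powi A k =
     (if 0 \<le> k then (((**) A) ^^ nat k) (mat 1)
      else (((**) (matrix_inv A)) ^^ nat (- k)) (mat 1))"

definition M_h :: "nat \<Rightarrow> nat \<Rightarrow> point \<Rightarrow> mat2" where
  "M_h n N M = foldr (\<lambda>i A. M i ** A) [n + 1..<n + N + 1] (mat 1)"

definition G_fun :: "nat \<Rightarrow> nat \<Rightarrow> int \<Rightarrow> nat \<Rightarrow> nat \<Rightarrow> point \<Rightarrow> complex" where
  "G_fun n N k i j M =
     - trace (M i ** matrix_powi (M_h n N M) k ** M j ** matrix_powi (M_h n N M) (- k))"

subsection \<open>The bracket relations\<close>

text \<open>Below, \<open>G k i j\<close> stands for \<open>G\<^sup>(\<^sup>k\<^sup>)\<^sub>i\<^sub>,\<^sub>j\<close> in an arbitrary commutative ring, and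
  \<open>br m j i k p l\<close> for the bracket of \<open>G m j i\<close> and \<open>G k p l\<close>.\<close>

definition eps :: "nat \<Rightarrow> nat \<Rightarrow> 'a::comm_ring_1" where
  "eps i j = of_int (sgn (int i - int j))"

definition G_relations ::
    "nat \<Rightarrow> (int \<Rightarrow> nat \<Rightarrow> nat \<Rightarrow> 'a::comm_ring_1) \<Rightarrow>
     (int \<Rightarrow> nat \<Rightarrow> nat \<Rightarrow> int \<Rightarrow> nat \<Rightarrow> nat \<Rightarrow> 'a) \<Rightarrow> bool" where
  "G_relations n G br \<longleftrightarrow>
     (\<forall>k\<ge>0. \<forall>i\<in>{1..n}. \<forall>j\<in>{1..n}. \<forall>p\<in>{1..n}. \<forall>l\<in>{1..n}.
        br 0 j i k p l =
          (eps j l - eps i l) * (G 0 l i * G k p j - G 0 l j * G k p i)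
        + (eps j p - eps i p) * (G 0 p i * G k j l - G 0 p j * G k i l)) \<and>
     (\<forall>m k. 0 < m \<and> m \<le> k \<longrightarrow>
       (\<forall>i\<in>{1..n}. \<forall>j\<in>{1..n}. \<forall>p\<in>{1..n}. \<forall>l\<in>{1..n}.
        br m j i k p l =
          eps i l * (G k p i * G m j l - G 0 i l * G (k - m) p j)
        + eps i p * (G m j p * G k i l - G 0 i p * G (k + m) j l)
        + eps j l * (G k p j * G m l i - G 0 j l * G (k + m) p i)
        + eps j p * (G m p i * G k j l - G 0 j p * G (k - m) i l)
        + G (k + m) p i * G 0 j l
        + 2 * (\<Sum>a\<in>{1..m - 1}. G (k + m - a) p i * G a j l)
        + G k p i * G m j l
        - G m p i * G k j l
        - 2 * (\<Sum>a\<in>{1..m - 1}. G (m - a) p i * G (k + a) j l)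
        - G 0 p i * G (k + m) j l
        + G (k - m) i l * G 0 j p
        + 2 * (\<Sum>a\<in>{1..m - 1}. G (k - m + a) i l * G a j p)
        + G k i l * G m j p
        - G 0 l i * G (k - m) p j
        - 2 * (\<Sum>a\<in>{1..m - 1}. G a l i * G (k - m + a) p j)
        - G m l i * G k p j))"

subsection \<open>Generating functions\<close>

text \<open>Formal series in \<open>\<lambda>\<^sup>-\<^sup>1\<close>, \<open>\<mu>\<^sup>-\<^sup>1\<close> live in the iterated Laurent series ring \<open>'a fls fls\<close>,
  where the inner indeterminate is \<open>\<lambda>\<^sup>-\<^sup>1\<close> and the outer one is \<open>\<mu>\<^sup>-\<^sup>1\<close>.\<close>

definition lam :: "'a::comm_ring_1 fls fls" where
  "lam = fls_const fls_X_inv"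

definition mu :: "'a::comm_ring_1 fls fls" where
  "mu = fls_X_inv"

definition series_lam :: "(nat \<Rightarrow> 'a::comm_ring_1) \<Rightarrow> 'a fls fls" where
  "series_lam f = fls_const (fps_to_fls (Abs_fps f))"

definition series_mu :: "(nat \<Rightarrow> 'a::comm_ring_1) \<Rightarrow> 'a fls fls" where
  "series_mu f = fps_to_fls (Abs_fps (\<lambda>k. fls_const (f k)))"

text \<open>\<open>\<Sum>\<^sub>m\<^sub>,\<^sub>k b m k \<lambda>\<^sup>-\<^sup>m \<mu>\<^sup>-\<^sup>k\<close>\<close>

definition series_lam_mu :: "(nat \<Rightarrow> nat \<Rightarrow> 'a::comm_ring_1) \<Rightarrow> 'a fls fls" where
  "series_lam_mu b = fps_to_fls (Abs_fps (\<lambda>k. fps_to_fls (Abs_fps (\<lambda>m. b m k))))"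

definition gen_coeff :: "(int \<Rightarrow> nat \<Rightarrow> nat \<Rightarrow> 'a::comm_ring_1) \<Rightarrow> nat \<Rightarrow> nat \<Rightarrow> nat \<Rightarrow> 'a" where
  "gen_coeff G i j k =
     (if k = 0 then (if i < j then G 0 i j else if i = j then 1 else 0) else G (int k) i j)"

text \<open>The generating-function identity multiplied by \<open>(\<lambda> - \<mu>)(1 - \<lambda>\<mu>)\<close>; this factor
  is not a zero divisor in \<open>'a fls fls\<close>. Here \<open>br m j i k p l\<close> is the bracket of the coefficient
  of \<open>\<lambda>\<^sup>-\<^sup>m\<close> in the \<open>(j, i)\<close> generating function with the coefficient of \<open>\<mu>\<^sup>-\<^sup>k\<close> in the
  \<open>(p, l)\<close> one.\<close>

definition gen_relations ::
    "nat \<Rightarrow> (int \<Rightarrow> nat \<Rightarrow> nat \<Rightarrow> 'a::comm_ring_1) \<Rightarrow>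
     (nat \<Rightarrow> nat \<Rightarrow> nat \<Rightarrow> nat \<Rightarrow> nat \<Rightarrow> nat \<Rightarrow> 'a) \<Rightarrow> bool" where
  "gen_relations n G br \<longleftrightarrow>
     (let GL = (\<lambda>i j. series_lam (gen_coeff G i j));
          GM = (\<lambda>i j. series_mu (gen_coeff G i j))
      in \<forall>i\<in>{1..n}. \<forall>j\<in>{1..n}. \<forall>p\<in>{1..n}. \<forall>l\<in>{1..n}.
        (lam - mu) * (1 - lam * mu) * series_lam_mu (\<lambda>m k. br m j i k p l) =
          (eps j p * (lam - mu) - (lam + mu)) * (1 - lam * mu) * GL p i * GM j l
        + (eps i l * (lam - mu) + (lam + mu)) * (1 - lam * mu) * GM p i * GL j l
        + (eps i p * (1 - lam * mu) - (1 + lam * mu)) * (lam - mu) * GL j p * GM i l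
        + (eps j l * (1 - lam * mu) + (1 + lam * mu)) * (lam - mu) * GL l i * GM p j)"

subsection \<open>The abstract algebra\<close>

text \<open>Complex polynomials in indeterminates indexed by triples \<open>(k, i, j)\<close>: finitely supported
  maps from monomials (exponent vectors) to coefficients. The generators for a given \<open>n\<close> are the
  triples in \<open>D_gens n\<close>, and \<open>D_alg n\<close> is the polynomial ring in these.\<close>

type_synonym gen = "nat \<times> nat \<times> nat"
type_synonym gpoly = "(gen \<Rightarrow>\<^sub>0 nat) \<Rightarrow>\<^sub>0 complex"

definition gconst :: "complex \<Rightarrow> gpoly" where
  "gconst c = Poly_Mapping.single 0 c"

definition gvar :: "gen \<Rightarrow> gpoly" where
  "gvar v = Poly_Mapping.single (Poly_Mapping.single v 1) 1"

definition D_gens :: "nat \<Rightarrow> gen set" where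
  "D_gens n = {(0, i, j) | i j. 1 \<le> i \<and> i < j \<and> j \<le> n} \<union>
              {(k, i, j) | k i j. 1 \<le> k \<and> i \<in> {1..n} \<and> j \<in> {1..n}}"

definition D_alg :: "nat \<Rightarrow> gpoly set" where
  "D_alg n = {f. \<forall>x\<in>Poly_Mapping.keys f. Poly_Mapping.keys x \<subseteq> D_gens n}"

definition G_abs :: "int \<Rightarrow> nat \<Rightarrow> nat \<Rightarrow> gpoly" where
  "G_abs k i j =
     (if 0 < k then gvar (nat k, i, j)
      else if k < 0 then gvar (nat (- k), j, i)
      else if i = j then 2
      else gvar (0, min i j, max i j))"

text \<open>The derivation property in the second argument follows by skew-symmetry.\<close>

definition skew_biderivation_on :: "gpoly set \<Rightarrow> (gpoly \<Rightarrow> gpoly \<Rightarrow> gpoly) \<Rightarrow> bool" where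
  "skew_biderivation_on A B \<longleftrightarrow>
     (\<forall>f\<in>A. \<forall>g\<in>A. B f g \<in> A \<and> B f g = - B g f) \<and>
     (\<forall>f\<in>A. \<forall>g\<in>A. \<forall>h\<in>A. B (f + g) h = B f h + B g h) \<and>
     (\<forall>c. \<forall>f\<in>A. \<forall>h\<in>A. B (gconst c * f) h = gconst c * B f h) \<and>
     (\<forall>f\<in>A. \<forall>g\<in>A. \<forall>h\<in>A. B (f * g) h = f * B g h + B f h * g)"

definition jacobi_on :: "gpoly set \<Rightarrow> (gpoly \<Rightarrow> gpoly \<Rightarrow> gpoly) \<Rightarrow> bool" where
  "jacobi_on A B \<longleftrightarrow>
     (\<forall>f\<in>A. \<forall>g\<in>A. \<forall>h\<in>A. B f (B g h) + B g (B h f) + B h (B f g) = 0)"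

end

theory Submission
  imports Defs
begin

text \<open>
Put \<open>H = M_h\<close> and \<open>M\<^sub>I = H\<^sup>a M\<^sub>i H\<^sup>-\<^sup>a\<close> for a site \<open>I = (a, i)\<close> of level \<open>a \<in> \<int>\<close> and index \<open>i\<close>, and order
the sites lexicographically. Then \<open>G\<^sup>(\<^sup>k\<^sup>)\<^sub>i\<^sub>,\<^sub>j = - Tr (M\<^sub>I M\<^sub>J)\<close> for all sites with indices \<open>i\<close>, \<open>j\<close> whose levels
differ by \<open>k\<close>: the \<open>G\<close> form a symmetric matrix \<open>g\<close> indexed by sites that is invariant under shifts of the
level. Everything follows from a single formula for the bracket,
\<open>{g\<^sub>J\<^sub>I, g\<^sub>P\<^sub>L} = \<Sum>\<^sub>s linking(J, I; P\<^sub>s, L\<^sub>s) (g(P\<^sub>s, I) g(J, L\<^sub>s) - g(P\<^sub>s, J) g(I, L\<^sub>s))\<close>, where \<open>P\<^sub>s\<close> is \<open>P\<close>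
shifted by \<open>s\<close>. Each summand is the bracket of Nelson and Regge for a linearly ordered index set, and the
sum is finite because distant chords are not linked. Collecting the terms by level gives the stated
relations (\<open>periodic_bracket_relations\<close>).

For monodromy matrices one computes with gradients. On the surface \<open>Tr M\<^sub>q = 0\<close>, \<open>det M\<^sub>q = 1\<close> the bracket is
\<open>1/2 \<Sum> \<epsilon>(q - q') Tr (D\<^sub>q D'\<^sub>q\<^sub>')\<close>, where \<open>D\<^sub>q\<close> is the commutator of \<open>M\<^sub>q\<close> with the gradient
(\<open>ks_bracket_gradient\<close>). For the functions \<open>G\<close> the sum of all \<open>D\<^sub>q\<close> is zero, the factors of \<open>H\<close> contribute
a telescoping sum, and the trace of a product of two commutators of traceless matrices is a
determinant in the \<open>g\<close>. This gives the formula above (\<open>ks_bracket_G_fun\<close>).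

The generating-function identity is equivalent to a formula for each coefficient. The two kernels
\<open>(\<lambda> + \<mu>) / (\<lambda> - \<mu>)\<close> and \<open>(1 + \<lambda>\<mu>) / (1 - \<lambda>\<mu>)\<close> expand into the sums along antidiagonals and diagonals that
occur in the relations; the choice of the constant terms makes the weights at the ends agree
(\<open>gen_relations_if_G_relations\<close>).

For the abstract algebra, a biderivation is given by its values on generators, and its Jacobi identity
need only be checked there (\<open>biderivation_jacobi\<close>). For three pairings each double bracket is a sum over
two independent shifts, and the identity holds for each pair of shifts (\<open>nested_chord_jacobi\<close>): the
quadratic relation between signs of differences reduces the cyclic sum to terms in which an end point
is common to all three chords, and these cancel.
\<close>

text \<open>Below, \<open>$\<close> denotes matrix entries.\<close>

no_notation fps_nth (infixl \<open>$\<close> 75)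

section \<open>Chords between sites and their periodic bracket\<close>

type_synonym site = "int \<times> nat"

text \<open>A site \<open>(a, i)\<close> stands for the conjugate \<open>M_h\<^sup>a M\<^sub>i M_h\<^sup>-\<^sup>a\<close>; conjugating by \<open>M_h\<close> once more
  raises the level \<open>a\<close> by one.\<close>

definition shift :: "int \<Rightarrow> site \<Rightarrow> site" where
  "shift s I = (fst I + s, snd I)"

text \<open>The sign of \<open>I - J\<close> in the lexicographic order, so that \<open>\<epsilon>\<close> is its restriction to one level.\<close>

definition site_sgn :: "site \<Rightarrow> site \<Rightarrow> int" where
  "site_sgn I J = sgn (if fst I = fst J then int (snd I) - int (snd J) else fst I - fst J)"

text \<open>For chords \<open>{J, I}\<close> and \<open>{P, L}\<close> on a line this is twice their signed linking number; it vanishes if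
  \<open>P\<close> and \<open>L\<close> lie in the same one of the intervals cut out by \<open>J\<close> and \<open>I\<close>.\<close>

definition linking :: "site \<Rightarrow> site \<Rightarrow> site \<Rightarrow> site \<Rightarrow> int" where
  "linking J I P L = site_sgn J P - site_sgn I P - site_sgn J L + site_sgn I L"

text \<open>\<open>- Tr (M\<^sub>I M\<^sub>J)\<close> for the matrices attached to two sites: conjugation invariance of the trace leaves
  only the difference of the levels.\<close>

definition pairing :: "(int \<Rightarrow> nat \<Rightarrow> nat \<Rightarrow> 'a) \<Rightarrow> site \<Rightarrow> site \<Rightarrow> 'a" where
  "pairing G I J = G (fst J - fst I) (snd I) (snd J)"

text \<open>The bracket of Nelson and Regge on symmetric matrices indexed by a linearly ordered set, here the
  sites.\<close>

definition chord_bracket ::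
    "(int \<Rightarrow> nat \<Rightarrow> nat \<Rightarrow> 'a::comm_ring_1) \<Rightarrow> site \<Rightarrow> site \<Rightarrow> site \<Rightarrow> site \<Rightarrow> 'a" where
  "chord_bracket G J I P L = of_int (linking J I P L) *
     (pairing G P I * pairing G J L - pairing G P J * pairing G I L)"

text \<open>Pairings do not change when both sites are shifted, so their bracket has to average the chord
  bracket over all relative shifts. This one formula covers all levels at once.\<close>

definition periodic_bracket ::
    "(int \<Rightarrow> nat \<Rightarrow> nat \<Rightarrow> 'a::comm_ring_1) \<Rightarrow> site \<Rightarrow> site \<Rightarrow> site \<Rightarrow> site \<Rightarrow> 'a" where
  "periodic_bracket G J I P L = Sum_any (\<lambda>s. chord_bracket G J I (shift s P) (shift s L))"

lemma site_sgn_shift [simp]: "site_sgn (shift s I) (shift s J) = site_sgn I J"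
  by (simp add: site_sgn_def shift_def)

lemma site_sgn_skew: "site_sgn J I = - site_sgn I J"
  by (simp add: site_sgn_def sgn_if)

lemma pairing_shift [simp]: "pairing G (shift s I) (shift s J) = pairing G I J"
  by (simp add: pairing_def shift_def)

lemma pairing_sym:
  assumes "\<And>k i j. G (- k) j i = G k i j"
  shows "pairing G J I = pairing G I J"
  using assms[of "fst J - fst I" "snd J" "snd I"] by (simp add: pairing_def)

lemma shift_shift [simp]: "shift s (shift t I) = shift (s + t) I"
  by (simp add: shift_def)

lemma shift_0 [simp]: "shift 0 I = I"
  by (simp add: shift_def)

text \<open>A site whose level is outside the range of levels between \<open>J\<close> and \<open>I\<close> is on the same side of both.\<close>

lemma site_sgn_outside:
  "fst X \<notin> {min (fst J) (fst I)..max (fst J) (fst I)} \<Longrightarrow> site_sgn J X = site_sgn I X"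
  by (auto simp: site_sgn_def min_def max_def sgn_if split: if_splits)

lemma linking_supp_levels:
  assumes "linking J I X Y \<noteq> 0"
  shows "fst X \<in> {min (fst J) (fst I)..max (fst J) (fst I)} \<or> fst Y \<in> {min (fst J) (fst I)..max (fst J) (fst I)}"
  using assms site_sgn_outside[of X J I] site_sgn_outside[of Y J I] by (simp only: linking_def) linarith

text \<open>Chords that are shifted far apart are unlinked, hence the sums over shifts below are finite.\<close>

lemma linking_supp:
  assumes "s \<notin> {min (fst J) (fst I) - max (fst P) (fst L)..max (fst J) (fst I) - min (fst P) (fst L)}"
  shows "linking J I (shift s P) (shift s L) = 0"
proof (rule ccontr)
  assume "linking J I (shift s P) (shift s L) \<noteq> 0"
  from linking_supp_levels[OF this] show False
    using assms by (simp add: shift_def) linarith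
qed

lemma finite_chord_support:
  "finite {s. chord_bracket G J I (shift s P) (shift s L) \<noteq> 0}"
proof (rule finite_subset)
  show "{s. chord_bracket G J I (shift s P) (shift s L) \<noteq> 0} \<subseteq>
    {min (fst J) (fst I) - max (fst P) (fst L)..max (fst J) (fst I) - min (fst P) (fst L)}"
    using linking_supp[of _ J I P L] by (force simp: chord_bracket_def)
qed simp

text \<open>The sign jump of the site \<open>(s, p)\<close> against the end points of the chord from \<open>(0, j)\<close> to \<open>(m, i)\<close>.
  The linking number is a difference of two such jumps.\<close>

definition step_sgn :: "int \<Rightarrow> nat \<Rightarrow> nat \<Rightarrow> int \<Rightarrow> nat \<Rightarrow> int" where
  "step_sgn m j i s p = site_sgn (0, j) (s, p) - site_sgn (m, i) (s, p)"

text \<open>Splitting the linking number into the jump at \<open>P\<close> and the jump at \<open>L\<close> turns the sum over all shifts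
  into two sums over the levels \<open>0, \<dots>, m\<close> of the chord \<open>{J, I}\<close>. The second sum is re-indexed by the
  level of \<open>L\<close>.\<close>

lemma periodic_bracket_level:
  fixes G :: "int \<Rightarrow> nat \<Rightarrow> nat \<Rightarrow> 'a::comm_ring_1"
  assumes "0 \<le> m"
  shows "periodic_bracket G (0, j) (m, i) (0, p) (k, l) =
    (\<Sum>s\<in>{0..m}. of_int (step_sgn m j i s p) * (G (m - s) p i * G (k + s) j l - G (- s) p j * G (k + s - m) i l))
  - (\<Sum>s\<in>{0..m}. of_int (step_sgn m j i s l) * (G (k + m - s) p i * G s j l - G (k - s) p j * G (s - m) i l))"
proof -
  define v where "v s = G (m - s) p i * G (k + s) j l - G (- s) p j * G (k + s - m) i l" for s
  define U where "U = {-\<bar>k\<bar>-m..\<bar>k\<bar>+m}"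
  have zero: "step_sgn m j i s q = 0" if "s \<notin> {0..m}" for s q
    using that assms by (auto simp: step_sgn_def site_sgn_def sgn_if)
  have eq: "chord_bracket G (0, j) (m, i) (shift s (0, p)) (shift s (k, l)) =
     of_int (step_sgn m j i s p) * v s - of_int (step_sgn m j i (k + s) l) * v s" for s
    by (simp add: chord_bracket_def linking_def pairing_def shift_def step_sgn_def v_def algebra_simps)
  have "periodic_bracket G (0, j) (m, i) (0, p) (k, l) =
     (\<Sum>s\<in>U. of_int (step_sgn m j i s p) * v s - of_int (step_sgn m j i (k + s) l) * v s)"
    unfolding periodic_bracket_def eq
  proof (intro Sum_any.expand_superset subsetI)
    fix s assume "s \<in> {s. of_int (step_sgn m j i s p) * v s - of_int (step_sgn m j i (k + s) l) * v s \<noteq> 0}"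
    then have "s \<in> {0..m} \<or> k + s \<in> {0..m}" using zero by force
    then show "s \<in> U" by (auto simp: U_def)
  qed (simp add: U_def)
  also have "\<dots> = (\<Sum>s\<in>U. of_int (step_sgn m j i s p) * v s) - (\<Sum>s\<in>U. of_int (step_sgn m j i (k + s) l) * v s)"
    by (rule sum_subtractf)
  also have "(\<Sum>s\<in>U. of_int (step_sgn m j i s p) * v s) = (\<Sum>s\<in>{0..m}. of_int (step_sgn m j i s p) * v s)"
    by (rule sum.mono_neutral_right) (use zero in \<open>auto simp: U_def\<close>)
  also have "(\<Sum>s\<in>U. of_int (step_sgn m j i (k + s) l) * v s) = (\<Sum>s\<in>{-k..m-k}. of_int (step_sgn m j i (k + s) l) * v s)"
    by (rule sum.mono_neutral_right) (use zero assms in \<open>auto simp: U_def\<close>)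
  also have "\<dots> = (\<Sum>t\<in>{0..m}. of_int (step_sgn m j i t l) * v (t - k))"
    by (rule sum.reindex_bij_witness[of _ "\<lambda>t. t - k" "\<lambda>s. k + s"]) auto
  finally show ?thesis by (simp add: v_def algebra_simps)
qed

lemma eps_eq: "eps i j = (if i < j then - 1 else if i = j then 0 else 1)"
  by (simp add: eps_def)

lemma eps_skew: "eps j i = - (eps i j :: 'a::comm_ring_1)"
  by (simp add: eps_eq)

lemma step_sgn_simps:
  "0 < m \<Longrightarrow> of_int (step_sgn m j i 0 p) = (eps j p - 1 :: 'a::comm_ring_1)"
  "0 < m \<Longrightarrow> of_int (step_sgn m j i m p) = (- 1 - eps i p :: 'a::comm_ring_1)"
  "0 < s \<Longrightarrow> s < m \<Longrightarrow> step_sgn m j i s p = - 2"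
  "of_int (step_sgn 0 j i 0 p) = (eps j p - eps i p :: 'a::comm_ring_1)"
  by (simp_all add: step_sgn_def site_sgn_def eps_def)

lemma sum_split_ends:
  fixes f :: "int \<Rightarrow> 'a::comm_monoid_add"
  assumes "0 < m"
  shows "sum f {0..m} = f 0 + f m + sum f {1..m - 1}"
proof -
  have "{0..m} = insert 0 (insert m {1..m - 1})" using assms by auto
  then show ?thesis using assms by (simp add: add.assoc)
qed

text \<open>At the interior levels the jump is \<open>-2\<close>; the two end levels carry the only dependence on the order of
  the indices. This produces the factor 2 in front of the sums in the bracket relations.\<close>

lemma sum_step_sgn:
  fixes f :: "int \<Rightarrow> 'a::comm_ring_1"
  assumes "0 < m"
  shows "(\<Sum>s\<in>{0..m}. of_int (step_sgn m j i s p) * f s) =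
    (eps j p - 1) * f 0 - (1 + eps i p) * f m - 2 * (\<Sum>s\<in>{1..m - 1}. f s)"
proof -
  have "(\<Sum>s\<in>{1..m - 1}. of_int (step_sgn m j i s p) * f s) = (\<Sum>s\<in>{1..m - 1}. - (2 * f s))"
    by (intro sum.cong refl) (simp add: step_sgn_simps)
  then show ?thesis
    using assms by (simp add: sum_split_ends step_sgn_simps sum_negf sum_distrib_left algebra_simps)
qed

text \<open>The stated relations are the periodic bracket, written out level by level.\<close>

lemma periodic_bracket_relations:
  fixes G :: "int \<Rightarrow> nat \<Rightarrow> nat \<Rightarrow> 'a::comm_ring_1"
  assumes sym: "\<And>k i j. G (- k) j i = G k i j"
  shows "G_relations n G (\<lambda>m j i k p l. periodic_bracket G (0, j) (m, i) (0, p) (k, l))"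
proof -
  have sym0: "G 0 a b = G 0 b a" for a b using sym[of 0] by simp
  have zero: "periodic_bracket G (0, j) (0, i) (0, p) (k, l) =
          (eps j l - eps i l) * (G 0 l i * G k p j - G 0 l j * G k p i)
        + (eps j p - eps i p) * (G 0 p i * G k j l - G 0 p j * G k i l)" for j i p l k
    by (simp add: periodic_bracket_level step_sgn_simps sym0[of l] algebra_simps)
  have pos: "periodic_bracket G (0, j) (m, i) (0, p) (k, l) =
          eps i l * (G k p i * G m j l - G 0 i l * G (k - m) p j)
        + eps i p * (G m j p * G k i l - G 0 i p * G (k + m) j l)
        + eps j l * (G k p j * G m l i - G 0 j l * G (k + m) p i)
        + eps j p * (G m p i * G k j l - G 0 j p * G (k - m) i l)
        + G (k + m) p i * G 0 j l
        + 2 * (\<Sum>a\<in>{1..m - 1}. G (k + m - a) p i * G a j l)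
        + G k p i * G m j l
        - G m p i * G k j l
        - 2 * (\<Sum>a\<in>{1..m - 1}. G (m - a) p i * G (k + a) j l)
        - G 0 p i * G (k + m) j l
        + G (k - m) i l * G 0 j p
        + 2 * (\<Sum>a\<in>{1..m - 1}. G (k - m + a) i l * G a j p)
        + G k i l * G m j p
        - G 0 l i * G (k - m) p j
        - 2 * (\<Sum>a\<in>{1..m - 1}. G a l i * G (k - m + a) p j)
        - G m l i * G k p j" if "0 < m" for m k j i p l
  proof -
    have rev: "(\<Sum>a\<in>{1..m - 1}. G (k - a) p j * G (a - m) i l)
        = (\<Sum>a\<in>{1..m - 1}. G a l i * G (k - m + a) p j)"
      by (rule sum.reindex_bij_witness[of _ "\<lambda>a. m - a" "\<lambda>a. m - a"])
        (auto simp: algebra_simps sym[of "m - _" i l, simplified])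
    have flip: "(\<Sum>a\<in>{1..m - 1}. G (- a) p j * G (k + a - m) i l)
        = (\<Sum>a\<in>{1..m - 1}. G (k - m + a) i l * G a j p)"
      by (rule sum.cong) (auto simp: sym algebra_simps)
    show ?thesis
      using that
      by (simp add: periodic_bracket_level sum_step_sgn sum_subtractf rev flip sym sym0[of l i] sym0[of p i] sym0[of p j])
         (simp add: algebra_simps)
  qed
  show ?thesis unfolding G_relations_def using zero pos by (intro conjI; blast)
qed

section \<open>Coefficients of the generating functions\<close>

text \<open>The coefficients of \<open>(\<lambda>\<^sup>-\<^sup>1 + \<mu>\<^sup>-\<^sup>1) / (\<mu>\<^sup>-\<^sup>1 - \<lambda>\<^sup>-\<^sup>1)\<close> times an antisymmetric series with coefficients \<open>h\<close>:
  the quotient of \<open>y\<^sup>d - x\<^sup>d\<close> by \<open>y - x\<close> runs along an antidiagonal.\<close>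

definition ladder :: "(nat \<Rightarrow> nat \<Rightarrow> 'a::comm_ring_1) \<Rightarrow> nat \<Rightarrow> nat \<Rightarrow> 'a" where
  "ladder h m k = 2 * (\<Sum>a<m. h a (m + k - a)) + h m k"

text \<open>The coefficients of \<open>(1 + x y) / (1 - x y)\<close> times a series with coefficients \<open>f\<close>, where
  \<open>x = \<lambda>\<^sup>-\<^sup>1\<close> and \<open>y = \<mu>\<^sup>-\<^sup>1\<close>.\<close>

definition diagonal :: "(nat \<Rightarrow> nat \<Rightarrow> 'a::comm_ring_1) \<Rightarrow> nat \<Rightarrow> nat \<Rightarrow> 'a" where
  "diagonal f m k = f m k + 2 * (\<Sum>r\<in>{1..min m k}. f (m - r) (k - r))"

lemma ladder_0: "ladder h 0 k = h 0 k"
  by (simp add: ladder_def)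

lemma ladder_Suc: "ladder h (Suc m) k = ladder h m (Suc k) + h m (Suc k) + h (Suc m) k"
  by (simp add: ladder_def algebra_simps)

text \<open>The terms cancel in pairs under reversal of the antidiagonal. Over a ring of arbitrary
  characteristic only twice the sum is known to vanish.\<close>

lemma two_sum_skew:
  fixes h :: "nat \<Rightarrow> nat \<Rightarrow> 'a::comm_ring_1"
  assumes "\<And>a b. h b a = - h a b"
  shows "2 * (\<Sum>a\<in>{Suc m..<k}. h a (m + k - a)) = 0"
proof -
  have "(\<Sum>a\<in>{Suc m..<k}. h a (m + k - a)) = (\<Sum>a\<in>{Suc m..<k}. h (m + k - a) a)"
    by (rule sum.reindex_bij_witness[of _ "\<lambda>a. m + k - a" "\<lambda>a. m + k - a"]) auto
  also have "\<dots> = - (\<Sum>a\<in>{Suc m..<k}. h a (m + k - a))"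
    unfolding sum_negf[symmetric] by (intro sum.cong refl assms)
  finally show ?thesis unfolding mult_2 by (metis add.right_inverse)
qed

lemma ladder_flip_less:
  fixes h :: "nat \<Rightarrow> nat \<Rightarrow> 'a::comm_ring_1"
  assumes skew: "\<And>a b. h b a = - h a b" and "m < k"
  shows "ladder h k m = ladder h m k"
proof -
  define f where "f a = h a (m + k - a)" for a
  have "sum f {..<k} = sum f {..<m} + (f m + sum f {Suc m..<k})"
    using sum.atLeastLessThan_concat[of 0 m k f] \<open>m < k\<close>
    by (simp add: lessThan_atLeast0 sum.atLeast_Suc_lessThan)
  then have "ladder h k m = 2 * (\<Sum>a<m. h a (m + k - a)) + 2 * h m k + 2 * (\<Sum>a\<in>{Suc m..<k}. h a (m + k - a)) + h k m"
    by (simp add: ladder_def f_def distrib_left add.commute[of k m])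
  then show ?thesis
    using two_sum_skew[of h m k, OF skew] skew[where a = m and b = k]
    by (simp add: ladder_def)
qed

lemma ladder_flip:
  fixes h :: "nat \<Rightarrow> nat \<Rightarrow> 'a::comm_ring_1"
  assumes skew: "\<And>a b. h b a = - h a b"
  shows "ladder h k m = ladder h m k"
  using ladder_flip_less[of h, OF skew, of m k] ladder_flip_less[of h, OF skew, of k m]
  by (cases m k rule: linorder_cases) auto

lemma diagonal_0: "diagonal f 0 k = f 0 k" "diagonal f m 0 = f m 0"
  by (simp_all add: diagonal_def)

lemma diagonal_Suc:
  "diagonal f (Suc m) (Suc k) = diagonal f m k + f m k + f (Suc m) (Suc k)"
proof -
  have "(\<Sum>r\<in>{1..Suc (min m k)}. f (Suc m - r) (Suc k - r)) = (\<Sum>r\<in>{0..min m k}. f (m - r) (k - r))"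
    using sum.shift_bounds_cl_Suc_ivl[of "\<lambda>r. f (Suc m - r) (Suc k - r)" 0 "min m k"] by simp
  also have "\<dots> = f m k + (\<Sum>r\<in>{1..min m k}. f (m - r) (k - r))"
    by (simp add: sum.atLeast_Suc_atMost)
  finally show ?thesis by (simp add: diagonal_def algebra_simps)
qed

abbreviation lam_inv :: "'a::comm_ring_1 fls fls" where "lam_inv \<equiv> fls_const fls_X"
abbreviation mu_inv :: "'a::comm_ring_1 fls fls" where "mu_inv \<equiv> fls_X"

abbreviation coeff2 :: "'a::comm_ring_1 fls fls \<Rightarrow> int \<Rightarrow> int \<Rightarrow> 'a" where
  "coeff2 F m k \<equiv> fls_nth (fls_nth F k) m"

lemma coeff_lam_inv_times: "coeff2 (lam_inv * F) m k = coeff2 F (m - 1) k"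
  by (simp add: fls_X_times_conv_shift)

lemma coeff_mu_inv_times: "coeff2 (mu_inv * F) m k = coeff2 F m (k - 1)"
  by (simp add: fls_X_times_conv_shift)

lemma coeff_series_lam_mu:
  "coeff2 (series_lam_mu b) m k = (if 0 \<le> m \<and> 0 \<le> k then b (nat m) (nat k) else 0)"
  by (simp add: series_lam_mu_def)

lemma series_lam_mu_add: "series_lam_mu (\<lambda>m k. b m k + c m k) = series_lam_mu b + series_lam_mu c"
  by (intro fls_eqI) (simp add: coeff_series_lam_mu)

lemma series_lam_mu_diff: "series_lam_mu (\<lambda>m k. b m k - c m k) = series_lam_mu b - series_lam_mu c"
  by (intro fls_eqI) (simp add: coeff_series_lam_mu)

lemma series_lam_mu_scale: "series_lam_mu (\<lambda>m k. of_int x * b m k) = of_int x * series_lam_mu b"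
  by (intro fls_eqI) (simp add: coeff_series_lam_mu)

lemma series_lam_times_mu: "series_lam f * series_mu g = series_lam_mu (\<lambda>m k. f m * g k)"
  by (intro fls_eqI) (simp add: coeff_series_lam_mu series_lam_def series_mu_def)

text \<open>On coefficients this is the recursion along antidiagonals; the only boundary case with content is
  \<open>k = 0\<close>, where antisymmetry of \<open>h\<close> is needed for the quotient to be a power series.\<close>

lemma ladder_series:
  fixes h :: "nat \<Rightarrow> nat \<Rightarrow> 'a::comm_ring_1"
  assumes skew: "\<And>a b. h b a = - h a b"
  shows "(mu_inv - lam_inv) * series_lam_mu (ladder h) = (lam_inv + mu_inv) * series_lam_mu h"
proof (intro fls_eqI)
  fix k m :: int
  have split: "coeff2 ((mu_inv - lam_inv) * series_lam_mu (ladder h)) m k =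
      coeff2 (series_lam_mu (ladder h)) m (k - 1) - coeff2 (series_lam_mu (ladder h)) (m - 1) k"
    "coeff2 ((lam_inv + mu_inv) * series_lam_mu h) m k =
      coeff2 (series_lam_mu h) (m - 1) k + coeff2 (series_lam_mu h) m (k - 1)"
    by (simp_all only: left_diff_distrib distrib_right fls_minus_nth fls_plus_nth
        coeff_lam_inv_times coeff_mu_inv_times)
  consider "m < 0" | "k < 0" | "m = 0" "k = 0" | "m = 0" "0 < k" | "0 < m" "k = 0" | "0 < m" "0 < k" by linarith
  then show "coeff2 ((mu_inv - lam_inv) * series_lam_mu (ladder h)) m k
      = coeff2 ((lam_inv + mu_inv) * series_lam_mu h) m k"
  proof cases
    case 5
    have "ladder h (nat (m - 1)) 0 = - h (nat (m - 1)) 0"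
      using ladder_flip[of h "nat (m - 1)" 0, OF skew] skew[where b = 0 and a = "nat (m - 1)"]
      by (simp add: ladder_0)
    with 5 show ?thesis
      unfolding split by (simp add: coeff_series_lam_mu)
  next
    case 6
    have "nat m = Suc (nat (m - 1))" "nat k = Suc (nat (k - 1))" using 6 by auto
    then have "ladder h (nat m) (nat (k - 1)) = ladder h (nat (m - 1)) (nat k) + h (nat (m - 1)) (nat k) + h (nat m) (nat (k - 1))"
      by (simp only: ladder_Suc)
    with 6 show ?thesis
      unfolding split by (simp add: coeff_series_lam_mu)
  qed (unfold split, simp_all add: coeff_series_lam_mu ladder_0)
qed

lemma diagonal_series:
  "(1 - lam_inv * mu_inv) * series_lam_mu (diagonal f) = (1 + lam_inv * mu_inv) * series_lam_mu f"
proof (intro fls_eqI)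
  fix k m :: int
  have split: "coeff2 ((1 - lam_inv * mu_inv) * series_lam_mu (diagonal f)) m k =
      coeff2 (series_lam_mu (diagonal f)) m k - coeff2 (series_lam_mu (diagonal f)) (m - 1) (k - 1)"
    "coeff2 ((1 + lam_inv * mu_inv) * series_lam_mu f) m k =
      coeff2 (series_lam_mu f) m k + coeff2 (series_lam_mu f) (m - 1) (k - 1)"
    by (simp_all only: left_diff_distrib distrib_right mult_1 fls_minus_nth fls_plus_nth mult.assoc
        coeff_lam_inv_times coeff_mu_inv_times)
  consider "m < 0" | "k < 0" | "m = 0" "0 \<le> k" | "0 < m" "k = 0" | "0 < m" "0 < k" by linarith
  then show "coeff2 ((1 - lam_inv * mu_inv) * series_lam_mu (diagonal f)) m k
      = coeff2 ((1 + lam_inv * mu_inv) * series_lam_mu f) m k"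
  proof cases
    case 5
    have "nat m = Suc (nat (m - 1))" "nat k = Suc (nat (k - 1))" using 5 by auto
    then have "diagonal f (nat m) (nat k) = diagonal f (nat (m - 1)) (nat (k - 1)) + f (nat (m - 1)) (nat (k - 1)) + f (nat m) (nat k)"
      by (simp only: diagonal_Suc)
    with 5 show ?thesis unfolding split by (simp add: coeff_series_lam_mu)
  qed (unfold split, simp_all add: coeff_series_lam_mu diagonal_0)
qed

text \<open>The coefficient of \<open>\<lambda>\<^sup>-\<^sup>m \<mu>\<^sup>-\<^sup>k\<close> on the right-hand side of the generating-function identity, after
  expansion of the two kernels \<open>(\<lambda> + \<mu>) / (\<lambda> - \<mu>)\<close> and \<open>(1 + \<lambda>\<mu>) / (1 - \<lambda>\<mu>)\<close>.\<close>

definition gen_bracket :: "(int \<Rightarrow> nat \<Rightarrow> nat \<Rightarrow> 'a::comm_ring_1) \<Rightarrow>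
    nat \<Rightarrow> nat \<Rightarrow> nat \<Rightarrow> nat \<Rightarrow> nat \<Rightarrow> nat \<Rightarrow> 'a" where
  "gen_bracket G m j i k p l =
     (let c = gen_coeff G in
        eps j p * (c p i m * c j l k) + eps i l * (c p i k * c j l m)
      + eps i p * (c j p m * c i l k) + eps j l * (c l i m * c p j k)
      + ladder (\<lambda>a b. c p i b * c j l a - c p i a * c j l b) m k
      - diagonal (\<lambda>a b. c l i a * c p j b - c j p a * c i l b) m k)"

lemma gen_bracket_skew: "gen_bracket G k p l m j i = - gen_bracket G m j i k p l"
proof -
  let ?c = "gen_coeff G"
  let ?h = "\<lambda>a b. ?c p i b * ?c j l a - ?c p i a * ?c j l b"
  have "ladder (\<lambda>a b. ?c j l b * ?c p i a - ?c j l a * ?c p i b) k m = - ladder ?h k m"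
    by (simp add: ladder_def algebra_simps sum_subtractf)
  also have "ladder ?h k m = ladder ?h m k" by (rule ladder_flip) simp
  finally have l: "ladder (\<lambda>a b. ?c j l b * ?c p i a - ?c j l a * ?c p i b) k m = - ladder ?h m k" .
  have d: "diagonal (\<lambda>a b. ?c i l a * ?c j p b - ?c p j a * ?c l i b) k m
      = - diagonal (\<lambda>a b. ?c l i a * ?c p j b - ?c j p a * ?c i l b) m k"
    by (simp add: diagonal_def algebra_simps sum_subtractf min.commute)
  show ?thesis
    unfolding gen_bracket_def Let_def l d
    by (simp add: eps_skew[of p j] eps_skew[of l i] eps_skew[of l j] eps_skew[of p i] algebra_simps)
qed

text \<open>The cleared identity is linear in the products \<open>A1, \<dots>, A4\<close> of generating functions. Here \<open>w = \<lambda>\<mu>\<close>,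
  \<open>w D\<close>, \<open>w Pp\<close>, \<open>w U\<close>, \<open>w V\<close> are \<open>\<lambda> - \<mu>\<close>, \<open>\<lambda> + \<mu>\<close>, \<open>1 - \<lambda>\<mu>\<close>, \<open>1 + \<lambda>\<mu>\<close>, and \<open>Q\<close>, \<open>R\<close> are the series
  of the ladder and diagonal sums.\<close>

lemma combine_cleared:
  fixes w :: "'a::comm_ring_1"
  assumes "D * Q = Pp * (A2 - A1)" "U * R = - (V * (A4 - A3))"
  shows "w * D * (w * U) * (e1 * A1 + e2 * A2 + e3 * A3 + e4 * A4 + Q - R) =
      (e1 * (w * D) - w * Pp) * (w * U) * A1 + (e2 * (w * D) + w * Pp) * (w * U) * A2
    + (e3 * (w * U) - w * V) * (w * D) * A3 + (e4 * (w * U) + w * V) * (w * D) * A4"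
    (is "?l = ?r")
proof -
  have "?l - ?r = w * w * U * (D * Q - Pp * (A2 - A1)) - w * w * D * (U * R + V * (A4 - A3))"
    by (simp add: algebra_simps)
  then show ?thesis using assms by simp
qed

text \<open>In \<open>x = \<lambda>\<^sup>-\<^sup>1\<close> and \<open>y = \<mu>\<^sup>-\<^sup>1\<close> the identity concerns power series, and the two kernels act on them by
  the ladder and diagonal sums. All clearing factors acquire a common factor \<open>\<lambda>\<mu>\<close> in this change of variables.\<close>

lemma gen_bracket_relations:
  "gen_relations n G (gen_bracket G)"
proof -
  have "(lam - mu) * (1 - lam * mu) * series_lam_mu (\<lambda>m k. gen_bracket G m j i k p l) =
          (eps j p * (lam - mu) - (lam + mu)) * (1 - lam * mu) * series_lam (gen_coeff G p i) * series_mu (gen_coeff G j l)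
        + (eps i l * (lam - mu) + (lam + mu)) * (1 - lam * mu) * series_mu (gen_coeff G p i) * series_lam (gen_coeff G j l)
        + (eps i p * (1 - lam * mu) - (1 + lam * mu)) * (lam - mu) * series_lam (gen_coeff G j p) * series_mu (gen_coeff G i l)
        + (eps j l * (1 - lam * mu) + (1 + lam * mu)) * (lam - mu) * series_lam (gen_coeff G l i) * series_mu (gen_coeff G p j)"
    for i j p l
  proof -
    let ?c = "gen_coeff G"
    define A1 where "A1 = series_lam_mu (\<lambda>m k. ?c p i m * ?c j l k)"
    define A2 where "A2 = series_lam_mu (\<lambda>m k. ?c p i k * ?c j l m)"
    define A3 where "A3 = series_lam_mu (\<lambda>m k. ?c j p m * ?c i l k)"
    define A4 where "A4 = series_lam_mu (\<lambda>m k. ?c l i m * ?c p j k)"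
    define Q where "Q = series_lam_mu (ladder (\<lambda>a b. ?c p i b * ?c j l a - ?c p i a * ?c j l b))"
    define R where "R = series_lam_mu (diagonal (\<lambda>a b. ?c l i a * ?c p j b - ?c j p a * ?c i l b))"
    have S: "series_lam_mu (\<lambda>m k. gen_bracket G m j i k p l) =
        eps j p * A1 + eps i l * A2 + eps i p * A3 + eps j l * A4 + Q - R"
      unfolding gen_bracket_def Let_def series_lam_mu_add series_lam_mu_diff eps_def series_lam_mu_scale
        A1_def A2_def A3_def A4_def Q_def R_def ..
    have Q: "(mu_inv - lam_inv) * Q = (lam_inv + mu_inv) * (A2 - A1)"
      unfolding Q_def A1_def A2_def series_lam_mu_diff[symmetric] by (rule ladder_series) simp
    have R: "(1 - lam_inv * mu_inv) * R = (1 + lam_inv * mu_inv) * (A4 - A3)"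
      unfolding R_def A3_def A4_def series_lam_mu_diff[symmetric] by (rule diagonal_series)
    have lx: "lam * lam_inv = (1 :: 'a fls fls)"
      by (simp add: lam_def fls_X_inv_times_conv_shift)
    have my: "mu * mu_inv = (1 :: 'a fls fls)"
      by (simp add: mu_def fls_X_inv_times_conv_shift)
    let ?w = "lam * mu :: 'a fls fls"
    have "?w * (mu_inv - lam_inv) = lam * (mu * mu_inv) - mu * (lam * lam_inv)"
      "?w * (mu_inv + lam_inv) = lam * (mu * mu_inv) + mu * (lam * lam_inv)"
      "?w * (lam_inv * mu_inv - 1) = (lam * lam_inv) * (mu * mu_inv) - ?w"
      "?w * (lam_inv * mu_inv + 1) = (lam * lam_inv) * (mu * mu_inv) + ?w"
      by (simp_all only: ring_distribs mult_1_right ac_simps)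
    then have l: "lam - mu = ?w * (mu_inv - lam_inv)" and l': "lam + mu = ?w * (mu_inv + lam_inv)"
      and m: "1 - ?w = ?w * (lam_inv * mu_inv - 1)" and m': "1 + ?w = ?w * (lam_inv * mu_inv + 1)"
      by (simp_all only: lx my mult_1 mult_1_right)
    have Q': "(mu_inv - lam_inv) * Q = (mu_inv + lam_inv) * (A2 - A1)"
      using Q by (simp only: add.commute)
    have R': "(lam_inv * mu_inv - 1) * R = - ((lam_inv * mu_inv + 1) * (A4 - A3))"
      using R by (metis add.commute minus_diff_eq minus_mult_left)
    have A: "series_lam (?c p i) * series_mu (?c j l) = A1" "series_mu (?c p i) * series_lam (?c j l) = A2"
      "series_lam (?c j p) * series_mu (?c i l) = A3" "series_lam (?c l i) * series_mu (?c p j) = A4"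
      unfolding A1_def A2_def A3_def A4_def mult.commute[of "series_mu _" "series_lam _"] series_lam_times_mu
      by (simp_all add: mult.commute)
    show ?thesis
      unfolding S mult.assoc[of _ "series_lam _" "series_mu _"] mult.assoc[of _ "series_mu _" "series_lam _"] A
      unfolding l l' m m'
      by (rule combine_cleared[OF Q' R'])
  qed
  then show ?thesis by (simp add: gen_relations_def)
qed

lemma sum_nat_to_int:
  assumes "\<And>a. 1 \<le> a \<Longrightarrow> a < m \<Longrightarrow> f a = F (int a)"
  shows "(\<Sum>a\<in>{1..<m}. f a) = (\<Sum>a\<in>{1..int m - 1}. F a)"
  by (rule sum.reindex_bij_witness[of _ nat int]) (use assms in auto)

text \<open>For \<open>0 < m \<le> k\<close> the ladder and diagonal sums have \<open>m\<close> steps; splitting off the step with index \<open>0\<close>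
  leaves exactly the sums over \<open>1, \<dots>, m - 1\<close> of the bracket relations.\<close>

lemma gen_bracket_pos:
  fixes G :: "int \<Rightarrow> nat \<Rightarrow> nat \<Rightarrow> 'a::comm_ring_1"
  assumes "0 < m" "m \<le> k"
  defines "c0 \<equiv> \<lambda>a b. gen_coeff G a b 0" and "X \<equiv> \<lambda>a b. gen_coeff G a b (k - m)"
  shows "gen_bracket G m j i k p l =
      eps j p * (G m p i * G k j l) + eps i l * (G k p i * G m j l)
    + eps i p * (G m j p * G k i l) + eps j l * (G m l i * G k p j)
    + 2 * (G (k + m) p i * c0 j l) + 2 * (\<Sum>a\<in>{1..int m - 1}. G (k + m - a) p i * G a j l)
    + G k p i * G m j l
    - G m p i * G k j l - 2 * (\<Sum>a\<in>{1..int m - 1}. G (m - a) p i * G (k + a) j l)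
    - 2 * (c0 p i * G (k + m) j l)
    + 2 * (c0 j p * X i l) + 2 * (\<Sum>a\<in>{1..int m - 1}. G (k - m + a) i l * G a j p)
    + G k i l * G m j p
    - 2 * (c0 l i * X p j) - 2 * (\<Sum>a\<in>{1..int m - 1}. G a l i * G (k - m + a) p j)
    - G m l i * G k p j"
proof -
  let ?c = "gen_coeff G"
  have c: "?c a b q = G (int q) a b" if "0 < q" for a b q
    using that by (simp add: gen_coeff_def)
  define h where "h a b = ?c p i b * ?c j l a - ?c p i a * ?c j l b" for a b
  define f where "f a b = ?c l i a * ?c p j b - ?c j p a * ?c i l b" for a b
  have lad: "ladder h m k = 2 * h 0 (m + k) + 2 * (\<Sum>a\<in>{1..<m}. h a (m + k - a)) + h m k"
    using \<open>0 < m\<close> by (simp add: ladder_def lessThan_atLeast0 sum.atLeast_Suc_lessThan distrib_left)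
  have "(\<Sum>a\<in>{1..<m}. h a (m + k - a)) =
      (\<Sum>a\<in>{1..<m}. ?c p i (m + k - a) * ?c j l a) - (\<Sum>a\<in>{1..<m}. ?c p i a * ?c j l (m + k - a))"
    by (simp add: h_def sum_subtractf)
  also have "(\<Sum>a\<in>{1..<m}. ?c p i (m + k - a) * ?c j l a) = (\<Sum>a\<in>{1..int m - 1}. G (k + m - a) p i * G a j l)"
    using assms by (intro sum_nat_to_int) (simp add: c of_nat_diff algebra_simps)
  also have "(\<Sum>a\<in>{1..<m}. ?c p i a * ?c j l (m + k - a)) = (\<Sum>a\<in>{1..<m}. ?c p i (m - a) * ?c j l (k + a))"
    by (rule sum.reindex_bij_witness[of _ "\<lambda>a. m - a" "\<lambda>a. m - a"]) (auto simp: add.commute[of k m])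
  also have "\<dots> = (\<Sum>a\<in>{1..int m - 1}. G (m - a) p i * G (k + a) j l)"
    using assms by (intro sum_nat_to_int) (simp add: c of_nat_diff algebra_simps)
  finally have hsum: "(\<Sum>a\<in>{1..<m}. h a (m + k - a)) =
      (\<Sum>a\<in>{1..int m - 1}. G (k + m - a) p i * G a j l) - (\<Sum>a\<in>{1..int m - 1}. G (m - a) p i * G (k + a) j l)" .
  have dia: "diagonal f m k = f m k + 2 * f 0 (k - m) + 2 * (\<Sum>a\<in>{1..<m}. f a (k - m + a))"
  proof -
    have "(\<Sum>r\<in>{1..min m k}. f (m - r) (k - r)) = (\<Sum>a\<in>{0..<m}. f a (k - m + a))"
      by (rule sum.reindex_bij_witness[of _ "\<lambda>a. m - a" "\<lambda>a. m - a"]) (use assms in auto)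
    then show ?thesis
      using \<open>0 < m\<close> by (simp add: diagonal_def sum.atLeast_Suc_lessThan distrib_left)
  qed
  have "(\<Sum>a\<in>{1..<m}. f a (k - m + a)) =
      (\<Sum>a\<in>{1..<m}. ?c l i a * ?c p j (k - m + a)) - (\<Sum>a\<in>{1..<m}. ?c i l (k - m + a) * ?c j p a)"
    by (simp add: f_def sum_subtractf mult.commute)
  also have "(\<Sum>a\<in>{1..<m}. ?c l i a * ?c p j (k - m + a)) = (\<Sum>a\<in>{1..int m - 1}. G a l i * G (k - m + a) p j)"
    using assms by (intro sum_nat_to_int) (simp add: c of_nat_diff algebra_simps)
  also have "(\<Sum>a\<in>{1..<m}. ?c i l (k - m + a) * ?c j p a) = (\<Sum>a\<in>{1..int m - 1}. G (k - m + a) i l * G a j p)"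
    using assms by (intro sum_nat_to_int) (simp add: c of_nat_diff algebra_simps)
  finally have fsum: "(\<Sum>a\<in>{1..<m}. f a (k - m + a)) =
     (\<Sum>a\<in>{1..int m - 1}. G a l i * G (k - m + a) p j) - (\<Sum>a\<in>{1..int m - 1}. G (k - m + a) i l * G a j p)" .
  have "gen_bracket G m j i k p l =
        eps j p * (?c p i m * ?c j l k) + eps i l * (?c p i k * ?c j l m)
      + eps i p * (?c j p m * ?c i l k) + eps j l * (?c l i m * ?c p j k)
      + ladder h m k - diagonal f m k"
    by (simp add: gen_bracket_def Let_def h_def[abs_def] f_def[abs_def])
  also have "\<dots> = eps j p * (G m p i * G k j l) + eps i l * (G k p i * G m j l)
    + eps i p * (G m j p * G k i l) + eps j l * (G m l i * G k p j) + ladder h m k - diagonal f m k"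
    using assms by (simp add: c)
  finally show ?thesis
    unfolding lad dia hsum fsum unfolding h_def f_def c0_def X_def
    using assms by (simp add: c algebra_simps)
qed

text \<open>The constant term of a generating function is the half of \<open>G\<^sup>(\<^sup>0\<^sup>)\<close> above the diagonal, with half of the
  diagonal value \<open>2\<close>. The halves below and above the diagonal add up to \<open>G\<^sup>(\<^sup>0\<^sup>)\<close>, and \<open>\<epsilon>\<close> is the sign
  that distinguishes them.\<close>

lemma gen_coeff_0_split:
  assumes "G 0 b a = G 0 a b" "a = b \<Longrightarrow> G 0 a a = 2"
  shows "G 0 a b = gen_coeff G a b 0 + gen_coeff G b a 0"
    and "eps a b * G 0 a b = gen_coeff G b a 0 - gen_coeff G a b 0"
  using assms by (auto simp: gen_coeff_def eps_eq)

text \<open>It suffices to compare each bracket with \<open>gen_bracket\<close>. For \<open>0 < m \<le> k\<close> the two expressions differ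
  only in how \<open>G\<^sup>(\<^sup>0\<^sup>)\<close> is weighted, which the splitting of \<open>G\<^sup>(\<^sup>0\<^sup>)\<close> accounts for; for \<open>m = 0\<close> the constant
  terms vanish below the diagonal, and so must the bracket. Skew-symmetry gives the case \<open>k < m\<close>.\<close>

lemma gen_relations_if_G_relations:
  fixes G :: "int \<Rightarrow> nat \<Rightarrow> nat \<Rightarrow> 'a::comm_ring_1"
  assumes sym: "\<And>k i j. G (- k) j i = G k i j"
    and two: "\<And>i. i \<in> {1..n} \<Longrightarrow> G 0 i i = 2"
    and rel: "G_relations n G br"
    and skew: "\<And>m j i k p l. 0 \<le> m \<Longrightarrow> 0 \<le> k \<Longrightarrow> i \<in> {1..n} \<Longrightarrow> j \<in> {1..n} \<Longrightarrow> p \<in> {1..n} \<Longrightarrow> l \<in> {1..n} \<Longrightarrow>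
      br k p l m j i = - br m j i k p l"
    and br': "\<And>m j i k p l. i \<in> {1..n} \<Longrightarrow> j \<in> {1..n} \<Longrightarrow> p \<in> {1..n} \<Longrightarrow> l \<in> {1..n} \<Longrightarrow>
      br' m j i k p l = (if m = 0 \<and> \<not> j < i \<or> k = 0 \<and> \<not> p < l then 0 else br (int m) j i (int k) p l)"
  shows "gen_relations n G br'"
proof -
  have sym0: "G 0 a b = G 0 b a" for a b using sym[of 0] by simp
  note split = gen_coeff_0_split[of G, OF sym0 two]
  have pos: "br (int m) j i (int k) p l = gen_bracket G m j i k p l"
    if "0 < m" "m \<le> k" and ix: "i \<in> {1..n}" "j \<in> {1..n}" "p \<in> {1..n}" "l \<in> {1..n}" for m j i k p l
  proof -
    define c0 where "c0 a b = gen_coeff G a b 0" for a b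
    have G0: "G 0 a b = c0 a b + c0 b a" and eG0: "eps a b * (G 0 a b * x) = (c0 b a - c0 a b) * x"
      if "a \<in> {1..n}" "b \<in> {1..n}" for a b x
      using split[of a b] that by (simp_all add: c0_def flip: mult.assoc)
    note rel' = rel[unfolded G_relations_def, THEN conjunct2, rule_format, of "int m" "int k" i j p l]
    have "0 < int m \<and> int m \<le> int k" using that by simp
    note rel'' = rel'[OF this ix]
    show ?thesis
    proof (cases "m = k")
      case True
      then have X: "gen_coeff G a b (k - m) = c0 a b" for a b
        by (simp add: c0_def)
      show ?thesis
        unfolding rel'' gen_bracket_pos[OF that(1,2)] X c0_def[symmetric]
        using that True
        by (simp add: right_diff_distrib eG0[OF ix(1,4)] eG0[OF ix(1,3)] eG0[OF ix(2,4)] eG0[OF ix(2,3)])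
           (simp add: G0[OF ix(3,2)] G0[OF ix(1,4)] G0[OF ix(2,4)] G0[OF ix(2,3)] G0[OF ix(3,1)] G0[OF ix(4,1)] algebra_simps)
    next
      case False
      then have X: "gen_coeff G a b (k - m) = G (int k - int m) a b" for a b
        using that by (simp add: gen_coeff_def of_nat_diff)
      show ?thesis
        unfolding rel'' gen_bracket_pos[OF that(1,2)] X c0_def[symmetric]
        using that
        by (simp add: right_diff_distrib eG0[OF ix(1,4)] eG0[OF ix(1,3)] eG0[OF ix(2,4)] eG0[OF ix(2,3)])
           (simp add: G0[OF ix(2,4)] G0[OF ix(2,3)] G0[OF ix(3,1)] G0[OF ix(4,1)] algebra_simps)
    qed
  qed
  \<comment> \<open>Both weighted constant terms are zero unless \<open>q\<close> lies between \<open>j\<close> and \<open>i\<close>; for \<open>q = i = j\<close> they cancel.\<close>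
  have T: "(eps j q - 1) * (gen_coeff G q i 0 * x j) + (eps i q + 1) * (gen_coeff G j q 0 * x i) =
      (if j < i then (eps j q - eps i q) * (G 0 q i * x j - G 0 q j * x i) else 0)"
    if "i \<in> {1..n}" "j \<in> {1..n}" "q \<in> {1..n}" for i j q and x :: "nat \<Rightarrow> 'a"
    using that two sym0[of q j]
    by (cases q j rule: linorder_cases; cases q i rule: linorder_cases; cases j i rule: linorder_cases;
        simp add: gen_coeff_def eps_eq algebra_simps)
  have zero: "br' 0 j i k p l = gen_bracket G 0 j i k p l"
    if ix: "i \<in> {1..n}" "j \<in> {1..n}" "p \<in> {1..n}" "l \<in> {1..n}" for j i k p l
  proof -
    note rel' = rel[unfolded G_relations_def, THEN conjunct1, rule_format, of "int k" i j p l]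
    have gb': "gen_bracket G 0 j i k p l = (if j < i then
        (eps j p - eps i p) * (G 0 p i * gen_coeff G j l k - G 0 p j * gen_coeff G i l k)
      + (eps j l - eps i l) * (G 0 l i * gen_coeff G p j k - G 0 l j * gen_coeff G p i k) else 0)"
      if "i \<in> {1..n}" "j \<in> {1..n}" "p \<in> {1..n}" "l \<in> {1..n}" for j i k p l
    proof -
      have "gen_bracket G 0 j i k p l =
          (eps j p - 1) * (gen_coeff G p i 0 * gen_coeff G j l k) + (eps i p + 1) * (gen_coeff G j p 0 * gen_coeff G i l k)
        + ((eps j l - 1) * (gen_coeff G l i 0 * gen_coeff G p j k) + (eps i l + 1) * (gen_coeff G j l 0 * gen_coeff G p i k))"
        by (simp add: gen_bracket_def Let_def ladder_0 diagonal_0 algebra_simps)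
      then show ?thesis
        using T[of i j p "\<lambda>a. gen_coeff G a l k"] T[of i j l "\<lambda>a. gen_coeff G p a k"] that
        by simp
    qed
    consider "\<not> j < i" | "k = 0" "\<not> p < l" | "j < i" "0 < k" | "j < i" "k = 0" "p < l" by linarith
    then show ?thesis
    proof cases
      case 1
      then show ?thesis by (simp add: br'[OF ix] gb'[OF ix])
    next
      case 2
      then show ?thesis
        using gen_bracket_skew[of G k p l 0 j i] gb'[OF ix(4,3,2,1), of 0] by (simp add: br'[OF ix])
    next
      case 3
      then show ?thesis
        using rel'[OF _ ix] by (simp add: br'[OF ix] gb'[OF ix] gen_coeff_def)
    next
      case 4
      \<comment> \<open>Both sides contain the full \<open>G\<^sup>(\<^sup>0\<^sup>)\<close> in one factor; in the other factor the bracket has \<open>G\<^sup>(\<^sup>0\<^sup>)\<close> and the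
        coefficient its upper half. The contribution of the lower half vanishes.\<close>
      define c where "c a b = gen_coeff G a b 0" for a b
      have G0: "G 0 a b = c a b + c b a" if "a \<in> {1..n}" "b \<in> {1..n}" for a b
        using split[of a b] that by (simp add: c_def)
      have T': "(eps j p - eps i p) * (G 0 p i * x - G 0 p j * y) = (eps j p - 1) * (c p i * x) + (eps i p + 1) * (c j p * y)"
        if "p \<in> {1..n}" for x y p
        using T[of i j p "\<lambda>a. if a = j then x else y"] ix that 4(1) by (simp add: c_def)
      have z1: "(eps j p - 1) * (c p i * c l j) = 0" and z2: "(eps i l + 1) * (c j l * c i p) = 0"
        and z3: "(eps j l - 1) * (c l i * c j p) + (eps i p + 1) * (c j p * c l i) = 0"
        using 4 by (auto simp: c_def gen_coeff_def eps_eq)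
      have "br 0 j i 0 p l - gen_bracket G 0 j i 0 p l = 
        (eps j p - eps i p) * (G 0 p i * (G 0 j l - c j l) - G 0 p j * (G 0 i l - c i l))
      + (eps j l - eps i l) * (G 0 l i * (G 0 p j - c p j) - G 0 l j * (G 0 p i - c p i))"
        using rel'[OF _ ix] 4 by (simp add: gb'[OF ix] c_def algebra_simps)
      also have "G 0 j l - c j l = c l j" using ix by (simp add: G0)
      also have "G 0 i l - c i l = c l i" using ix by (simp add: G0)
      also have "G 0 p j - c p j = c j p" using ix by (simp add: G0)
      also have "G 0 p i - c p i = c i p" using ix by (simp add: G0)
      also have "(eps j p - eps i p) * (G 0 p i * c l j - G 0 p j * c l i)
          + (eps j l - eps i l) * (G 0 l i * c j p - G 0 l j * c i p) = 0"
        unfolding T'[OF ix(3)] T'[OF ix(4)] using z1 z2 z3 by (simp add: algebra_simps)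
      finally show ?thesis using 4 by (simp add: br'[OF ix])
    qed
  qed
  have "br' m j i k p l = gen_bracket G m j i k p l"
    if ix: "i \<in> {1..n}" "j \<in> {1..n}" "p \<in> {1..n}" "l \<in> {1..n}" for m j i k p l
  proof -
    consider "m = 0" | "k = 0" | "0 < m" "m \<le> k" | "0 < k" "k < m" by linarith
    then show ?thesis
    proof cases
      case 1
      then show ?thesis using zero[OF ix] by simp
    next
      case 2
      have "br' m j i k p l = - br' k p l m j i"
        using skew[of "int m" "int k" i j p l] ix by (simp add: br')
      then show ?thesis
        using 2 zero[OF ix(4,3,2,1)] gen_bracket_skew[of G k p l m j i] by simp
    next
      case 3
      then show ?thesis using pos[OF 3 ix] by (simp add: br'[OF ix])
    next
      case 4
      then show ?thesis
        using pos[OF 4(1) _ ix(4,3,2,1)] skew[of "int k" "int m" l p j i] gen_bracket_skew[of G k p l m j i] ix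
        by (simp add: br'[OF ix])
    qed
  qed
  then have "series_lam_mu (\<lambda>m k. br' m j i k p l) = series_lam_mu (\<lambda>m k. gen_bracket G m j i k p l)"
    if "i \<in> {1..n}" "j \<in> {1..n}" "p \<in> {1..n}" "l \<in> {1..n}" for j i p l
    using that by simp
  then show ?thesis
    using gen_bracket_relations[of n G] by (simp add: gen_relations_def Let_def)
qed

section \<open>The Korotkin--Samtleben bracket in terms of gradients\<close>

definition commutator :: "mat2 \<Rightarrow> mat2 \<Rightarrow> mat2" where
  "commutator A B = A ** B - B ** A"

lemma matrix_add_rdistrib: "(A + B) ** C = A ** C + B ** (C :: mat2)" for A B :: mat2
  by (simp add: matrix_matrix_mult_def vec_eq_iff distrib_right sum.distrib)

lemma matrix_diff_ldistrib: "A ** (B - C) = A ** B - A ** (C :: mat2)" for A B :: mat2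
  by (simp add: matrix_matrix_mult_def vec_eq_iff right_diff_distrib sum_subtractf)

lemma matrix_diff_rdistrib: "(A - B) ** C = A ** C - B ** (C :: mat2)" for A B :: mat2
  by (simp add: matrix_matrix_mult_def vec_eq_iff left_diff_distrib sum_subtractf)

lemma matrix_minus_left: "(- A) ** B = - (A ** (B :: mat2))" for A :: mat2
  by (simp add: matrix_matrix_mult_def vec_eq_iff sum_negf)

lemma matrix_minus_right: "A ** (- B) = - (A ** (B :: mat2))" for A :: mat2
  by (simp add: matrix_matrix_mult_def vec_eq_iff sum_negf)

lemma matrix_sum_left: "(\<Sum>x\<in>X. f x) ** B = (\<Sum>x\<in>X. f x ** (B :: mat2))" for f :: "'b \<Rightarrow> mat2"
  by (induction X rule: infinite_finite_induct) (simp_all add: matrix_add_rdistrib)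

lemma matrix_sum_right: "B ** (\<Sum>x\<in>X. f x) = (\<Sum>x\<in>X. B ** f x)" for f :: "'b \<Rightarrow> mat2" and B :: mat2
  by (induction X rule: infinite_finite_induct) (simp_all add: matrix_add_ldistrib)

lemma trace_minus: "trace (- A) = - trace A" for A :: mat2
  by (simp add: trace_def sum_negf)

lemma trace_zero: "trace (0 :: mat2) = 0"
  by (simp add: trace_def)

lemma trace_sum: "trace (\<Sum>x\<in>X. f x) = (\<Sum>x\<in>X. trace (f x))" for f :: "'b \<Rightarrow> mat2"
  by (induction X rule: infinite_finite_induct) (simp_all add: trace_add trace_zero)

lemma sum_pair: "(\<Sum>x\<in>UNIV. f x) = (\<Sum>a\<in>UNIV. \<Sum>c\<in>UNIV. f (a, c))"
  for f :: "2 \<times> 2 \<Rightarrow> complex"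
  by (simp add: sum.cartesian_product flip: UNIV_Times_UNIV)

lemma half_entry: "((1 / 2) *\<^sub>R X) $ r $ s = X $ r $ s / 2" for X :: mat4
  by (simp only: vector_scaleR_component) (simp add: scaleR_conv_of_real)

lemma ks_same_entry:
  "ks_same A $ (a, c) $ (b, d) =
    ((if a = d then (A ** A) $ c $ b else 0) - (if c = b then (A ** A) $ a $ d else 0)) / 2"
proof -
  have "\<forall>a c b d. ks_same A $ (a, c) $ (b, d) =
    ((if a = d then (A ** A) $ c $ b else 0) - (if c = b then (A ** A) $ a $ d else 0)) / 2"
    unfolding ks_same_def half_entry
    by (simp add: forall_2 space1_def space2_def exchange_def kron_def unit_mat_def
        mat_def matrix_matrix_mult_def sum_pair sum_2 field_simps)
  from this[rule_format] show ?thesis .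
qed

lemma ks_less_entry:
  "ks_less A B $ (a, c) $ (b, d) =
    ((if c = b then (A ** B) $ a $ d else 0) + (if a = d then (B ** A) $ c $ b else 0)
      - A $ c $ b * B $ a $ d - A $ a $ d * B $ c $ b) / 2"
proof -
  have "\<forall>a c b d. ks_less A B $ (a, c) $ (b, d) =
    ((if c = b then (A ** B) $ a $ d else 0) + (if a = d then (B ** A) $ c $ b else 0)
      - A $ c $ b * B $ a $ d - A $ a $ d * B $ c $ b) / 2"
    unfolding ks_less_def half_entry
    by (simp add: forall_2 space1_def space2_def exchange_def kron_def unit_mat_def
        mat_def matrix_matrix_mult_def sum_pair sum_2 field_simps)
  from this[rule_format] show ?thesis .
qed

text \<open>If \<open>f\<close> and \<open>h\<close> are the gradients of two functions with respect to \<open>A\<close> and \<open>B\<close>, their commutators with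
  \<open>A\<close> and \<open>B\<close> generate simultaneous conjugation. The exchange matrix turns a product of two traces into
  a trace of a product, and the four terms of the bracket assemble to these commutators.\<close>

lemma ks_less_contract:
  "(\<Sum>a\<in>UNIV. \<Sum>b\<in>UNIV. \<Sum>c\<in>UNIV. \<Sum>d\<in>UNIV. f $ b $ a * h $ d $ c * ks_less A B $ (a, c) $ (b, d)) =
    - trace (commutator A f ** commutator B h) / 2"
proof -
  define S where "S g = (\<Sum>a\<in>UNIV. \<Sum>b\<in>UNIV. \<Sum>c\<in>UNIV. \<Sum>d\<in>UNIV. f $ b $ a * h $ d $ c * g a b c d)"
    for g :: "2 \<Rightarrow> 2 \<Rightarrow> 2 \<Rightarrow> 2 \<Rightarrow> complex"
  have S_add: "S (\<lambda>a b c d. g a b c d + g' a b c d) = S g + S g'" for g g'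
    unfolding S_def distrib_left sum.distrib ..
  have S_diff: "S (\<lambda>a b c d. g a b c d - g' a b c d) = S g - S g'" for g g'
    unfolding S_def right_diff_distrib sum_subtractf ..
  have S_half: "S (\<lambda>a b c d. g a b c d / 2) = S g / 2" for g
    unfolding S_def times_divide_eq_right sum_divide_distrib ..
  have delta1: "S (\<lambda>a b c d. if c = b then X $ a $ d else 0) = trace (f ** X ** h)" for X :: mat2
    by (simp add: S_def sum_2 trace_def matrix_matrix_mult_def algebra_simps)
  have delta2: "S (\<lambda>a b c d. if a = d then X $ c $ b else 0) = trace (h ** X ** f)" for X :: mat2
    by (simp add: S_def sum_2 trace_def matrix_matrix_mult_def algebra_simps)
  have cross1: "S (\<lambda>a b c d. A $ c $ b * B $ a $ d) = trace (A ** f ** (B ** h))"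
    by (simp add: S_def sum_2 trace_def matrix_matrix_mult_def algebra_simps)
  have cross2: "S (\<lambda>a b c d. A $ a $ d * B $ c $ b) = trace (f ** A ** (h ** B))"
    by (simp add: S_def sum_2 trace_def matrix_matrix_mult_def algebra_simps)
  have cyc: "trace (A ** f ** (h ** B)) = trace (h ** (B ** A) ** f)"
    using trace_mul_sym[of "A ** f" "h ** B"] by (simp only: matrix_mul_assoc)
  have "trace (commutator A f ** commutator B h) =
      trace (A ** f ** (B ** h)) + trace (f ** A ** (h ** B)) - trace (f ** (A ** B) ** h) - trace (h ** (B ** A) ** f)"
    unfolding cyc[symmetric] commutator_def matrix_diff_ldistrib matrix_diff_rdistrib trace_sub
    by (simp add: matrix_mul_assoc)
  moreover have "S (\<lambda>a b c d. ks_less A B $ (a, c) $ (b, d)) =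
      (trace (f ** (A ** B) ** h) + trace (h ** (B ** A) ** f) - trace (A ** f ** (B ** h)) - trace (f ** A ** (h ** B))) / 2"
    unfolding ks_less_entry S_half S_diff S_add delta1 delta2 cross1 cross2 ..
  moreover have "(t3 + t4 - t1 - t2) / 2 = - (t1 + t2 - t3 - t4) / 2" for t1 t2 t3 t4 :: complex
    by simp
  ultimately show ?thesis by (simp only: S_def)
qed

text \<open>On the surface \<open>Tr A = 0\<close>, \<open>det A = 1\<close> the square of \<open>A\<close> is \<open>-1\<close>, and the two terms of the bracket of \<open>A\<close>
  with itself cancel.\<close>

lemma ks_same_contract:
  assumes "A ** A = - mat 1"
  shows "(\<Sum>a\<in>UNIV. \<Sum>b\<in>UNIV. \<Sum>c\<in>UNIV. \<Sum>d\<in>UNIV. f $ b $ a * h $ d $ c * ks_same A $ (a, c) $ (b, d)) = 0"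
  unfolding ks_same_entry assms by (simp add: sum_2 mat_def)

lemma ks_entry_contract:
  assumes "M i ** M i = - mat 1"
  shows "(\<Sum>a\<in>UNIV. \<Sum>b\<in>UNIV. \<Sum>c\<in>UNIV. \<Sum>d\<in>UNIV. f $ b $ a * h $ d $ c * ks_entry M i a b j c d) =
    eps i j * trace (commutator (M i) f ** commutator (M j) h) / 2"
proof (cases i j rule: linorder_cases)
  case greater
  have "(\<Sum>a\<in>UNIV. \<Sum>b\<in>UNIV. \<Sum>c\<in>UNIV. \<Sum>d\<in>UNIV. f $ b $ a * h $ d $ c * ks_entry M i a b j c d) =
    - (\<Sum>c\<in>UNIV. \<Sum>d\<in>UNIV. \<Sum>a\<in>UNIV. \<Sum>b\<in>UNIV. h $ d $ c * f $ b $ a * ks_less (M j) (M i) $ (c, a) $ (d, b))"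
    using greater by (simp add: ks_entry_def sum_2 mult.commute[of "h $ _ $ _" "f $ _ $ _"])
  also have "\<dots> = trace (commutator (M j) h ** commutator (M i) f) / 2"
    unfolding ks_less_contract by simp
  also have "trace (commutator (M j) h ** commutator (M i) f) = trace (commutator (M i) f ** commutator (M j) h)"
    by (rule trace_mul_sym)
  finally show ?thesis using greater by (simp add: eps_eq)
qed (use ks_less_contract[of f h "M i" "M j"] ks_same_contract[OF assms, of f h] in \<open>simp_all add: ks_entry_def eps_eq\<close>)

text \<open>The whole bracket is the antisymmetric sum of traces of products of commutators, without diagonal
  terms.\<close>

lemma ks_bracket_gradient:
  assumes f: "\<And>i a b. i \<in> {1..r} \<Longrightarrow> entry_deriv F i a b M = f i $ b $ a"
    and h: "\<And>i a b. i \<in> {1..r} \<Longrightarrow> entry_deriv H i a b M = h i $ b $ a"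
    and sq: "\<And>i. i \<in> {1..r} \<Longrightarrow> M i ** M i = - mat 1"
  shows "ks_bracket r F H M =
    (\<Sum>i\<in>{1..r}. \<Sum>j\<in>{1..r}. eps i j * trace (commutator (M i) (f i) ** commutator (M j) (h j))) / 2"
proof -
  have "ks_bracket r F H M = (\<Sum>i\<in>{1..r}. \<Sum>j\<in>{1..r}. \<Sum>a\<in>UNIV. \<Sum>b\<in>UNIV. \<Sum>c\<in>UNIV. \<Sum>d\<in>UNIV.
     f i $ b $ a * h j $ d $ c * ks_entry M i a b j c d)"
    unfolding ks_bracket_def by (intro sum.cong refl) (simp add: f h)
  also have "\<dots> = (\<Sum>i\<in>{1..r}. \<Sum>j\<in>{1..r}. eps i j * trace (commutator (M i) (f i) ** commutator (M j) (h j)) / 2)"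
    by (intro sum.cong refl) (simp add: ks_entry_contract sq)
  finally show ?thesis by (simp add: sum_divide_distrib)
qed

section \<open>Derivatives of matrix-valued functions\<close>

definition mat_deriv :: "(complex \<Rightarrow> mat2) \<Rightarrow> mat2 \<Rightarrow> complex \<Rightarrow> bool" where
  "mat_deriv X X' t \<longleftrightarrow> (\<forall>a b. ((\<lambda>t. X t $ a $ b) has_field_derivative X' $ a $ b) (at t))"

lemma mat_deriv_const: "mat_deriv (\<lambda>_. A) 0 t"
  by (simp add: mat_deriv_def)

lemma mat_deriv_mult:
  assumes "mat_deriv X X' t" "mat_deriv Y Y' t"
  shows "mat_deriv (\<lambda>t. X t ** Y t) (X' ** Y t + X t ** Y') t"
  using assms unfolding mat_deriv_def matrix_matrix_mult_def
  by (auto simp: sum_2 intro!: derivative_eq_intros)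

lemma mat_deriv_trace:
  assumes "mat_deriv X X' t"
  shows "((\<lambda>t. trace (X t)) has_field_derivative trace X') (at t)"
  using assms unfolding mat_deriv_def trace_def by (auto simp: sum_2 intro!: derivative_eq_intros)

lemma mat_deriv_unique:
  assumes "mat_deriv X A t" "mat_deriv X B t"
  shows "A = B"
  using assms unfolding mat_deriv_def vec_eq_iff by (metis DERIV_unique)

lemma matrix_inv_eqI:
  fixes A B :: mat2
  assumes "A ** B = mat 1"
  shows "matrix_inv A = B"
proof -
  have "B ** A = mat 1" using assms by (rule matrix_left_right_inverse[THEN iffD1])
  then have "A ** matrix_inv A = mat 1"
    using assms unfolding matrix_inv_def by (rule_tac someI2[of _ B]) auto
  then have "B ** (A ** matrix_inv A) = B" by simp
  then show ?thesis using \<open>B ** A = mat 1\<close> by (simp add: matrix_mul_assoc)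
qed

definition adjugate :: "mat2 \<Rightarrow> mat2" where
  "adjugate A = (\<chi> a b. if a = b then trace A - A $ a $ a else - A $ a $ b)"

lemma mult_adjugate: "A ** adjugate A = (\<chi> a b. det A * mat 1 $ a $ b)"
  by (simp add: vec_eq_iff forall_2 adjugate_def matrix_matrix_mult_def trace_def sum_2 det_2 mat_def algebra_simps)

lemma matrix_inv_2:
  assumes "det A \<noteq> 0"
  shows "matrix_inv A = (\<chi> a b. adjugate A $ a $ b / det A)"
proof (rule matrix_inv_eqI)
  have "A ** (\<chi> a b. adjugate A $ a $ b / det A) = (\<chi> a b. (A ** adjugate A) $ a $ b / det A)"
    by (simp add: vec_eq_iff matrix_matrix_mult_def sum_divide_distrib)
  also have "\<dots> = mat 1" using assms by (simp add: mult_adjugate vec_eq_iff)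
  finally show "A ** (\<chi> a b. adjugate A $ a $ b / det A) = mat 1" .
qed

lemma matrix_inv_right: "det A \<noteq> 0 \<Longrightarrow> A ** matrix_inv A = mat 1" for A :: mat2
  using mult_adjugate[of A] by (simp add: matrix_inv_2 vec_eq_iff matrix_matrix_mult_def flip: sum_divide_distrib)

lemma matrix_inv_left: "det A \<noteq> 0 \<Longrightarrow> matrix_inv A ** A = mat 1" for A :: mat2
  using matrix_inv_right matrix_left_right_inverse by blast

text \<open>Cramer's rule shows that the entries of the inverse are differentiable; the product rule applied to
  \<open>X X\<^sup>-\<^sup>1 = 1\<close> then determines the derivative.\<close>

lemma mat_deriv_inverse:
  assumes X: "mat_deriv X X' t" and nz: "det (X t) \<noteq> 0"
  shows "mat_deriv (\<lambda>t. matrix_inv (X t)) (- (matrix_inv (X t) ** X' ** matrix_inv (X t))) t"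
proof -
  have dx: "((\<lambda>t. X t $ a $ b) has_field_derivative X' $ a $ b) (at t)" for a b
    using X by (simp add: mat_deriv_def)
  have det: "(\<lambda>t. det (X t)) field_differentiable at t"
    unfolding det_2 field_differentiable_def by (rule exI) (rule derivative_eq_intros dx refl)+
  then have "isCont (\<lambda>t. det (X t)) t" by (rule field_differentiable_imp_continuous_at)
  then have ev: "\<forall>\<^sub>F t in nhds t. det (X t) \<noteq> 0"
    using nz by (simp add: isCont_def tendsto_imp_eventually_ne eventually_nhds_conv_at)
  have "\<exists>D. ((\<lambda>t. matrix_inv (X t) $ a $ b) has_field_derivative D) (at t)" for a b
  proof -
    have adj: "(\<lambda>t. adjugate (X t) $ a $ b) field_differentiable at t"
      unfolding adjugate_def trace_def sum_2 field_differentiable_def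
      by (cases "a = b"; simp; rule exI; (rule derivative_eq_intros dx refl)+)
    have "(\<lambda>t. adjugate (X t) $ a $ b / det (X t)) field_differentiable at t"
      using adj det nz by (rule field_differentiable_divide)
    then obtain D where "((\<lambda>t. adjugate (X t) $ a $ b / det (X t)) has_field_derivative D) (at t)"
      by (auto simp: field_differentiable_def)
    moreover have "\<forall>\<^sub>F t in nhds t. matrix_inv (X t) $ a $ b = adjugate (X t) $ a $ b / det (X t)"
      using ev by eventually_elim (simp add: matrix_inv_2)
    note DERIV_cong_ev[OF refl this refl, THEN iffD2]
    ultimately show ?thesis by auto
  qed
  then obtain D where D: "\<And>a b. ((\<lambda>t. matrix_inv (X t) $ a $ b) has_field_derivative D a b) (at t)"
    by metis
  define Y' :: mat2 where "Y' = (\<chi> a b. D a b)"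
  have Y: "mat_deriv (\<lambda>t. matrix_inv (X t)) Y' t" by (simp add: mat_deriv_def Y'_def D)
  have "mat_deriv (\<lambda>t. X t ** matrix_inv (X t)) (X' ** matrix_inv (X t) + X t ** Y') t"
    by (rule mat_deriv_mult[OF X Y])
  moreover have "mat_deriv (\<lambda>t. X t ** matrix_inv (X t)) 0 t"
    unfolding mat_deriv_def
  proof (intro allI)
    fix a b
    have "\<forall>\<^sub>F t in nhds t. (X t ** matrix_inv (X t)) $ a $ b = (mat 1 :: mat2) $ a $ b"
      using ev by eventually_elim (simp add: matrix_inv_right)
    then show "((\<lambda>t. (X t ** matrix_inv (X t)) $ a $ b) has_field_derivative (0 :: mat2) $ a $ b) (at t)"
      by (subst DERIV_cong_ev) auto
  qed
  ultimately have "X' ** matrix_inv (X t) + X t ** Y' = 0" by (rule mat_deriv_unique)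
  then have "matrix_inv (X t) ** (X' ** matrix_inv (X t) + X t ** Y') = 0" by simp
  then have "matrix_inv (X t) ** X' ** matrix_inv (X t) + Y' = 0"
    by (simp add: matrix_add_ldistrib matrix_mul_assoc matrix_inv_left[OF nz])
  then have "Y' = - (matrix_inv (X t) ** X' ** matrix_inv (X t))" by (simp add: eq_neg_iff_add_eq_0 add.commute)
  with Y show ?thesis by simp
qed

abbreviation matrix_pow :: "mat2 \<Rightarrow> nat \<Rightarrow> mat2" where
  "matrix_pow A k \<equiv> (((**) A) ^^ k) (mat 1)"

lemma matrix_powi_of_nat: "matrix_powi A (int k) = matrix_pow A k"
  by (simp add: matrix_powi_def)

lemma matrix_powi_minus_of_nat: "matrix_powi A (- int k) = matrix_pow (matrix_inv A) k"
  by (cases "k = 0") (simp_all add: matrix_powi_def)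

lemma matrix_powi_0 [simp]: "matrix_powi A 0 = mat 1"
  by (simp add: matrix_powi_def)

lemma matrix_powi_Suc:
  assumes "det A \<noteq> 0"
  shows "matrix_powi A (k + 1) = A ** matrix_powi A k"
proof (cases "0 \<le> k")
  case True
  then obtain j where "k = int j" using nonneg_int_cases by blast
  moreover have "int j + 1 = int (Suc j)" by simp
  ultimately show ?thesis by (simp only: matrix_powi_of_nat) simp
next
  case False
  then obtain j where k: "k = - int (Suc j)" by (cases k) auto
  then have k1: "k + 1 = - int j" by simp
  show ?thesis
    unfolding k1 unfolding k matrix_powi_minus_of_nat
    by (simp add: matrix_mul_assoc matrix_inv_right[OF assms])
qed

lemma matrix_powi_add:
  assumes "det A \<noteq> 0"
  shows "matrix_powi A (a + b) = matrix_powi A a ** matrix_powi A b"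
proof (induction a rule: int_induct[where k = 0])
  case base
  then show ?case by simp
next
  case (step1 a)
  have "matrix_powi A (a + 1 + b) = A ** matrix_powi A (a + b)"
    using matrix_powi_Suc[OF assms, of "a + b"] by (simp add: ac_simps)
  then show ?case using step1 by (simp add: matrix_powi_Suc[OF assms] matrix_mul_assoc)
next
  case (step2 a)
  have "A ** matrix_powi A (a - 1 + b) = A ** (matrix_powi A (a - 1) ** matrix_powi A b)"
    using step2 matrix_powi_Suc[OF assms, of "a - 1 + b"] matrix_powi_Suc[OF assms, of "a - 1"]
    by (simp add: matrix_mul_assoc)
  then have "matrix_inv A ** (A ** matrix_powi A (a - 1 + b)) = matrix_inv A ** (A ** (matrix_powi A (a - 1) ** matrix_powi A b))"
    by simp
  then show ?case by (simp add: matrix_mul_assoc matrix_inv_left[OF assms])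
qed

lemma matrix_powi_collapse:
  assumes "det A \<noteq> 0"
  shows "matrix_powi A a ** matrix_powi A b = matrix_powi A (a + b)"
    and "X ** matrix_powi A a ** matrix_powi A b = X ** matrix_powi A (a + b)"
  by (simp_all add: matrix_powi_add[OF assms] matrix_mul_assoc)

lemma matrix_powi_1: "det A \<noteq> 0 \<Longrightarrow> A = matrix_powi A 1"
  using matrix_powi_Suc[of A 0] by simp

lemma matrix_inv_powi: "matrix_inv A = matrix_powi A (- 1)"
  using matrix_powi_minus_of_nat[of A 1] by simp

lemma mat_deriv_pow:
  assumes "mat_deriv X X' t"
  shows "mat_deriv (\<lambda>t. matrix_pow (X t) k) (\<Sum>s<k. matrix_pow (X t) s ** X' ** matrix_pow (X t) (k - 1 - s)) t"
proof (induction k)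
  case 0
  then show ?case by (simp add: mat_deriv_const)
next
  case (Suc k)
  have "(\<Sum>s<Suc k. matrix_pow (X t) s ** X' ** matrix_pow (X t) (Suc k - 1 - s)) =
      X' ** matrix_pow (X t) k + X t ** (\<Sum>s<k. matrix_pow (X t) s ** X' ** matrix_pow (X t) (k - 1 - s))"
    unfolding sum.lessThan_Suc_shift by (simp add: matrix_sum_right matrix_mul_assoc)
  with mat_deriv_mult[OF assms Suc] show ?case by simp
qed

lemma trace_sum_sandwich:
  fixes A B X' :: mat2
  shows
  "trace (A ** (\<Sum>s\<in>S. f s ** X' ** g s) ** B) = trace (X' ** (\<Sum>s\<in>S. g s ** B ** A ** f s))"
proof -
  have "trace (A ** (f s ** X' ** g s) ** B) = trace (X' ** (g s ** B ** A ** f s))" for s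
    using trace_mul_sym[of "A ** f s" "X' ** g s ** B"] by (simp add: matrix_mul_assoc)
  then show ?thesis by (simp add: matrix_sum_left matrix_sum_right trace_sum)
qed

text \<open>The derivative in \<open>H\<close> is obtained by moving each occurrence of \<open>H'\<close> to the front of the trace. The
  contributions of \<open>H\<^sup>k\<close> and of \<open>H\<^sup>-\<^sup>k\<close> combine to a commutator.\<close>

lemma trace_powi_deriv:
  fixes k :: nat
  assumes X: "mat_deriv X X' t" and Y: "mat_deriv Y Y' t" and H: "mat_deriv H H' t" and nz: "det (H t) \<noteq> 0"
  defines "P \<equiv> matrix_powi (H t)"
  defines "Yk \<equiv> P (int k) ** Y t ** P (- int k)"
  shows "((\<lambda>t. - trace (X t ** matrix_powi (H t) (int k) ** Y t ** matrix_powi (H t) (- int k)))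
    has_field_derivative
      trace (X' ** (- Yk)) + trace (Y' ** (- (P (- int k) ** X t ** P (int k))))
      + trace (H' ** (- (\<Sum>s<k. P (- 1 - int s) ** commutator Yk (X t) ** P (int s))))) (at t)"
proof -
  let ?Q = "matrix_inv (H t)"
  \<comment> \<open>The derivatives of \<open>H\<^sup>k\<close> and \<open>H\<^sup>-\<^sup>k\<close>.\<close>
  define DP where "DP = (\<Sum>s<k. P (int s) ** H' ** P (int k - 1 - int s))"
  define DQ where "DQ = - (\<Sum>s<k. P (- 1 - int s) ** H' ** P (int s - int k))"
  note collapse = matrix_powi_collapse[OF nz, folded P_def]
  have P: "mat_deriv (\<lambda>t. matrix_powi (H t) (int k)) DP t"
  proof -
    have "(\<Sum>s<k. matrix_pow (H t) s ** H' ** matrix_pow (H t) (k - 1 - s)) = DP"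
      unfolding DP_def P_def by (rule sum.cong) (simp_all add: of_nat_diff diff_diff_eq flip: matrix_powi_of_nat)
    then show ?thesis using mat_deriv_pow[OF H, of k] by (simp add: matrix_powi_of_nat)
  qed
  have Q: "mat_deriv (\<lambda>t. matrix_powi (H t) (- int k)) DQ t"
  proof -
    have "matrix_pow ?Q s ** (- (?Q ** H' ** ?Q)) ** matrix_pow ?Q (k - 1 - s) =
        - (P (- 1 - int s) ** H' ** P (int s - int k))" if "s < k" for s
    proof -
      have "int s - int k = - 1 + (- int (k - 1 - s))" "- 1 - int s = - int s + - 1" using that by auto
      then show ?thesis
        by (simp only: P_def matrix_powi_add[OF nz] flip: matrix_powi_minus_of_nat matrix_inv_powi)
          (simp add: matrix_mul_assoc matrix_minus_left matrix_minus_right matrix_inv_powi)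
    qed
    then have "(\<Sum>s<k. matrix_pow ?Q s ** (- (?Q ** H' ** ?Q)) ** matrix_pow ?Q (k - 1 - s)) = DQ"
      unfolding DQ_def sum_negf[symmetric] by (intro sum.cong) auto
    then show ?thesis
      using mat_deriv_pow[OF mat_deriv_inverse[OF H nz], of k] by (simp add: matrix_powi_minus_of_nat)
  qed
  have "mat_deriv (\<lambda>t. X t ** matrix_powi (H t) (int k) ** Y t ** matrix_powi (H t) (- int k))
     (((X' ** P (int k) + X t ** DP) ** Y t + X t ** P (int k) ** Y') ** P (- int k)
       + X t ** P (int k) ** Y t ** DQ) t"
    unfolding P_def by (intro mat_deriv_mult X Y P Q)
  then have "((\<lambda>t. - trace (X t ** matrix_powi (H t) (int k) ** Y t ** matrix_powi (H t) (- int k)))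
    has_field_derivative - trace (((X' ** P (int k) + X t ** DP) ** Y t + X t ** P (int k) ** Y') ** P (- int k)
       + X t ** P (int k) ** Y t ** DQ)) (at t)"
    by (intro DERIV_minus mat_deriv_trace)
  moreover have "trace (((X' ** P (int k) + X t ** DP) ** Y t + X t ** P (int k) ** Y') ** P (- int k)
       + X t ** P (int k) ** Y t ** DQ) =
     trace (X' ** Yk) + trace (Y' ** (P (- int k) ** X t ** P (int k)))
      + trace (H' ** (\<Sum>s<k. P (- 1 - int s) ** commutator Yk (X t) ** P (int s)))"
  proof -
    have x: "trace (X' ** P (int k) ** Y t ** P (- int k)) = trace (X' ** Yk)"
      by (simp add: Yk_def matrix_mul_assoc)
    have y: "trace (X t ** P (int k) ** Y' ** P (- int k)) = trace (Y' ** (P (- int k) ** X t ** P (int k)))"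
      using trace_mul_sym[of "X t ** P (int k)" "Y' ** P (- int k)"] by (simp add: matrix_mul_assoc)
    have "trace (X t ** DP ** (Y t ** P (- int k))) =
        trace (H' ** (\<Sum>s<k. P (int k - 1 - int s) ** (Y t ** P (- int k)) ** X t ** P (int s)))"
      unfolding DP_def by (rule trace_sum_sandwich)
    also have "(\<Sum>s<k. P (int k - 1 - int s) ** (Y t ** P (- int k)) ** X t ** P (int s)) =
        (\<Sum>s<k. P (- 1 - int s) ** (Yk ** X t) ** P (int s))"
      by (simp add: Yk_def matrix_mul_assoc collapse algebra_simps)
    finally have h1: "trace (X t ** DP ** Y t ** P (- int k)) =
        trace (H' ** (\<Sum>s<k. P (- 1 - int s) ** (Yk ** X t) ** P (int s)))"
      by (simp add: matrix_mul_assoc)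
    have "trace (X t ** P (int k) ** Y t ** (\<Sum>s<k. P (- 1 - int s) ** H' ** P (int s - int k)) ** mat 1) =
        trace (H' ** (\<Sum>s<k. P (int s - int k) ** mat 1 ** (X t ** P (int k) ** Y t) ** P (- 1 - int s)))"
      by (rule trace_sum_sandwich)
    also have "(\<Sum>s<k. P (int s - int k) ** mat 1 ** (X t ** P (int k) ** Y t) ** P (- 1 - int s)) =
        (\<Sum>s<k. P (- 1 - int s) ** (X t ** Yk) ** P (int s))"
      by (rule sum.reindex_bij_witness[of _ "\<lambda>s. k - 1 - s" "\<lambda>s. k - 1 - s"])
        (auto simp: Yk_def matrix_mul_assoc collapse of_nat_diff algebra_simps)
    finally have h2: "trace (X t ** P (int k) ** Y t ** DQ) =
        - trace (H' ** (\<Sum>s<k. P (- 1 - int s) ** (X t ** Yk) ** P (int s)))"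
      by (simp add: DQ_def matrix_minus_right trace_minus)
    have "(\<Sum>s<k. P (- 1 - int s) ** commutator Yk (X t) ** P (int s)) =
        (\<Sum>s<k. P (- 1 - int s) ** (Yk ** X t) ** P (int s)) - (\<Sum>s<k. P (- 1 - int s) ** (X t ** Yk) ** P (int s))"
      by (simp add: commutator_def matrix_diff_ldistrib matrix_diff_rdistrib sum_subtractf)
    then show ?thesis
      by (simp add: matrix_add_rdistrib trace_add x y h1 h2 matrix_diff_ldistrib trace_sub)
  qed
  ultimately show ?thesis by (simp add: matrix_minus_right trace_minus)
qed

definition matrix_prod :: "point \<Rightarrow> nat list \<Rightarrow> mat2" where
  "matrix_prod M xs = foldr (\<lambda>i A. M i ** A) xs (mat 1)"

lemma M_h_eq: "M_h n N M = matrix_prod M [n + 1..<n + N + 1]"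
  by (simp add: M_h_def matrix_prod_def)

lemma matrix_prod_simps [simp]:
  "matrix_prod M [] = mat 1" "matrix_prod M (i # xs) = M i ** matrix_prod M xs"
  by (simp_all add: matrix_prod_def)

lemma matrix_prod_append: "matrix_prod M (xs @ ys) = matrix_prod M xs ** matrix_prod M ys"
  by (induction xs) (simp_all add: matrix_mul_assoc)

lemma matrix_prod_set_entry: "q \<notin> set xs \<Longrightarrow> matrix_prod (set_entry M q a b t) xs = matrix_prod M xs"
  by (induction xs) (auto simp: set_entry_def)

lemma det_matrix_prod: "(\<And>i. i \<in> set xs \<Longrightarrow> det (M i) = 1) \<Longrightarrow> det (matrix_prod M xs) = 1"
  by (induction xs) (simp_all add: det_mul)

lemma set_entry_self: "set_entry M q a b (M q $ a $ b) = M"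
  by (auto simp: set_entry_def vec_eq_iff)

lemma mat_deriv_set_entry:
  "mat_deriv (\<lambda>t. set_entry M q a b t i) (if i = q then unit_mat a b else 0) t"
  by (auto simp: mat_deriv_def set_entry_def unit_mat_def)

lemma trace_unit_mat: "trace (unit_mat a b ** Z) = Z $ b $ a"
proof -
  have "\<forall>a b. trace (unit_mat a b ** Z) = Z $ b $ a"
    by (simp add: forall_2 trace_def unit_mat_def matrix_matrix_mult_def sum_2)
  then show ?thesis by simp
qed

text \<open>Only one factor of the ordered product depends on the entry that is varied.\<close>

lemma mat_deriv_M_h:
  "mat_deriv (\<lambda>t. M_h n N (set_entry M q a b t))
    (if q \<in> {n + 1..n + N} then matrix_prod M [n + 1..<q] ** unit_mat a b ** matrix_prod M [q + 1..<n + N + 1] else 0) t"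
proof (cases "q \<in> {n + 1..n + N}")
  case True
  have "[n + 1..<n + N + 1] = [n + 1..<q] @ q # [q + 1..<n + N + 1]"
    using True upt_add_eq_append[of "n + 1" q "n + N + 1 - q"] by (auto simp: upt_conv_Cons)
  then have "M_h n N (set_entry M q a b t) =
      matrix_prod M [n + 1..<q] ** (set_entry M q a b t q ** matrix_prod M [q + 1..<n + N + 1])" for t
    by (simp add: M_h_eq matrix_prod_append matrix_prod_set_entry del: upt_Suc)
  moreover have "mat_deriv (\<lambda>t. matrix_prod M [n + 1..<q] ** (set_entry M q a b t q ** matrix_prod M [q + 1..<n + N + 1]))
     (0 ** (set_entry M q a b t q ** matrix_prod M [q + 1..<n + N + 1])
      + matrix_prod M [n + 1..<q] ** ((if q = q then unit_mat a b else 0) ** matrix_prod M [q + 1..<n + N + 1] + set_entry M q a b t q ** 0)) t"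
    by (intro mat_deriv_mult mat_deriv_const mat_deriv_set_entry)
  ultimately show ?thesis using True by (simp add: matrix_mul_assoc)
next
  case False
  then have "M_h n N (set_entry M q a b t) = M_h n N M" for t
    unfolding M_h_eq by (intro matrix_prod_set_entry) auto
  then show ?thesis unfolding if_not_P[OF False] by (simp add: mat_deriv_const)
qed

section \<open>The bracket of the trace functions\<close>

lemma G_fun_flip: "G_fun n N (- k) j i M = G_fun n N k i j M"
  using trace_mul_sym[of "M j ** matrix_powi (M_h n N M) (- k)" "M i ** matrix_powi (M_h n N M) k"]
  by (simp add: G_fun_def matrix_mul_assoc)

lemma square_minus_one:
  fixes A :: mat2
  assumes "trace A = 0" "det A = 1"
  shows "A ** A = - mat 1"
proof -
  have t: "A $ 2 $ 2 = - (A $ 1 $ 1)" using assms(1) by (simp add: trace_def sum_2 eq_neg_iff_add_eq_0 add.commute)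
  have "A $ 1 $ 1 * A $ 1 $ 1 + A $ 1 $ 2 * A $ 2 $ 1 = - 1"
  proof -
    have "A $ 1 $ 1 * A $ 1 $ 1 + A $ 1 $ 2 * A $ 2 $ 1 = - (A $ 1 $ 1 * A $ 2 $ 2 - A $ 1 $ 2 * A $ 2 $ 1)"
      by (simp add: t)
    also have "A $ 1 $ 1 * A $ 2 $ 2 - A $ 1 $ 2 * A $ 2 $ 1 = 1" using assms(2) by (simp only: det_2)
    finally show ?thesis .
  qed
  moreover from this have "A $ 2 $ 1 * A $ 1 $ 2 + A $ 1 $ 1 * A $ 1 $ 1 = - 1"
    by (simp only: ac_simps)
  ultimately show ?thesis
    by (simp add: vec_eq_iff forall_2 matrix_matrix_mult_def sum_2 mat_def t
        mult.commute[of "A $ 1 $ 2" "A $ 1 $ 1"] mult.commute[of "A $ 2 $ 1" "A $ 1 $ 1"])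
qed

text \<open>For traceless matrices this is the identity
  \<open>(a \<times> b) \<cdot> (c \<times> d) = (a \<cdot> c) (b \<cdot> d) - (a \<cdot> d) (b \<cdot> c)\<close> for the cross product.\<close>

lemma trace_commutators:
  fixes A B C D :: mat2
  assumes "trace A = 0" "trace B = 0" "trace C = 0" "trace D = 0"
  shows "trace (commutator A B ** commutator C D) =
    2 * (trace (A ** D) * trace (B ** C) - trace (A ** C) * trace (B ** D))"
proof -
  have t: "X $ 2 $ 2 = - (X $ 1 $ 1)" if "trace X = 0" for X :: mat2
    using that by (simp add: trace_def sum_2 eq_neg_iff_add_eq_0 add.commute)
  show ?thesis
    by (simp add: commutator_def trace_def sum_2 matrix_matrix_mult_def assms[THEN t]) (simp add: algebra_simps)
qed

text \<open>If neighbouring entries of \<open>b\<close> are symmetric, a double sum of its mixed differences, weighted by the sign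
  of \<open>q - q'\<close>, collapses to two corners: the factors of \<open>M_h\<close> act together like the single matrix \<open>M_h\<close>.\<close>

lemma eps_sum_telescope:
  fixes b :: "nat \<Rightarrow> nat \<Rightarrow> complex"
  assumes "\<And>q. q \<in> {n + 1..n + N} \<Longrightarrow> b q (q + 1) = b (q + 1) q"
  shows "(\<Sum>q\<in>{n + 1..n + N}. \<Sum>q'\<in>{n + 1..n + N}.
      eps q q' * (b q q' - b q (q' + 1) - b (q + 1) q' + b (q + 1) (q' + 1)))
    = b (n + 1) (n + N + 1) - b (n + N + 1) (n + 1)"
  using assms
proof (induction N)
  case 0
  then show ?case by simp
next
  case (Suc N)
  define w where "w q q' = b q q' - b q (q' + 1) - b (q + 1) q' + b (q + 1) (q' + 1)" for q q'
  let ?A = "{n + 1..n + N}" and ?e = "n + N + 1"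
  have tele: "(\<Sum>q\<in>?A. f q - f (q + 1)) = f (n + 1) - f ?e" for f :: "nat \<Rightarrow> complex"
    by (induction N) (simp_all add: sum.cl_ivl_Suc)
  have split: "(\<Sum>q\<in>{n + 1..n + Suc N}. f q) = (\<Sum>q\<in>?A. f q) + f ?e" for f :: "nat \<Rightarrow> complex"
    by (simp add: sum.cl_ivl_Suc)
  have "(\<Sum>q\<in>{n + 1..n + Suc N}. \<Sum>q'\<in>{n + 1..n + Suc N}. eps q q' * w q q') =
      (\<Sum>q\<in>?A. \<Sum>q'\<in>?A. eps q q' * w q q') + (\<Sum>q\<in>?A. eps q ?e * w q ?e) + (\<Sum>q'\<in>?A. eps ?e q' * w ?e q')"
    unfolding split sum.distrib by (simp add: eps_eq)
  also have "(\<Sum>q\<in>?A. eps q ?e * w q ?e) = (\<Sum>q\<in>?A. - w q ?e)"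
    by (intro sum.cong refl) (auto simp: eps_eq)
  also have "\<dots> = (\<Sum>q\<in>?A. (b q (?e + 1) - b q ?e) - (b (q + 1) (?e + 1) - b (q + 1) ?e))"
    by (intro sum.cong refl) (simp add: w_def)
  also have "\<dots> = (b (n + 1) (?e + 1) - b (n + 1) ?e) - (b ?e (?e + 1) - b ?e ?e)"
    by (rule tele)
  also have "(\<Sum>q'\<in>?A. eps ?e q' * w ?e q') = (\<Sum>q'\<in>?A. (b ?e q' - b (?e + 1) q') - (b ?e (q' + 1) - b (?e + 1) (q' + 1)))"
    by (intro sum.cong refl) (auto simp: eps_eq w_def)
  also have "\<dots> = (b ?e (n + 1) - b (?e + 1) (n + 1)) - (b ?e ?e - b (?e + 1) ?e)"
    by (rule tele)
  also have "(\<Sum>q\<in>?A. \<Sum>q'\<in>?A. eps q q' * w q q') = b (n + 1) ?e - b ?e (n + 1)"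
    using Suc by (simp add: w_def)
  also have "b ?e (?e + 1) = b (?e + 1) ?e" using Suc.prems[of ?e] by simp
  finally show ?case by (simp add: w_def)
qed

lemma eps_sum_delta:
  assumes "finite S" "j \<in> S" "p \<in> S"
  shows "(\<Sum>q\<in>S. \<Sum>q'\<in>S. eps q q' * trace ((if q = j then A else 0) ** (if q' = p then B else 0)))
    = eps j p * trace (A ** B :: mat2)"
proof -
  have "eps q q' * trace ((if q = j then A else 0) ** (if q' = p then B else 0)) =
      (if q' = p then if q = j then eps j p * trace (A ** B) else 0 else 0)" for q q'
    by (auto simp: trace_zero)
  then show ?thesis using assms by simp
qed

text \<open>The sum against the sign jumps is, up to the factor \<open>-2\<close>, the trapezoidal rule with corrections at the end points. In this
  form it is valid for \<open>m = 0\<close> as well.\<close>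

lemma sum_trapezoid:
  fixes f :: "int \<Rightarrow> 'a::comm_ring_1"
  shows "(\<Sum>s\<in>{0..int m}. of_int (step_sgn (int m) j i s p) * f s) =
    eps j p * f 0 - eps i p * f (int m) - (\<Sum>s<m. f (int s) + f (int s + 1))"
proof (cases "m = 0")
  case True
  then show ?thesis by (simp add: step_sgn_simps algebra_simps)
next
  case False
  then obtain r where m: "m = Suc r" by (cases m) auto
  have inner: "(\<Sum>s\<in>{1..int m - 1}. f s) = (\<Sum>s<r. f (int s + 1))"
    by (rule sum.reindex_bij_witness[of _ "\<lambda>s. int s + 1" "\<lambda>s. nat (s - 1)"]) (auto simp: m)
  have "(\<Sum>s<m. f (int s) + f (int s + 1)) = f 0 + f (int m) + 2 * (\<Sum>s<r. f (int s + 1))"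
    unfolding sum.distrib unfolding m
    by (subst sum.lessThan_Suc_shift) (simp add: algebra_simps)
  moreover have "0 < int m" using False by simp
  note sum_step_sgn[OF this, of j i p f]
  ultimately show ?thesis by (simp only: inner) (simp add: algebra_simps)
qed

definition site_matrix :: "nat \<Rightarrow> nat \<Rightarrow> point \<Rightarrow> site \<Rightarrow> mat2" where
  "site_matrix n N M I =
     matrix_powi (M_h n N M) (fst I) ** M (snd I) ** matrix_powi (M_h n N M) (- fst I)"

context
  fixes n N :: nat and M :: point
  assumes surface: "\<And>i. i \<in> {1..n + N} \<Longrightarrow> trace (M i) = 0 \<and> det (M i) = 1"
begin

abbreviation "handle_pow \<equiv> matrix_powi (M_h n N M)"
abbreviation "loop \<equiv> site_matrix n N M"

lemma det_M_h: "det (M_h n N M) \<noteq> 0"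
proof -
  have "det (matrix_prod M [n + 1..<n + N + 1]) = 1"
    by (rule det_matrix_prod) (use surface in auto)
  then show ?thesis by (simp add: M_h_eq del: upt_Suc)
qed

lemmas handle_pow_collapse = matrix_powi_collapse[OF det_M_h]

lemma site_matrix_0: "loop (0, i) = M i"
  by (simp add: site_matrix_def)

lemma trace_conj: "trace (handle_pow s ** A ** handle_pow (- s)) = trace A"
  using trace_mul_sym[of "handle_pow s ** A" "handle_pow (- s)"] by (simp add: matrix_mul_assoc handle_pow_collapse)

lemma trace_site_matrix: "snd I \<in> {1..n + N} \<Longrightarrow> trace (loop I) = 0"
  using surface by (simp add: site_matrix_def trace_conj)

lemma pairing_G_fun: "trace (loop I ** loop J) = - pairing (\<lambda>k i j. G_fun n N k i j M) I J"
proof -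
  have "trace (loop I ** loop J) = trace (handle_pow (fst I) ** (M (snd I) ** handle_pow (fst J - fst I) ** M (snd J) ** handle_pow (- (fst J - fst I))) ** handle_pow (- fst I))"
    by (simp add: site_matrix_def matrix_mul_assoc handle_pow_collapse)
  then show ?thesis by (simp only: trace_conj) (simp add: pairing_def G_fun_def)
qed

lemma trace_unit_mat_sandwich: "trace (A ** unit_mat a b ** B ** Z) = (B ** Z ** A) $ b $ a"
  using trace_mul_sym[of A "unit_mat a b ** B ** Z"] trace_unit_mat[of a b "B ** Z ** A"]
  by (simp add: matrix_mul_assoc)

lemma entry_deriv_G:
  assumes "i \<in> {1..n}" "j \<in> {1..n}"
  shows "entry_deriv (G_fun n N (int m) j i) q a b M =
   (if q \<in> {1..n} then (if q = j then - loop (int m, i) else 0) + (if q = i then - loop (- int m, j) else 0)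
    else if q \<in> {n + 1..n + N} then
      matrix_prod M [q + 1..<n + N + 1]
      ** (- (\<Sum>s<m. handle_pow (- 1 - int s) ** commutator (loop (int m, i)) (loop (0, j)) ** handle_pow (int s)))
      ** matrix_prod M [n + 1..<q]
    else 0) $ b $ a"
proof -
  let ?t = "M q $ a $ b" and ?S = "set_entry M q a b"
  let ?Z = "- (\<Sum>s<m. handle_pow (- 1 - int s) ** commutator (loop (int m, i)) (loop (0, j)) ** handle_pow (int s))"
  define H' where "H' = (if q \<in> {n + 1..n + N} then matrix_prod M [n + 1..<q] ** unit_mat a b ** matrix_prod M [q + 1..<n + N + 1] else 0)"
  have nz: "det (M_h n N (?S ?t)) \<noteq> 0" by (simp add: set_entry_self det_M_h)
  have "((\<lambda>t. G_fun n N (int m) j i (?S t)) has_field_derivative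
      trace ((if j = q then unit_mat a b else 0) ** (- loop (int m, i)))
    + trace ((if i = q then unit_mat a b else 0) ** (- loop (- int m, j))) + trace (H' ** ?Z)) (at ?t)"
    using trace_powi_deriv[OF mat_deriv_set_entry[of M q a b j ?t] mat_deriv_set_entry[of M q a b i ?t]
        mat_deriv_M_h[of n N M q a b ?t, folded H'_def] nz, where k = m]
    unfolding set_entry_self G_fun_def by (simp add: site_matrix_def)
  then have "entry_deriv (G_fun n N (int m) j i) q a b M =
      trace ((if j = q then unit_mat a b else 0) ** (- loop (int m, i)))
    + trace ((if i = q then unit_mat a b else 0) ** (- loop (- int m, j))) + trace (H' ** ?Z)"
    unfolding entry_deriv_def by (rule DERIV_imp_deriv)
  moreover have "trace (H' ** ?Z) = (matrix_prod M [q + 1..<n + N + 1] ** ?Z ** matrix_prod M [n + 1..<q]) $ b $ a"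
    if "q \<in> {n + 1..n + N}"
    unfolding H'_def if_P[OF that] by (rule trace_unit_mat_sandwich)
  moreover have "trace (H' ** ?Z) = 0" if "q \<notin> {n + 1..n + N}"
    unfolding H'_def if_not_P[OF that] by (simp add: trace_zero)
  ultimately show ?thesis
    using assms by (auto simp: trace_unit_mat trace_zero simp del: upt_Suc)
qed

abbreviation "loop_chord m j i s \<equiv> commutator (loop (int m + s, i)) (loop (s, j))"

text \<open>\<open>loop_chord m j i s\<close> is the commutator of the matrices at the sites \<open>(m + s, i)\<close> and \<open>(s, j)\<close>, and
  conjugation by powers of \<open>M_h\<close> shifts it.\<close>

lemma chord_shift: "handle_pow a ** loop_chord m j i s ** handle_pow (- a) = loop_chord m j i (s + a)"
proof -
  have "handle_pow a ** (loop I ** loop J) ** handle_pow (- a) = loop (shift a I) ** loop (shift a J)" for I J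
    by (simp add: site_matrix_def shift_def matrix_mul_assoc handle_pow_collapse algebra_simps)
  then show ?thesis
    by (simp add: commutator_def matrix_diff_ldistrib matrix_diff_rdistrib shift_def algebra_simps)
qed

lemma trace_chords_shift: "trace (loop_chord m j i a ** loop_chord k p l b) = trace (loop_chord m j i 0 ** loop_chord k p l (b - a))"
proof -
  have "loop_chord m j i a ** loop_chord k p l b = handle_pow a ** loop_chord m j i 0 ** handle_pow (- a) ** (handle_pow a ** loop_chord k p l (b - a) ** handle_pow (- a))"
    by (simp only: chord_shift) simp
  also have "\<dots> = handle_pow a ** (loop_chord m j i 0 ** loop_chord k p l (b - a)) ** handle_pow (- a)"
    by (simp add: matrix_mul_assoc handle_pow_collapse)
  finally show ?thesis by (simp only: trace_conj)
qed

lemma trace_chords: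
  assumes "i \<in> {1..n}" "j \<in> {1..n}" "p \<in> {1..n}" "l \<in> {1..n}"
  shows "trace (loop_chord m j i 0 ** loop_chord k p l s) =
    2 * (G_fun n N (int m - s) p i M * G_fun n N (int k + s) j l M - G_fun n N (- s) p j M * G_fun n N (int k + s - int m) i l M)"
proof -
  have "trace (loop_chord m j i 0 ** loop_chord k p l s) =
      2 * (trace (loop (int m, i) ** loop (s, p)) * trace (loop (0, j) ** loop (int k + s, l))
        - trace (loop (int m, i) ** loop (int k + s, l)) * trace (loop (0, j) ** loop (s, p)))"
    using assms by (subst trace_commutators) (auto intro!: trace_site_matrix)
  then show ?thesis
    using G_fun_flip[of n N "s - int m" p i M] G_fun_flip[of n N s p j M]
    by (simp add: pairing_G_fun pairing_def algebra_simps)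
qed

text \<open>The gradient of \<open>G\<^sup>(\<^sup>m\<^sup>)\<^sub>j\<^sub>,\<^sub>i\<close> with respect to \<open>M_h\<close>.\<close>

definition handle_gradient :: "nat \<Rightarrow> nat \<Rightarrow> nat \<Rightarrow> mat2" where
  "handle_gradient m j i = - (\<Sum>s<m. handle_pow (- 1 - int s) ** loop_chord m j i 0 ** handle_pow (int s))"

text \<open>The gradient of \<open>G\<^sup>(\<^sup>m\<^sup>)\<^sub>j\<^sub>,\<^sub>i\<close> with respect to \<open>M\<^sub>q\<close>. The two contributions for \<open>q \<le> n\<close> are added since
  \<open>i = j\<close> is possible.\<close>

definition G_gradient :: "nat \<Rightarrow> nat \<Rightarrow> nat \<Rightarrow> nat \<Rightarrow> mat2" where
  "G_gradient m j i q =
    (if q \<in> {1..n} then (if q = j then - loop (int m, i) else 0) + (if q = i then - loop (- int m, j) else 0)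
     else if q \<in> {n + 1..n + N} then
       matrix_prod M [q + 1..<n + N + 1] ** handle_gradient m j i ** matrix_prod M [n + 1..<q]
     else 0)"

text \<open>The gradient with respect to \<open>M_h\<close>, carried around the product \<open>M\<^sub>n\<^sub>+\<^sub>1 \<cdots> M\<^sub>n\<^sub>+\<^sub>N\<close> up to the factor
  \<open>M\<^sub>q\<close>. At the two ends it is \<open>M_h\<close> times the gradient and the gradient times \<open>M_h\<close>.\<close>

definition transported :: "nat \<Rightarrow> nat \<Rightarrow> nat \<Rightarrow> nat \<Rightarrow> mat2" where
  "transported m j i q = matrix_prod M [q..<n + N + 1] ** handle_gradient m j i ** matrix_prod M [n + 1..<q]"

lemma commutator_gradient_low:
  assumes "i \<in> {1..n}" "j \<in> {1..n}" "q \<in> {1..n}"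
  shows "commutator (M q) (G_gradient m j i q) =
    (if q = j then loop_chord m j i 0 else 0) + (if q = i then - loop_chord m j i (- int m) else 0)"
  using assms
  by (simp add: G_gradient_def commutator_def matrix_add_ldistrib matrix_add_rdistrib matrix_minus_left
      matrix_minus_right site_matrix_0)

lemma matrix_prod_Cons_upt: "q \<in> {n + 1..n + N} \<Longrightarrow> matrix_prod M [q..<n + N + 1] = M q ** matrix_prod M [q + 1..<n + N + 1]"
  by (simp add: upt_conv_Cons del: upt_Suc)

lemma matrix_prod_upt_snoc: "q \<in> {n + 1..n + N} \<Longrightarrow> matrix_prod M [n + 1..<q + 1] = matrix_prod M [n + 1..<q] ** M q"
  by (simp add: matrix_prod_append)

lemma commutator_gradient_high:
  assumes "q \<in> {n + 1..n + N}"
  shows "commutator (M q) (G_gradient m j i q) = transported m j i q - transported m j i (q + 1)"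
  using assms unfolding transported_def commutator_def G_gradient_def matrix_prod_Cons_upt[OF assms] matrix_prod_upt_snoc[OF assms]
  by (simp add: matrix_mul_assoc del: upt_Suc)

lemma square_M: "q \<in> {1..n + N} \<Longrightarrow> M q ** M q = - mat 1"
  using surface square_minus_one by blast

text \<open>Both traces reduce to the same one because \<open>M\<^sub>q\<^sup>2 = -1\<close>; this is the hypothesis of the telescoping
  lemma.\<close>

lemma trace_transported_sym:
  assumes "q \<in> {n + 1..n + N}"
  shows "trace (transported m j i q ** transported k p l (q + 1)) = trace (transported m j i (q + 1) ** transported k p l q)"
proof -
  define f where "f m j i = matrix_prod M [q + 1..<n + N + 1] ** handle_gradient m j i ** matrix_prod M [n + 1..<q]" for m j i
  have q: "transported m j i q = M q ** f m j i" and q1: "transported m j i (q + 1) = f m j i ** M q" for m j i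
    unfolding transported_def f_def matrix_prod_Cons_upt[OF assms] matrix_prod_upt_snoc[OF assms]
    by (simp_all add: matrix_mul_assoc del: upt_Suc)
  have sq: "M q ** M q = - mat 1" using assms by (intro square_M) auto
  have "trace (M q ** f m j i ** (f k p l ** M q)) = trace (M q ** M q ** (f m j i ** f k p l))"
    using trace_mul_sym[of "M q ** f m j i ** f k p l" "M q"] by (simp add: matrix_mul_assoc)
  also have "\<dots> = - trace (f m j i ** f k p l)"
    by (simp add: sq matrix_minus_left trace_minus)
  also have "\<dots> = trace (f m j i ** (M q ** M q) ** f k p l)"
    by (simp add: sq matrix_minus_left matrix_minus_right trace_minus)
  finally show ?thesis unfolding q q1 by (simp add: matrix_mul_assoc)
qed

lemma transported_first: "transported m j i (n + 1) = - (\<Sum>s<m. loop_chord m j i (- int s))"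
proof -
  have "handle_pow 1 ** (handle_pow (- 1 - int s) ** loop_chord m j i 0 ** handle_pow (int s)) = loop_chord m j i (- int s)" for s
    using chord_shift[where a = "- int s" and s = 0 and m = m and i = i and j = j] by (simp add: matrix_mul_assoc handle_pow_collapse)
  then show ?thesis
    using matrix_powi_1[OF det_M_h]
    by (simp add: transported_def handle_gradient_def matrix_minus_right matrix_sum_right flip: M_h_eq[simplified])
qed

lemma transported_last: "transported m j i (n + N + 1) = - (\<Sum>s<m. loop_chord m j i (- 1 - int s))"
proof -
  have "(handle_pow (- 1 - int s) ** loop_chord m j i 0 ** handle_pow (int s)) ** handle_pow 1 = loop_chord m j i (- 1 - int s)" for s
    using chord_shift[where a = "- 1 - int s" and s = 0 and m = m and i = i and j = j] by (simp add: matrix_mul_assoc handle_pow_collapse algebra_simps)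
  then show ?thesis
    using matrix_powi_1[OF det_M_h]
    by (simp add: transported_def handle_gradient_def matrix_minus_left matrix_sum_left flip: M_h_eq[simplified])
qed

text \<open>The total generator of conjugation vanishes, because the trace functions are conjugation invariant:
  the part of \<open>M_h\<close> is minus the part of \<open>M\<^sub>1, \<dots>, M\<^sub>n\<close>.\<close>

lemma sum_transported:
  "(\<Sum>q\<in>{n + 1..n + N}. transported m j i q - transported m j i (q + 1)) = - (loop_chord m j i 0 - loop_chord m j i (- int m))"
proof -
  have tele: "(\<Sum>q\<in>{n + 1..n + N}. f q - f (q + 1)) = f (n + 1) - f (n + N + 1)" for f :: "nat \<Rightarrow> mat2"
    by (induction N) (simp_all add: sum.cl_ivl_Suc)
  have "(\<Sum>s<m. loop_chord m' j i (- int s)) - (\<Sum>s<m. loop_chord m' j i (- 1 - int s)) = loop_chord m' j i 0 - loop_chord m' j i (- int m)" for m'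
    by (induction m) (simp_all add: algebra_simps)
  from this[of m] show ?thesis
    unfolding tele transported_first transported_last by (simp add: algebra_simps)
qed

text \<open>In the double sum over all matrices the mixed terms between \<open>M\<^sub>1, \<dots>, M\<^sub>n\<close> and the factors of \<open>M_h\<close>
  cancel by invariance. The terms within \<open>M\<^sub>1, \<dots>, M\<^sub>n\<close> give the corrections at the end levels, those
  within \<open>M_h\<close> telescope to the trapezoidal sums, and both together are the periodic bracket.\<close>

lemma ks_bracket_G_fun:
  assumes ix: "i \<in> {1..n}" "j \<in> {1..n}" "p \<in> {1..n}" "l \<in> {1..n}"
  shows "ks_bracket (n + N) (G_fun n N (int m) j i) (G_fun n N (int k) p l) M =
    periodic_bracket (\<lambda>k i j. G_fun n N k i j M) (0, j) (int m, i) (0, p) (int k, l)"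
proof -
  define v where "v s = G_fun n N (int m - s) p i M * G_fun n N (int k + s) j l M
    - G_fun n N (- s) p j M * G_fun n N (int k + s - int m) i l M" for s
  \<comment> \<open>The trace of two commutators depends only on their relative shift.\<close>
  have W: "trace (loop_chord m j i a ** loop_chord k p l b) = 2 * v (b - a)" for a b
    by (subst trace_chords_shift) (simp only: trace_chords[OF ix] v_def)
  define D where "D q = commutator (M q) (G_gradient m j i q)" for q
  define D' where "D' q = commutator (M q) (G_gradient k p l q)" for q
  define w where "w q q' = eps q q' * trace (D q ** D' q')" for q q'
  let ?A = "{1..n}" and ?B = "{n + 1..n + N}"
  have ks: "ks_bracket (n + N) (G_fun n N (int m) j i) (G_fun n N (int k) p l) M =
      (\<Sum>q\<in>{1..n + N}. \<Sum>q'\<in>{1..n + N}. w q q') / 2"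
    unfolding w_def D_def D'_def
    by (rule ks_bracket_gradient) (simp_all only: entry_deriv_G[OF ix(1,2)] entry_deriv_G[OF ix(4,3)] G_gradient_def handle_gradient_def square_M, simp_all)
  have split: "(\<Sum>q\<in>{1..n + N}. f q) = (\<Sum>q\<in>?A. f q) + (\<Sum>q\<in>?B. f q)" for f :: "nat \<Rightarrow> complex"
    using sum.ub_add_nat[of 1 n f N] by simp
  have low: "D q = (if q = j then loop_chord m j i 0 else 0) + (if q = i then - loop_chord m j i (- int m) else 0)"
    "D' q = (if q = p then loop_chord k p l 0 else 0) + (if q = l then - loop_chord k p l (- int k) else 0)" if "q \<in> ?A" for q
    using that ix by (simp_all only: D_def D'_def commutator_gradient_low)
  have high: "D q = transported m j i q - transported m j i (q + 1)"
    "D' q = transported k p l q - transported k p l (q + 1)" if "q \<in> ?B" for q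
    using that by (simp_all only: D_def D'_def commutator_gradient_high)
  have sumA: "(\<Sum>q\<in>?A. D q) = loop_chord m j i 0 - loop_chord m j i (- int m)"
    "(\<Sum>q\<in>?A. D' q) = loop_chord k p l 0 - loop_chord k p l (- int k)"
    using ix by (simp_all add: low sum.distrib)
  have sumB: "(\<Sum>q\<in>?B. D q) = - (\<Sum>q\<in>?A. D q)" "(\<Sum>q\<in>?B. D' q) = - (\<Sum>q\<in>?A. D' q)"
    unfolding sumA sum_transported[symmetric] by (intro sum.cong refl; simp only: high)+
  have AA: "(\<Sum>q\<in>?A. \<Sum>q'\<in>?A. w q q') =
      2 * (eps j p * v 0 - eps j l * v (- int k) - eps i p * v (int m) + eps i l * v (int m - int k))"
  proof -
    have "(\<Sum>q\<in>?A. \<Sum>q'\<in>?A. w q q') = 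
       (\<Sum>q\<in>?A. \<Sum>q'\<in>?A. eps q q' * trace ((if q = j then loop_chord m j i 0 else 0) ** (if q' = p then loop_chord k p l 0 else 0)))
     + (\<Sum>q\<in>?A. \<Sum>q'\<in>?A. eps q q' * trace ((if q = j then loop_chord m j i 0 else 0) ** (if q' = l then - loop_chord k p l (- int k) else 0)))
     + (\<Sum>q\<in>?A. \<Sum>q'\<in>?A. eps q q' * trace ((if q = i then - loop_chord m j i (- int m) else 0) ** (if q' = p then loop_chord k p l 0 else 0)))
     + (\<Sum>q\<in>?A. \<Sum>q'\<in>?A. eps q q' * trace ((if q = i then - loop_chord m j i (- int m) else 0) ** (if q' = l then - loop_chord k p l (- int k) else 0)))"
      unfolding sum.distrib[symmetric]
      by (intro sum.cong refl) (simp only: w_def low matrix_add_ldistrib matrix_add_rdistrib trace_add distrib_left add.assoc add.left_commute add.commute)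
    also have "\<dots> = eps j p * trace (loop_chord m j i 0 ** loop_chord k p l 0) + eps j l * trace (loop_chord m j i 0 ** - loop_chord k p l (- int k))
      + eps i p * trace (- loop_chord m j i (- int m) ** loop_chord k p l 0) + eps i l * trace (- loop_chord m j i (- int m) ** - loop_chord k p l (- int k))"
      by (simp only: eps_sum_delta ix finite_atLeastAtMost)
    finally show ?thesis
      unfolding matrix_minus_left matrix_minus_right trace_minus W by (simp add: algebra_simps)
  qed
  have AB: "(\<Sum>q\<in>?A. \<Sum>q'\<in>?B. w q q') = trace ((\<Sum>q\<in>?A. D q) ** (\<Sum>q\<in>?A. D' q))"
  proof -
    have "(\<Sum>q\<in>?A. \<Sum>q'\<in>?B. w q q') = (\<Sum>q\<in>?A. \<Sum>q'\<in>?B. - trace (D q ** D' q'))"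
      by (intro sum.cong refl) (auto simp: w_def eps_eq)
    also have "\<dots> = - trace ((\<Sum>q\<in>?A. D q) ** (\<Sum>q\<in>?B. D' q))"
      unfolding matrix_sum_left unfolding matrix_sum_right by (simp add: trace_sum sum_negf)
    finally show ?thesis unfolding sumB matrix_minus_right trace_minus by simp
  qed
  have BA: "(\<Sum>q\<in>?B. \<Sum>q'\<in>?A. w q q') = - trace ((\<Sum>q\<in>?A. D q) ** (\<Sum>q\<in>?A. D' q))"
  proof -
    have "(\<Sum>q\<in>?B. \<Sum>q'\<in>?A. w q q') = (\<Sum>q\<in>?B. \<Sum>q'\<in>?A. trace (D q ** D' q'))"
      by (intro sum.cong refl) (auto simp: w_def eps_eq)
    also have "\<dots> = trace ((\<Sum>q\<in>?B. D q) ** (\<Sum>q\<in>?A. D' q))"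
      unfolding matrix_sum_left unfolding matrix_sum_right by (simp add: trace_sum)
    finally show ?thesis unfolding sumB matrix_minus_left trace_minus by simp
  qed
  have BB: "(\<Sum>q\<in>?B. \<Sum>q'\<in>?B. w q q') =
      2 * (\<Sum>s<m. v (int s - int k) + v (int s + 1 - int k) - v (int s) - v (int s + 1))"
  proof -
    define b where "b q q' = trace (transported m j i q ** transported k p l q')" for q q'
    have "(\<Sum>q\<in>?B. \<Sum>q'\<in>?B. w q q') = (\<Sum>q\<in>?B. \<Sum>q'\<in>?B.
        eps q q' * (b q q' - b q (q' + 1) - b (q + 1) q' + b (q + 1) (q' + 1)))"
      by (intro sum.cong refl)
        (simp only: w_def high b_def matrix_diff_ldistrib matrix_diff_rdistrib trace_sub, simp add: algebra_simps)
    also have "\<dots> = b (n + 1) (n + N + 1) - b (n + N + 1) (n + 1)"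
      by (rule eps_sum_telescope) (simp only: b_def trace_transported_sym)
    also have "\<dots> = (\<Sum>s<m. \<Sum>t<k. 2 * (v (int s - int t - 1) - v (int s - int t + 1)))"
    proof -
      have "b (n + 1) (n + N + 1) = (\<Sum>s<m. \<Sum>t<k. 2 * v (int s - int t - 1))"
        unfolding b_def transported_first transported_last matrix_minus_left matrix_minus_right minus_minus
          matrix_sum_left unfolding matrix_sum_right trace_sum W by (simp add: algebra_simps)
      moreover have "b (n + N + 1) (n + 1) = (\<Sum>s<m. \<Sum>t<k. 2 * v (int s - int t + 1))"
        unfolding b_def transported_first transported_last matrix_minus_left matrix_minus_right minus_minus
          matrix_sum_left unfolding matrix_sum_right trace_sum W by (simp add: algebra_simps)
      ultimately show ?thesis by (simp only: right_diff_distrib sum_subtractf)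
    qed
    also have "\<dots> = (\<Sum>s<m. 2 * (v (int s - int k) + v (int s + 1 - int k) - v (int s) - v (int s + 1)))"
    proof (intro sum.cong refl)
      fix s
      show "(\<Sum>t<k. 2 * (v (int s - int t - 1) - v (int s - int t + 1))) =
          2 * (v (int s - int k) + v (int s + 1 - int k) - v (int s) - v (int s + 1))"
        by (induction k) (simp_all add: algebra_simps)
    qed
    finally show ?thesis by (simp add: sum_distrib_left)
  qed
  have "periodic_bracket (\<lambda>k i j. G_fun n N k i j M) (0, j) (int m, i) (0, p) (int k, l) =
      (\<Sum>s\<in>{0..int m}. of_int (step_sgn (int m) j i s p) * v s)
    - (\<Sum>s\<in>{0..int m}. of_int (step_sgn (int m) j i s l) * v (s - int k))"
    by (simp add: periodic_bracket_level v_def algebra_simps)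
  also have "\<dots> = eps j p * v 0 - eps j l * v (- int k) - eps i p * v (int m) + eps i l * v (int m - int k)
      + (\<Sum>s<m. v (int s - int k) + v (int s + 1 - int k) - v (int s) - v (int s + 1))"
    unfolding sum_trapezoid by (simp add: sum.distrib sum_subtractf algebra_simps)
  finally show ?thesis
    unfolding ks split sum.distrib AA AB BA BB by simp
qed

end

section \<open>Biderivations of polynomial rings\<close>

definition poly_over :: "gen set \<Rightarrow> gpoly set" where
  "poly_over V = {f. \<forall>x\<in>Poly_Mapping.keys f. Poly_Mapping.keys x \<subseteq> V}"

lemma D_alg_eq: "D_alg n = poly_over (D_gens n)"
  by (simp add: D_alg_def poly_over_def)

lemma poly_over_UNIV: "poly_over UNIV = UNIV"
  by (simp add: poly_over_def)

lemma update_eq_add_single: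
  fixes f :: "'a \<Rightarrow>\<^sub>0 'b::comm_monoid_add"
  assumes "a \<notin> Poly_Mapping.keys f"
  shows "Poly_Mapping.update a b f = f + Poly_Mapping.single a b"
  using assms by (intro poly_mapping_eqI) (auto simp: lookup_update lookup_add lookup_single in_keys_iff when_def)

lemma gconst_in_poly_over: "gconst c \<in> poly_over V"
  by (simp add: poly_over_def gconst_def)

lemma gvar_in_poly_over: "v \<in> V \<Longrightarrow> gvar v \<in> poly_over V"
  by (simp add: poly_over_def gvar_def)

lemma add_in_poly_over: "f \<in> poly_over V \<Longrightarrow> g \<in> poly_over V \<Longrightarrow> f + g \<in> poly_over V"
  using keys_add[of f g] by (auto simp: poly_over_def)

lemma mult_in_poly_over:
  assumes "f \<in> poly_over V" "g \<in> poly_over V"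
  shows "f * g \<in> poly_over V"
  unfolding poly_over_def
proof (intro CollectI ballI)
  fix z assume "z \<in> Poly_Mapping.keys (f * g)"
  then obtain x y where z: "z = x + y" "x \<in> Poly_Mapping.keys f" "y \<in> Poly_Mapping.keys g"
    using keys_mult[of f g] by blast
  then have "Poly_Mapping.keys x \<subseteq> V" "Poly_Mapping.keys y \<subseteq> V"
    using assms by (simp_all add: poly_over_def)
  then show "Poly_Mapping.keys z \<subseteq> V"
    using keys_add[of x y] z(1) by blast
qed

lemma gconst_add: "gconst (a + b) = gconst a + gconst b"
  by (simp add: gconst_def single_add)

lemma gconst_mult: "gconst (a * b) = gconst a * gconst b"
  by (simp add: gconst_def mult_single)

lemma gconst_0 [simp]: "gconst 0 = 0" and gconst_1 [simp]: "gconst 1 = 1"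
  by (simp_all add: gconst_def)

lemma gconst_of_int: "gconst (of_int c) = of_int c"
  by (simp add: gconst_def)

lemma gconst_uminus: "gconst (- a) = - gconst a"
  by (simp add: gconst_def single_uminus)

lemma uminus_in_poly_over: "f \<in> poly_over V \<Longrightarrow> - f \<in> poly_over V"
  using mult_in_poly_over[OF gconst_in_poly_over[of "-1"], of f V] by (simp add: gconst_uminus)

lemma diff_in_poly_over: "f \<in> poly_over V \<Longrightarrow> g \<in> poly_over V \<Longrightarrow> f - g \<in> poly_over V"
  using add_in_poly_over[of f V "- g"] uminus_in_poly_over[of g V] by simp

lemma of_int_in_poly_over: "of_int c \<in> poly_over V"
  using gconst_in_poly_over[of "of_int c" V] by (simp add: gconst_of_int)

lemma sum_in_poly_over: "(\<And>x. x \<in> X \<Longrightarrow> f x \<in> poly_over V) \<Longrightarrow> sum f X \<in> poly_over V"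
  using gconst_in_poly_over[of 0 V]
  by (induction X rule: infinite_finite_induct) (simp_all add: add_in_poly_over)

text \<open>Polynomials in the variables \<open>V\<close> are generated by constants and variables under sums and products,
  with all intermediate polynomials in the same variables.\<close>

lemma poly_over_induct [consumes 1, case_names const var add mult]:
  assumes "f \<in> poly_over V"
    and const: "\<And>c. P (gconst c)"
    and var: "\<And>v. v \<in> V \<Longrightarrow> P (gvar v)"
    and add: "\<And>f g. f \<in> poly_over V \<Longrightarrow> g \<in> poly_over V \<Longrightarrow> P f \<Longrightarrow> P g \<Longrightarrow> P (f + g)"
    and mult: "\<And>f g. f \<in> poly_over V \<Longrightarrow> g \<in> poly_over V \<Longrightarrow> P f \<Longrightarrow> P g \<Longrightarrow> P (f * g)"
  shows "P f"
proof -
  have power: "Poly_Mapping.single (Poly_Mapping.single v b) 1 \<in> poly_over V \<and> P (Poly_Mapping.single (Poly_Mapping.single v b) 1)"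
    if "v \<in> V" for v b
  proof (induction b)
    case 0
    then show ?case using const[of 1] gconst_in_poly_over[of 1 V] by simp
  next
    case (Suc b)
    have "Poly_Mapping.single (Poly_Mapping.single v (Suc b)) 1 = gvar v * Poly_Mapping.single (Poly_Mapping.single v b) 1"
      by (simp add: gvar_def mult_single flip: single_add)
    then show ?case
      using Suc mult[of "gvar v"] var[OF that] that by (simp add: gvar_in_poly_over mult_in_poly_over)
  qed
  have monomial: "Poly_Mapping.single x 1 \<in> poly_over V \<and> P (Poly_Mapping.single x 1)"
    if "Poly_Mapping.keys x \<subseteq> V" for x
    using that
  proof (induction x rule: update_induct)
    case const
    then show ?case using assms(2)[of 1] gconst_in_poly_over[of 1 V] by simp
  next
    case (update x v b)
    have "Poly_Mapping.single (Poly_Mapping.update v b x) 1 =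
        Poly_Mapping.single x 1 * (Poly_Mapping.single (Poly_Mapping.single v b) 1 :: gpoly)"
      by (simp add: update_eq_add_single[OF update(1)] mult_single)
    with update power[of v b] mult[of "Poly_Mapping.single x 1" "Poly_Mapping.single (Poly_Mapping.single v b) 1"]
    show ?case by (simp add: keys_update mult_in_poly_over)
  qed
  show ?thesis
    using assms(1)
  proof (induction f rule: update_induct)
    case const
    then show ?case using assms(2)[of 0] by simp
  next
    case (update f x c)
    have x: "Poly_Mapping.keys x \<subseteq> V" and f: "f \<in> poly_over V"
      using update(2,4) by (auto simp: poly_over_def keys_update)
    have eq: "Poly_Mapping.update x c f = f + gconst c * Poly_Mapping.single x 1"
      by (simp add: update_eq_add_single[OF update(1)] gconst_def mult_single)
    show ?case
      unfolding eq
      by (intro add mult mult_in_poly_over gconst_in_poly_over f update(3) const)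
        (use monomial[OF x] in auto)
  qed
qed

text \<open>The product rule on a monomial: \<open>x - single v 1\<close> lowers the exponent of \<open>v\<close> by one.\<close>

definition monomial_derivation :: "(gen \<Rightarrow> gpoly) \<Rightarrow> (gen \<Rightarrow>\<^sub>0 nat) \<Rightarrow> gpoly" where
  "monomial_derivation d x = (\<Sum>v\<in>Poly_Mapping.keys x. of_nat (Poly_Mapping.lookup x v) *
     (Poly_Mapping.single (x - Poly_Mapping.single v 1) 1 * d v))"

definition derivation :: "(gen \<Rightarrow> gpoly) \<Rightarrow> gpoly \<Rightarrow> gpoly" where
  "derivation d f = (\<Sum>x\<in>Poly_Mapping.keys f. gconst (Poly_Mapping.lookup f x) * monomial_derivation d x)"

lemma monomial_derivation_superset:
  assumes "finite S" "Poly_Mapping.keys x \<subseteq> S"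
  shows "monomial_derivation d x = (\<Sum>v\<in>S. of_nat (Poly_Mapping.lookup x v) *
     (Poly_Mapping.single (x - Poly_Mapping.single v 1) 1 * d v))"
  unfolding monomial_derivation_def using assms by (intro sum.mono_neutral_left) (auto simp: in_keys_iff)

lemma derivation_superset:
  assumes "finite S" "Poly_Mapping.keys f \<subseteq> S"
  shows "derivation d f = (\<Sum>x\<in>S. gconst (Poly_Mapping.lookup f x) * monomial_derivation d x)"
  unfolding derivation_def using assms by (intro sum.mono_neutral_left) (auto simp: in_keys_iff)

lemma derivation_add: "derivation d (f + g) = derivation d f + derivation d g"
proof -
  let ?S = "Poly_Mapping.keys f \<union> Poly_Mapping.keys g"
  have "derivation d (f + g) = (\<Sum>x\<in>?S. gconst (Poly_Mapping.lookup (f + g) x) * monomial_derivation d x)"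
    by (rule derivation_superset) (use keys_add[of f g] in auto)
  also have "\<dots> = (\<Sum>x\<in>?S. gconst (Poly_Mapping.lookup f x) * monomial_derivation d x)
      + (\<Sum>x\<in>?S. gconst (Poly_Mapping.lookup g x) * monomial_derivation d x)"
    by (simp add: lookup_add gconst_add distrib_right sum.distrib)
  finally show ?thesis by (simp flip: derivation_superset)
qed

lemma derivation_single: "derivation d (Poly_Mapping.single x c) = gconst c * monomial_derivation d x"
  by (simp add: derivation_def)

lemma monomial_derivation_add:
  "monomial_derivation d (x + y) =
     Poly_Mapping.single x 1 * monomial_derivation d y + monomial_derivation d x * Poly_Mapping.single y 1"
proof -
  let ?S = "Poly_Mapping.keys x \<union> Poly_Mapping.keys y"
  have shift: "of_nat (Poly_Mapping.lookup z v) * Poly_Mapping.single (z + w - Poly_Mapping.single v 1) 1 =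
      of_nat (Poly_Mapping.lookup z v) * (Poly_Mapping.single (z - Poly_Mapping.single v 1) 1 * Poly_Mapping.single w 1 :: gpoly)"
    for z w :: "gen \<Rightarrow>\<^sub>0 nat" and v
  proof (cases "Poly_Mapping.lookup z v = 0")
    case False
    then have "z + w - Poly_Mapping.single v 1 = (z - Poly_Mapping.single v 1) + w"
      by (intro poly_mapping_eqI) (auto simp: minus_poly_mapping.rep_eq lookup_add lookup_single when_def)
    then show ?thesis by (simp add: mult_single)
  qed simp
  have "monomial_derivation d (x + y) = (\<Sum>v\<in>?S. of_nat (Poly_Mapping.lookup (x + y) v) *
     (Poly_Mapping.single (x + y - Poly_Mapping.single v 1) 1 * d v))"
    by (rule monomial_derivation_superset) (use keys_add[of x y] in auto)
  also have "\<dots> = (\<Sum>v\<in>?S. (of_nat (Poly_Mapping.lookup y v) * Poly_Mapping.single (y + x - Poly_Mapping.single v 1) 1) * d v)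
     + (\<Sum>v\<in>?S. (of_nat (Poly_Mapping.lookup x v) * Poly_Mapping.single (x + y - Poly_Mapping.single v 1) 1) * d v)"
    by (simp add: lookup_add sum.distrib[symmetric] algebra_simps)
  also have "\<dots> = Poly_Mapping.single x 1 * (\<Sum>v\<in>?S. of_nat (Poly_Mapping.lookup y v) * (Poly_Mapping.single (y - Poly_Mapping.single v 1) 1 * d v))
     + (\<Sum>v\<in>?S. of_nat (Poly_Mapping.lookup x v) * (Poly_Mapping.single (x - Poly_Mapping.single v 1) 1 * d v)) * Poly_Mapping.single y 1"
    unfolding shift sum_distrib_left sum_distrib_right by (simp only: ac_simps)
  also have "(\<Sum>v\<in>?S. of_nat (Poly_Mapping.lookup y v) * (Poly_Mapping.single (y - Poly_Mapping.single v 1) 1 * d v)) = monomial_derivation d y"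
    by (rule monomial_derivation_superset[symmetric]) auto
  also have "(\<Sum>v\<in>?S. of_nat (Poly_Mapping.lookup x v) * (Poly_Mapping.single (x - Poly_Mapping.single v 1) 1 * d v)) = monomial_derivation d x"
    by (rule monomial_derivation_superset[symmetric]) auto
  finally show ?thesis .
qed

lemma single_eq: "Poly_Mapping.single x c = gconst c * Poly_Mapping.single x 1"
  by (simp add: gconst_def mult_single)

lemma derivation_0: "derivation d 0 = 0"
  by (simp add: derivation_def)

lemma derivation_mult: "derivation d (f * g) = f * derivation d g + derivation d f * g"
proof (induction f rule: update_induct)
  case const
  show ?case by (simp add: derivation_0)
next
  case (update f x a)
  have "derivation d (Poly_Mapping.single x a * g) = Poly_Mapping.single x a * derivation d g + derivation d (Poly_Mapping.single x a) * g"
  proof (induction g rule: update_induct)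
    case const
    show ?case by (simp add: derivation_0)
  next
    case (update g y b)
    have "derivation d (Poly_Mapping.single x a * Poly_Mapping.single y b) =
        Poly_Mapping.single x a * derivation d (Poly_Mapping.single y b) + derivation d (Poly_Mapping.single x a) * Poly_Mapping.single y b"
      unfolding mult_single derivation_single monomial_derivation_add gconst_mult
      unfolding single_eq[of x a] single_eq[of y b]
      by (simp add: algebra_simps)
    with update show ?case by (simp add: update_eq_add_single distrib_left derivation_add algebra_simps)
  qed
  with update show ?case by (simp add: update_eq_add_single distrib_right derivation_add algebra_simps)
qed

lemma derivation_gconst: "derivation d (gconst c) = 0"
  by (simp add: gconst_def derivation_single monomial_derivation_def)

lemma derivation_gvar: "derivation d (gvar v) = d v"
  by (simp add: gvar_def derivation_single monomial_derivation_def)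

lemma derivation_linear: "derivation (\<lambda>v. a * d v + b * e v) f = a * derivation d f + b * derivation e f"
  by (simp add: derivation_def monomial_derivation_def sum_distrib_left sum.distrib algebra_simps)

text \<open>The extension of prescribed brackets of variables, \<open>\<Sum> (\<partial>f/\<partial>u) (\<partial>g/\<partial>v) b u v\<close>, as a derivation with
  values \<open>derivation (b u) g\<close> on the variables.\<close>

definition biderivation :: "(gen \<Rightarrow> gen \<Rightarrow> gpoly) \<Rightarrow> gpoly \<Rightarrow> gpoly \<Rightarrow> gpoly" where
  "biderivation b f g = derivation (\<lambda>u. derivation (b u) g) f"

lemma biderivation_gvar: "biderivation b (gvar u) (gvar v) = b u v"
  by (simp add: biderivation_def derivation_gvar)

lemma biderivation_gconst_left: "biderivation b (gconst c) g = 0"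
  by (simp add: biderivation_def derivation_gconst)

lemma biderivation_add_left: "biderivation b (f + g) h = biderivation b f h + biderivation b g h"
  by (simp add: biderivation_def derivation_add)

lemma biderivation_mult_left: "biderivation b (f * g) h = f * biderivation b g h + biderivation b f h * g"
  by (simp add: biderivation_def derivation_mult)

lemma biderivation_gconst_right: "biderivation b g (gconst c) = 0"
  using derivation_linear[of 0 "\<lambda>_. 0" 0 "\<lambda>_. 0" g] by (simp add: biderivation_def derivation_gconst)

lemma biderivation_add_right: "biderivation b h (f + g) = biderivation b h f + biderivation b h g"
  using derivation_linear[of 1 "\<lambda>u. derivation (b u) f" 1 "\<lambda>u. derivation (b u) g" h]
  by (simp add: biderivation_def derivation_add)

lemma biderivation_mult_right: "biderivation b h (f * g) = f * biderivation b h g + biderivation b h f * g"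
  using derivation_linear[of f "\<lambda>u. derivation (b u) g" g "\<lambda>u. derivation (b u) f" h]
  by (simp add: biderivation_def derivation_mult mult.commute)

lemma biderivation_skew:
  assumes "\<And>u v. b v u = - b u v"
  shows "biderivation b g f = - biderivation b f g"
proof -
  have "f \<in> poly_over UNIV" "g \<in> poly_over UNIV" by (simp_all add: poly_over_UNIV)
  then show ?thesis
  proof (induction f rule: poly_over_induct)
    case (var u)
    from var(2) show ?case
      by (induction g rule: poly_over_induct)
        (simp_all add: biderivation_gvar assms[of _ u] biderivation_gconst_left biderivation_gconst_right
          biderivation_add_left biderivation_add_right biderivation_mult_left biderivation_mult_right)
  qed (simp_all add: biderivation_gconst_left biderivation_gconst_right
      biderivation_add_left biderivation_add_right biderivation_mult_left biderivation_mult_right)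
qed

lemma biderivation_closed:
  assumes b: "\<And>u v. u \<in> V \<Longrightarrow> v \<in> V \<Longrightarrow> b u v \<in> poly_over V"
    and "f \<in> poly_over V" "g \<in> poly_over V"
  shows "biderivation b f g \<in> poly_over V"
  using assms(2,3)
proof (induction f rule: poly_over_induct)
  case (const c)
  then show ?case using gconst_in_poly_over[of 0 V] by (simp add: biderivation_gconst_left)
next
  case (var u)
  from var(2) show ?case
  proof (induction g rule: poly_over_induct)
    case (const c)
    then show ?case using gconst_in_poly_over[of 0 V] by (simp add: biderivation_gconst_right)
  next
    case (var v)
    then show ?case using b \<open>u \<in> V\<close> by (simp add: biderivation_gvar)
  qed (simp_all add: biderivation_add_right biderivation_mult_right add_in_poly_over mult_in_poly_over)
qed (simp_all add: biderivation_add_left biderivation_mult_left add_in_poly_over mult_in_poly_over)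

text \<open>The Jacobiator of a skew biderivation is cyclic and a derivation in its first argument, hence in
  each argument: the terms that would violate the product rule cancel by
  skew-symmetry. So it vanishes
  as soon as it vanishes on variables.\<close>

lemma biderivation_jacobi:
  fixes b :: "gen \<Rightarrow> gen \<Rightarrow> gpoly"
  defines "B \<equiv> biderivation b"
  assumes skew: "\<And>u v. b v u = - b u v"
    and gens: "\<And>u v w. u \<in> V \<Longrightarrow> v \<in> V \<Longrightarrow> w \<in> V \<Longrightarrow>
      B (gvar u) (B (gvar v) (gvar w)) + B (gvar v) (B (gvar w) (gvar u)) + B (gvar w) (B (gvar u) (gvar v)) = 0"
    and "f \<in> poly_over V" "g \<in> poly_over V" "h \<in> poly_over V"
  shows "B f (B g h) + B g (B h f) + B h (B f g) = 0"
proof -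
  define J where "J f g h = B f (B g h) + B g (B h f) + B h (B f g)" for f g h
  have B_skew: "B g f = - B f g" for f g
    unfolding B_def by (rule biderivation_skew) (rule skew)
  have cyc: "J f g h = J g h f" for f g h by (simp add: J_def algebra_simps)
  have add: "J (f + f') g h = J f g h + J f' g h" for f f' g h
    by (simp add: J_def B_def biderivation_add_left biderivation_add_right algebra_simps)
  have zero: "B f 0 = 0" "B 0 f = 0" for f
    using biderivation_gconst_left[of b 0 f] biderivation_gconst_right[of b f 0] by (simp_all add: B_def)
  have const: "J (gconst c) g h = 0" for c g h
    using zero by (simp add: J_def B_def biderivation_gconst_left biderivation_gconst_right)
  have mult: "J (f * f') g h = f * J f' g h + J f g h * f'" for f f' g h
  proof -
    have "J (f * f') g h = f * J f' g h + J f g h * f' + (B g f + B f g) * B h f' + (B g f' + B f' g) * B h f"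
      unfolding J_def B_def
      by (simp add: biderivation_mult_left biderivation_mult_right biderivation_add_right biderivation_add_left algebra_simps)
    then show ?thesis by (simp add: B_skew[of f g] B_skew[of f' g])
  qed
  have reduce: "J f g h = 0" if "f \<in> poly_over V" "\<And>u. u \<in> V \<Longrightarrow> J (gvar u) g h = 0" for f g h
    using that(1) by (induction f rule: poly_over_induct) (simp_all add: add mult const that(2))
  have "J f g h = 0"
  proof (rule reduce[OF assms(4)])
    fix u assume u: "u \<in> V"
    have "J g h (gvar u) = 0"
    proof (rule reduce[OF assms(5)])
      fix v assume v: "v \<in> V"
      have "J h (gvar u) (gvar v) = 0"
        using u v gens by (intro reduce[OF assms(6)]) (simp add: J_def)
      then show "J (gvar v) h (gvar u) = 0" using cyc[of "gvar v" h "gvar u"] by simp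
    qed
    then show "J (gvar u) g h = 0" using cyc[of "gvar u" g h] by simp
  qed
  then show ?thesis by (simp add: J_def)
qed

section \<open>The Jacobi identity for chords\<close>

text \<open>The alternating count of triples with one end point from each of three chords that coincide.\<close>

definition coincidences :: "site \<Rightarrow> site \<Rightarrow> site \<Rightarrow> site \<Rightarrow> site \<Rightarrow> site \<Rightarrow> int" where
  "coincidences J I P L Q R =
     (let \<delta> = (\<lambda>a b c. of_bool (a = b \<and> b = c))
      in \<delta> J P Q - \<delta> J P R - \<delta> J L Q + \<delta> J L R - \<delta> I P Q + \<delta> I P R + \<delta> I L Q - \<delta> I L R)"

lemma coincidences_swap:
  "coincidences I J P L Q R = - coincidences J I P L Q R"
  "coincidences J I L P Q R = - coincidences J I P L Q R"
  "coincidences J I P L R Q = - coincidences J I P L Q R"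
  by (simp_all add: coincidences_def Let_def)

text \<open>The signs satisfy the relation \<open>coth x coth y + coth y coth z + coth z coth x = -1\<close>, where
  \<open>x + y + z = 0\<close>, that makes the classical Yang--Baxter equation hold; it fails only for three equal
  sites.\<close>

lemma site_sgn_triple:
  "site_sgn a b * site_sgn b c - site_sgn b c * site_sgn a c - site_sgn a c * site_sgn a b
     = of_bool (a = b \<and> b = c) - 1"
  by (cases a; cases b; cases c) (auto simp: site_sgn_def sgn_if)

lemma linking_swap:
  "linking I J P L = - linking J I P L" "linking J I L P = - linking J I P L" "linking P L J I = - linking J I P L"
  by (simp_all add: linking_def site_sgn_skew[of P] site_sgn_skew[of L])

text \<open>Expanded into signs, the left-hand side is an alternating sum of eight expressions as in the
  preceding relation, in which the constants \<open>-1\<close> cancel.\<close>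

lemma linking_quadratic:
  "linking P L Q R * linking J I P R + linking Q R J I * linking P L Q I + linking J I P L * linking Q R J L
     = coincidences J I P L Q R"
proof -
  define t where "t a b c = site_sgn a b * site_sgn b c - site_sgn b c * site_sgn a c - site_sgn a c * site_sgn a b" for a b c
  have "linking P L Q R * linking J I P R + linking Q R J I * linking P L Q I + linking J I P L * linking Q R J L
      = t J P Q - t J P R - t J L Q + t J L R - t I P Q + t I P R + t I L Q - t I L R"
    unfolding linking_def t_def site_sgn_skew[of Q J] site_sgn_skew[of Q I] site_sgn_skew[of R J] site_sgn_skew[of R I]
      site_sgn_skew[of P I] site_sgn_skew[of L I] site_sgn_skew[of Q L] site_sgn_skew[of R L]
    by (simp add: algebra_simps)
  then show ?thesis by (simp add: t_def site_sgn_triple coincidences_def Let_def)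
qed

text \<open>The bracket of \<open>{J, I}\<close> with the chord bracket of \<open>{P, L}\<close> and \<open>{Q, R}\<close>, expanded by the product
  rule with no average over shifts.\<close>

definition nested_chord ::
    "(int \<Rightarrow> nat \<Rightarrow> nat \<Rightarrow> 'a::comm_ring_1) \<Rightarrow> site \<Rightarrow> site \<Rightarrow> site \<Rightarrow> site \<Rightarrow> site \<Rightarrow> site \<Rightarrow> 'a" where
  "nested_chord G J I P L Q R = of_int (linking P L Q R) *
     (chord_bracket G J I Q L * pairing G P R + pairing G Q L * chord_bracket G J I P R
      - chord_bracket G J I Q P * pairing G L R - pairing G Q P * chord_bracket G J I L R)"

text \<open>The cyclic sum is a combination of eight cubic monomials, each matching the end points of the three
  chords in a cycle. Each coefficient is a quadratic expression in linking numbers, equal up to sign to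
  \<open>coincidences J I P L Q R\<close>, so the sum factorises as \<open>c K\<close>, where \<open>K\<close> is the alternating sum of the
  monomials. If three end points, one of each chord, coincide then \<open>K\<close> vanishes, otherwise \<open>c\<close> does.\<close>

lemma nested_chord_jacobi:
  fixes G :: "int \<Rightarrow> nat \<Rightarrow> nat \<Rightarrow> 'a::comm_ring_1"
  assumes sym: "\<And>k i j. G (- k) j i = G k i j"
  shows "nested_chord G J I P L Q R + nested_chord G P L Q R J I + nested_chord G Q R J I P L = 0"
proof -
  define g where "g a b = pairing G a b" for a b
  have gs: "g b a = g a b" for a b unfolding g_def by (rule pairing_sym) (rule sym)
  \<comment> \<open>The eight ways to join the three chords to a closed hexagon.\<close>
  define u1 where "u1 = g I P * g J R * g L Q"
  define u2 where "u2 = g I R * g J P * g L Q"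
  define u3 where "u3 = g I Q * g J P * g L R"
  define u4 where "u4 = g I P * g J Q * g L R"
  define u5 where "u5 = g I Q * g J L * g P R"
  define u6 where "u6 = g I R * g J L * g P Q"
  define u7 where "u7 = g I L * g J Q * g P R"
  define u8 where "u8 = g I L * g J R * g P Q"
  note u = u1_def u2_def u3_def u4_def u5_def u6_def u7_def u8_def
  note orient = gs[of P I] gs[of P J] gs[of L I] gs[of L J] gs[of Q I] gs[of Q J] gs[of R I] gs[of R J]
    gs[of Q P] gs[of Q L] gs[of R P] gs[of R L]
  define l where "l a b c d = (of_int (linking a b c d) :: 'a)" for a b c d
  have N1: "nested_chord G J I P L Q R =
      l P L Q R * (l J I Q L * (u5 - u7) + l J I P R * (u1 - u2) - l J I Q P * (u3 - u4) - l J I L R * (u8 - u6))"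
    unfolding nested_chord_def chord_bracket_def g_def[symmetric] l_def[symmetric] orient u
    by (simp add: algebra_simps)
  have N2: "nested_chord G P L Q R J I =
      l Q R J I * (l P L J R * (u5 - u3) + l P L Q I * (u1 - u8) - l P L J Q * (u6 - u2) - l P L R I * (u4 - u7))"
    unfolding nested_chord_def chord_bracket_def g_def[symmetric] l_def[symmetric] orient u
    by (simp add: algebra_simps)
  have N3: "nested_chord G Q R J I P L =
      l J I P L * (l Q R P I * (u5 - u6) + l Q R J L * (u1 - u4) - l Q R P J * (u7 - u8) - l Q R I L * (u2 - u3))"
    unfolding nested_chord_def chord_bracket_def g_def[symmetric] l_def[symmetric] orient u
    by (simp add: algebra_simps)
  have quad: "l c d e f * l a b c f + l e f a b * l c d e b + l a b c d * l e f a d = of_int (coincidences a b c d e f)"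
    for a b c d e f
    unfolding l_def linking_quadratic[symmetric] by simp
  define e where "e a b = (of_int (site_sgn a b) :: 'a)" for a b
  have l: "l a b c d = e a c - e b c - e a d + e b d" for a b c d
    by (simp add: l_def e_def linking_def)
  define c where "c = (of_int (coincidences J I P L Q R) :: 'a)"
  note cs = coincidences_swap(1)[of I J] coincidences_swap(2)[of _ _ L P] coincidences_swap(3)[of _ _ _ _ R Q]
  \<comment> \<open>Exchanging the end points of chords carries the coefficient of \<open>u1\<close> to the seven others.\<close>
  note q1 = quad[of P L Q R J I, folded c_def]
  have q2: "l P L Q R * l J I P R - l Q R J I * l P L J Q + l J I P L * l Q R I L = c"
    using quad[of P L Q R I J] unfolding cs of_int_minus c_def[symmetric] l by (simp add: algebra_simps)
  have q3: "l P L Q R * l J I Q P + l Q R J I * l P L J R - l J I P L * l Q R I L = - c"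
    using quad[of P L R Q I J] unfolding cs of_int_minus c_def[symmetric] l by (simp add: algebra_simps)
  have q4: "l P L Q R * l J I Q P - l Q R J I * l P L R I - l J I P L * l Q R J L = - c"
    using quad[of P L R Q J I] unfolding cs of_int_minus c_def[symmetric] l by (simp add: algebra_simps)
  have q5: "l P L Q R * l J I Q L + l Q R J I * l P L J R + l J I P L * l Q R P I = - c"
    using quad[of L P R Q I J] unfolding cs of_int_minus c_def[symmetric] l by (simp add: algebra_simps)
  have q6: "l P L Q R * l J I L R - l Q R J I * l P L J Q - l J I P L * l Q R P I = c"
    using quad[of L P Q R I J] unfolding cs of_int_minus c_def[symmetric] l by (simp add: algebra_simps)
  have q7: "l P L Q R * l J I Q L - l Q R J I * l P L R I + l J I P L * l Q R P J = - c"
    using quad[of L P R Q J I] unfolding cs of_int_minus c_def[symmetric] l by (simp add: algebra_simps)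
  have q8: "l P L Q R * l J I L R + l Q R J I * l P L Q I - l J I P L * l Q R P J = c"
    using quad[of L P Q R J I] unfolding cs of_int_minus c_def[symmetric] l by (simp add: algebra_simps)
  define K where "K = u1 - u2 + u3 - u4 - u5 + u6 + u7 - u8"
  have "nested_chord G J I P L Q R + nested_chord G P L Q R J I + nested_chord G Q R J I P L =
      u1 * (l P L Q R * l J I P R + l Q R J I * l P L Q I + l J I P L * l Q R J L)
    - u2 * (l P L Q R * l J I P R - l Q R J I * l P L J Q + l J I P L * l Q R I L)
    - u3 * (l P L Q R * l J I Q P + l Q R J I * l P L J R - l J I P L * l Q R I L)
    + u4 * (l P L Q R * l J I Q P - l Q R J I * l P L R I - l J I P L * l Q R J L)
    + u5 * (l P L Q R * l J I Q L + l Q R J I * l P L J R + l J I P L * l Q R P I)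
    + u6 * (l P L Q R * l J I L R - l Q R J I * l P L J Q - l J I P L * l Q R P I)
    - u7 * (l P L Q R * l J I Q L - l Q R J I * l P L R I + l J I P L * l Q R P J)
    - u8 * (l P L Q R * l J I L R + l Q R J I * l P L Q I - l J I P L * l Q R P J)"
    unfolding N1 N2 N3 by (simp add: algebra_simps)
  also have "\<dots> = c * K"
    unfolding q1 q2 q3 q4 q5 q6 q7 q8 K_def by (simp add: algebra_simps)
  also have "c * K = 0"
  proof -
    have K0: "K = 0" if "a = b \<and> b = d" "a \<in> {J, I}" "b \<in> {P, L}" "d \<in> {Q, R}" for a b d
      using that by (auto simp: K_def u gs mult_ac)
    show ?thesis
    proof (cases "K = 0")
      case False
      then have n: "of_bool (a = b \<and> b = d) = (0 :: int)" if "a \<in> {J, I}" "b \<in> {P, L}" "d \<in> {Q, R}" for a b d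
        using K0[OF _ that] by (simp only: of_bool_eq_0_iff) blast
      have "coincidences J I P L Q R = 0"
        unfolding coincidences_def Let_def
          n[OF insertI1 insertI1 insertI1] n[OF insertI1 insertI1 insertI2[OF singletonI]]
          n[OF insertI1 insertI2[OF singletonI] insertI1] n[OF insertI1 insertI2[OF singletonI] insertI2[OF singletonI]]
          n[OF insertI2[OF singletonI] insertI1 insertI1] n[OF insertI2[OF singletonI] insertI1 insertI2[OF singletonI]]
          n[OF insertI2[OF singletonI] insertI2[OF singletonI] insertI1]
          n[OF insertI2[OF singletonI] insertI2[OF singletonI] insertI2[OF singletonI]]
        by simp
      then have "c = 0" by (simp add: c_def)
      then show ?thesis by simp
    qed simp
  qed
  finally show ?thesis .
qed

section \<open>The abstract Poisson bracket\<close>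

lemma snd_shift: "snd (shift s I) = snd I"
  by (simp add: shift_def)

lemma bij_int_plus: "bij (\<lambda>s::int. s + a)"
  by (rule bij_betw_byWitness[of _ "\<lambda>s. s - a"]) auto

lemma bij_int_uminus: "bij (uminus :: int \<Rightarrow> int)"
  by (rule bij_betw_byWitness[of _ uminus]) auto

lemma chord_bracket_shift [simp]:
  "chord_bracket G (shift a J) (shift a I) (shift a P) (shift a L) = chord_bracket G J I P L"
  by (simp add: chord_bracket_def linking_def)

lemma linking_shift [simp]: "linking (shift a J) (shift a I) (shift a P) (shift a L) = linking J I P L"
  by (simp add: linking_def)

lemma nested_chord_shift:
  "nested_chord G (shift a J) (shift a I) (shift a P) (shift a L) (shift a Q) (shift a R) = nested_chord G J I P L Q R"
  by (simp add: nested_chord_def linking_def)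

lemma periodic_bracket_self: "periodic_bracket G J J P L = 0"
  by (simp add: periodic_bracket_def chord_bracket_def linking_def)

lemma periodic_bracket_shift_left: "periodic_bracket G (shift a J) (shift a I) P L = periodic_bracket G J I P L"
  unfolding periodic_bracket_def
proof (rule Sum_any.reindex_cong[OF bij_int_plus[of a]])
  show "(\<lambda>s. chord_bracket G (shift a J) (shift a I) (shift s P) (shift s L)) \<circ> (\<lambda>s. s + a) =
      (\<lambda>s. chord_bracket G J I (shift s P) (shift s L))"
  proof
    fix s show "((\<lambda>s. chord_bracket G (shift a J) (shift a I) (shift s P) (shift s L)) \<circ> (\<lambda>s. s + a)) s =
      chord_bracket G J I (shift s P) (shift s L)"
      using chord_bracket_shift[of G a J I "shift s P" "shift s L"] by (simp add: add.commute)
  qed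
qed

context
  fixes G :: "int \<Rightarrow> nat \<Rightarrow> nat \<Rightarrow> 'a::comm_ring_1"
  assumes sym: "\<And>k i j. G (- k) j i = G k i j"
begin

lemma chord_bracket_swap_left: "chord_bracket G I J P L = chord_bracket G J I P L"
  by (simp add: chord_bracket_def linking_swap(1)[of I J] algebra_simps)

lemma chord_bracket_skew: "chord_bracket G P L J I = - chord_bracket G J I P L"
  by (simp add: chord_bracket_def linking_swap(3)[of P L J I] pairing_sym[of G J P, OF sym] pairing_sym[of G L I, OF sym]
      pairing_sym[of G J L, OF sym] pairing_sym[of G P I, OF sym] algebra_simps)

lemma periodic_bracket_swap_left: "periodic_bracket G I J P L = periodic_bracket G J I P L"
  by (simp add: periodic_bracket_def chord_bracket_swap_left[of I J])

lemma periodic_bracket_skew: "periodic_bracket G P L J I = - periodic_bracket G J I P L"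
proof -
  have "periodic_bracket G P L J I = Sum_any (\<lambda>s. - chord_bracket G J I (shift s P) (shift s L))"
    unfolding periodic_bracket_def
  proof (rule Sum_any.reindex_cong[OF bij_int_uminus])
    show "(\<lambda>s. chord_bracket G P L (shift s J) (shift s I)) \<circ> uminus = (\<lambda>s. - chord_bracket G J I (shift s P) (shift s L))"
    proof
      fix s
      have "chord_bracket G P L (shift (- s) J) (shift (- s) I) = chord_bracket G (shift s P) (shift s L) J I"
        using chord_bracket_shift[of G s P L "shift (- s) J" "shift (- s) I"] by simp
      then show "((\<lambda>s. chord_bracket G P L (shift s J) (shift s I)) \<circ> uminus) s = - chord_bracket G J I (shift s P) (shift s L)"
        by (simp add: chord_bracket_skew[of "shift s P"])
    qed
  qed
  also have "\<dots> = - periodic_bracket G J I P L"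
    unfolding periodic_bracket_def Sum_any.expand_set by (simp add: sum_negf)
  finally show ?thesis .
qed

end

lemma G_abs_sym: "G_abs (- k) j i = G_abs k i j"
  by (auto simp: G_abs_def min.commute max.commute)

lemma G_abs_0_diag: "G_abs 0 i i = 2"
  by (simp add: G_abs_def)

text \<open>The value \<open>0\<close> outside the generators makes the extension skew on all polynomials.\<close>

definition D_generator_bracket :: "nat \<Rightarrow> gen \<Rightarrow> gen \<Rightarrow> gpoly" where
  "D_generator_bracket n = (\<lambda>(m, j, i) (k, p, l).
     if (m, j, i) \<in> D_gens n \<and> (k, p, l) \<in> D_gens n
     then periodic_bracket G_abs (0, j) (int m, i) (0, p) (int k, l) else 0)"

definition D_bracket :: "nat \<Rightarrow> gpoly \<Rightarrow> gpoly \<Rightarrow> gpoly" where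
  "D_bracket n = biderivation (D_generator_bracket n)"

lemma D_generator_bracket_skew: "D_generator_bracket n v u = - D_generator_bracket n u v"
proof -
  obtain m j i k p l where "u = (m, j, i)" "v = (k, p, l)" by (metis prod_cases3)
  then show ?thesis
    using periodic_bracket_skew[of G_abs "(0, p)" "(int k, l)" "(0, j)" "(int m, i)", OF G_abs_sym]
    by (simp add: D_generator_bracket_def)
qed

lemma D_bracket_skew: "D_bracket n g f = - D_bracket n f g"
  unfolding D_bracket_def by (rule biderivation_skew) (rule D_generator_bracket_skew)

text \<open>Up to a shift and an exchange of the two sites, every pair of different sites is a generator.\<close>

lemma site_pair_induct [consumes 2, case_names equal generator shift swap]:
  assumes "snd J \<in> {1..n}" "snd I \<in> {1..n}"
    and equal: "\<And>J. R J J"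
    and gen: "\<And>m j i. (m, j, i) \<in> D_gens n \<Longrightarrow> R (0, j) (int m, i)"
    and shift: "\<And>a J I. R J I \<Longrightarrow> R (shift a J) (shift a I)"
    and swap: "\<And>J I. R J I \<Longrightarrow> R I J"
  shows "R J I"
proof -
  have forward: "R J I" if "snd J \<in> {1..n}" "snd I \<in> {1..n}" "fst J < fst I \<or> fst J = fst I \<and> snd J < snd I" for J I
  proof -
    define m where "m = nat (fst I - fst J)"
    have "(m, snd J, snd I) \<in> D_gens n" using that by (auto simp: D_gens_def m_def)
    from shift[OF gen[OF this], of "fst J"] show ?thesis
      using that by (auto simp: shift_def m_def split: if_splits)
  qed
  consider "fst J < fst I \<or> fst J = fst I \<and> snd J < snd I" | "fst I < fst J \<or> fst I = fst J \<and> snd I < snd J" | "J = I"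
    unfolding prod_eq_iff by linarith
  then show ?thesis
    using forward[of J I] forward[of I J] assms(1,2) swap equal by cases auto
qed

lemma pairing_G_abs_generator: "(m, j, i) \<in> D_gens n \<Longrightarrow> pairing G_abs (0, j) (int m, i) = gvar (m, j, i)"
  by (auto simp: pairing_def G_abs_def D_gens_def)

lemma pairing_G_abs_self: "pairing G_abs J J = gconst 2"
  by (simp add: pairing_def G_abs_0_diag flip: gconst_of_int[of 2, simplified])

lemma D_bracket_pairing_left:
  assumes "snd J \<in> {1..n}" "snd I \<in> {1..n}" "(k, p, l) \<in> D_gens n"
  shows "D_bracket n (pairing G_abs J I) (gvar (k, p, l)) = periodic_bracket G_abs J I (0, p) (int k, l)"
  using assms(1,2)
proof (induction rule: site_pair_induct)
  case (equal J)
  then show ?case by (simp add: pairing_G_abs_self D_bracket_def biderivation_gconst_left periodic_bracket_self)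
next
  case (generator m j i)
  with assms(3) show ?case
    by (simp add: pairing_G_abs_generator D_bracket_def biderivation_gvar D_generator_bracket_def)
next
  case (shift a J I)
  then show ?case by (simp add: periodic_bracket_shift_left)
next
  case (swap J I)
  then show ?case
    by (simp add: pairing_sym[of G_abs I J, OF G_abs_sym] periodic_bracket_swap_left[of G_abs I J, OF G_abs_sym])
qed

text \<open>Both sides are invariant under shifts and exchanges of sites, so the case of generators, which is
  the definition, implies the general one.\<close>

lemma D_bracket_pairing:
  assumes "snd J \<in> {1..n}" "snd I \<in> {1..n}" "snd P \<in> {1..n}" "snd L \<in> {1..n}"
  shows "D_bracket n (pairing G_abs J I) (pairing G_abs P L) = periodic_bracket G_abs J I P L"
proof -
  have "D_bracket n (pairing G_abs P L) (pairing G_abs J I) = periodic_bracket G_abs P L J I"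
    using assms(3,4)
  proof (induction rule: site_pair_induct)
    case (equal J)
    then show ?case by (simp add: pairing_G_abs_self D_bracket_def biderivation_gconst_left periodic_bracket_self)
  next
    case (generator k p l)
    then show ?case
      using D_bracket_pairing_left[OF assms(1,2) generator] D_bracket_skew[of n "gvar (k, p, l)" "pairing G_abs J I"]
        periodic_bracket_skew[of G_abs "(0, p)" "(int k, l)" J I, OF G_abs_sym]
      by (simp add: pairing_G_abs_generator)
  next
    case (shift a J I)
    then show ?case by (simp add: periodic_bracket_shift_left)
  next
    case (swap J I)
    then show ?case
      by (simp add: pairing_sym[of G_abs I J, OF G_abs_sym] periodic_bracket_swap_left[of G_abs I J, OF G_abs_sym])
  qed
  then show ?thesis
    using D_bracket_skew[of n "pairing G_abs J I" "pairing G_abs P L"]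
      periodic_bracket_skew[of G_abs P L J I, OF G_abs_sym] by simp
qed

lemma D_bracket_Sum_any_right:
  assumes "finite {t. f t \<noteq> 0}"
  shows "D_bracket n F (Sum_any f) = Sum_any (\<lambda>t. D_bracket n F (f t))"
proof -
  have zero: "D_bracket n F 0 = 0"
    using biderivation_gconst_right[of _ F 0] by (simp add: D_bracket_def)
  have "D_bracket n F (sum f X) = (\<Sum>t\<in>X. D_bracket n F (f t))" for X
    by (induction X rule: infinite_finite_induct) (simp_all add: zero, simp add: D_bracket_def biderivation_add_right)
  then show ?thesis
    unfolding Sum_any.expand_set[of f]
    by (simp only:) (rule Sum_any.expand_superset[symmetric], use assms zero in auto)
qed

lemma D_bracket_of_int_mult: "D_bracket n F (of_int c * f) = of_int c * D_bracket n F f"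
  using biderivation_mult_right[of _ F "gconst (of_int c)" f] biderivation_gconst_right[of _ F "of_int c"]
  by (simp add: D_bracket_def gconst_of_int)

lemma D_bracket_chord:
  assumes "snd J \<in> {1..n}" "snd I \<in> {1..n}" "snd P \<in> {1..n}" "snd L \<in> {1..n}" "snd Q \<in> {1..n}" "snd R \<in> {1..n}"
  shows "D_bracket n (pairing G_abs J I) (chord_bracket G_abs P L Q R) =
    Sum_any (\<lambda>s. nested_chord G_abs J I (shift s P) (shift s L) (shift s Q) (shift s R))"
proof -
  let ?B = "D_bracket n (pairing G_abs J I)"
  have diff: "?B (f - g) = ?B f - ?B g" for f g
    using biderivation_add_right[of _ "pairing G_abs J I" "f - g" g] by (simp add: D_bracket_def algebra_simps)
  have mult: "?B (f * g) = f * ?B g + ?B f * g" for f g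
    by (simp add: D_bracket_def biderivation_mult_right)
  define S where "S X Y = {s. chord_bracket G_abs J I (shift s X) (shift s Y) \<noteq> 0}" for X Y
  define U where "U = S Q L \<union> S P R \<union> S Q P \<union> S L R"
  have fin: "finite U" by (simp add: U_def S_def finite_chord_support)
  have per: "periodic_bracket G_abs J I X Y = (\<Sum>s\<in>U. chord_bracket G_abs J I (shift s X) (shift s Y))"
    if "S X Y \<subseteq> U" for X Y
    unfolding periodic_bracket_def using fin that by (intro Sum_any.expand_superset) (auto simp: S_def)
  have "?B (chord_bracket G_abs P L Q R) = of_int (linking P L Q R) *
     (periodic_bracket G_abs J I Q L * pairing G_abs P R + pairing G_abs Q L * periodic_bracket G_abs J I P R
      - periodic_bracket G_abs J I Q P * pairing G_abs L R - pairing G_abs Q P * periodic_bracket G_abs J I L R)"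
    unfolding chord_bracket_def[of G_abs P] D_bracket_of_int_mult unfolding diff mult
    using assms by (simp add: D_bracket_pairing algebra_simps)
  also have "\<dots> = (\<Sum>s\<in>U. nested_chord G_abs J I (shift s P) (shift s L) (shift s Q) (shift s R))"
  proof -
    have "S Q L \<subseteq> U" "S P R \<subseteq> U" "S Q P \<subseteq> U" "S L R \<subseteq> U" by (auto simp: U_def)
    note per[OF this(1)] per[OF this(2)] per[OF this(3)] per[OF this(4)]
    then show ?thesis
      by (simp add: nested_chord_def sum.distrib sum_subtractf flip: sum_distrib_left sum_distrib_right)
  qed
  also have "\<dots> = Sum_any (\<lambda>s. nested_chord G_abs J I (shift s P) (shift s L) (shift s Q) (shift s R))"
  proof (rule Sum_any.expand_superset[symmetric, OF fin], rule subsetI)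
    fix s assume s: "s \<in> {s. nested_chord G_abs J I (shift s P) (shift s L) (shift s Q) (shift s R) \<noteq> 0}"
    show "s \<in> U"
    proof (rule ccontr)
      assume "s \<notin> U"
      then have "nested_chord G_abs J I (shift s P) (shift s L) (shift s Q) (shift s R) = 0"
        by (simp add: nested_chord_def U_def S_def)
      with s show False by simp
    qed
  qed
  finally show ?thesis .
qed

text \<open>A non-zero term needs \<open>{P\<^sub>s, L\<^sub>s}\<close> linked with \<open>{Q\<^sub>t, R\<^sub>t}\<close>, which bounds \<open>t - s\<close>, and one of these four
  sites near \<open>J\<close> and \<open>I\<close>, which bounds \<open>s\<close> or \<open>t\<close>.\<close>

lemma nested_chord_support:
  assumes "nested_chord G J I (shift s P) (shift s L) (shift t Q) (shift t R) \<noteq> 0"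
    and K: "K = \<bar>fst J\<bar> + \<bar>fst I\<bar> + \<bar>fst P\<bar> + \<bar>fst L\<bar> + \<bar>fst Q\<bar> + \<bar>fst R\<bar>"
  shows "\<bar>t - s\<bar> \<le> K" "\<bar>s\<bar> \<le> 2 * K"  "\<bar>t\<bar> \<le> 2 * K"
proof -
  let ?P = "shift s P" and ?L = "shift s L" and ?Q = "shift t Q" and ?R = "shift t R"
  have 1: "linking ?P ?L ?Q ?R \<noteq> 0"
    using assms(1) by (auto simp: nested_chord_def)
  have 2: "linking J I ?Q ?L \<noteq> 0 \<or> linking J I ?P ?R \<noteq> 0 \<or> linking J I ?Q ?P \<noteq> 0 \<or> linking J I ?L ?R \<noteq> 0"
    using assms(1) by (auto simp: nested_chord_def chord_bracket_def)
  define d where "d X = \<bar>fst X\<bar>" for X :: site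
  have K': "K = d J + d I + d P + d L + d Q + d R" by (simp add: K d_def)
  have pos: "0 \<le> d X" for X by (simp add: d_def)
  note pos' = pos[of J] pos[of I] pos[of P] pos[of L] pos[of Q] pos[of R]
  have bound: "\<bar>x + u\<bar> \<le> \<bar>a\<bar> + \<bar>b\<bar>" if "x + u \<in> {min a b..max a b}" for x u a b :: int
    using that by (auto simp: min_def max_def split: if_splits)
  have triangle: "\<bar>u\<bar> \<le> \<bar>x + u\<bar> + \<bar>x\<bar>" for x u :: int
    by linarith
  from linking_supp_levels[OF 1] show ts: "\<bar>t - s\<bar> \<le> K"
  proof
    assume "fst ?Q \<in> {min (fst ?P) (fst ?L)..max (fst ?P) (fst ?L)}"
    then have "fst Q + (t - s) \<in> {min (fst P) (fst L)..max (fst P) (fst L)}" by (auto simp: shift_def)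
    from order_trans[OF triangle[of "t - s" "fst Q"] add_right_mono[OF bound[OF this]]] pos' show ?thesis
      unfolding K' d_def[symmetric] by linarith
  next
    assume "fst ?R \<in> {min (fst ?P) (fst ?L)..max (fst ?P) (fst ?L)}"
    then have "fst R + (t - s) \<in> {min (fst P) (fst L)..max (fst P) (fst L)}" by (auto simp: shift_def)
    from order_trans[OF triangle[of "t - s" "fst R"] add_right_mono[OF bound[OF this]]] pos' show ?thesis
      unfolding K' d_def[symmetric] by linarith
  qed
  let ?B = "{min (fst J) (fst I)..max (fst J) (fst I)}"
  have "fst P + s \<in> ?B \<or> fst L + s \<in> ?B \<or> fst Q + t \<in> ?B \<or> fst R + t \<in> ?B"
  proof -
    have "fst X \<in> ?B \<or> fst Y \<in> ?B" if "linking J I X Y \<noteq> 0" for X Y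
      using that by (rule linking_supp_levels)
    with 2 have "fst ?P \<in> ?B \<or> fst ?L \<in> ?B \<or> fst ?Q \<in> ?B \<or> fst ?R \<in> ?B" by blast
    then show ?thesis by (simp only: shift_def fst_conv)
  qed
  then have "\<bar>s\<bar> \<le> K \<or> \<bar>t\<bar> \<le> K"
  proof (elim disjE)
    assume "fst P + s \<in> ?B"
    from order_trans[OF triangle[of s "fst P"] add_right_mono[OF bound[OF this]]] pos' show ?thesis
      unfolding K' d_def[symmetric] by linarith
  next
    assume "fst L + s \<in> ?B"
    from order_trans[OF triangle[of s "fst L"] add_right_mono[OF bound[OF this]]] pos' show ?thesis
      unfolding K' d_def[symmetric] by linarith
  next
    assume "fst Q + t \<in> ?B"
    from order_trans[OF triangle[of t "fst Q"] add_right_mono[OF bound[OF this]]] pos' show ?thesis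
      unfolding K' d_def[symmetric] by linarith
  next
    assume "fst R + t \<in> ?B"
    from order_trans[OF triangle[of t "fst R"] add_right_mono[OF bound[OF this]]] pos' show ?thesis
      unfolding K' d_def[symmetric] by linarith
  qed
  then show "\<bar>s\<bar> \<le> 2 * K"  "\<bar>t\<bar> \<le> 2 * K" using ts by linarith+
qed

text \<open>The inner bracket averages over shifts \<open>t\<close> of the third chord against the second, the outer one over
  shifts \<open>s\<close> of both; the substitution of \<open>s + t\<close> for \<open>t\<close> makes the shifts of the two chords independent.\<close>

lemma D_bracket_twice:
  assumes "snd J \<in> {1..n}" "snd I \<in> {1..n}" "snd P \<in> {1..n}" "snd L \<in> {1..n}" "snd Q \<in> {1..n}" "snd R \<in> {1..n}"
  shows "D_bracket n (pairing G_abs J I) (D_bracket n (pairing G_abs P L) (pairing G_abs Q R)) =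
    Sum_any (\<lambda>(s, t). nested_chord G_abs J I (shift s P) (shift s L) (shift t Q) (shift t R))"
proof -
  define F where "F s t = nested_chord G_abs J I (shift s P) (shift s L) (shift t Q) (shift t R)" for s t
  define K where "K = \<bar>fst J\<bar> + \<bar>fst I\<bar> + \<bar>fst P\<bar> + \<bar>fst L\<bar> + \<bar>fst Q\<bar> + \<bar>fst R\<bar>"
  have supp: "\<bar>t - s\<bar> \<le> K" "\<bar>s\<bar> \<le> 2 * K" "\<bar>t\<bar> \<le> 2 * K" if "F s t \<noteq> 0" for s t
    using nested_chord_support[OF that[unfolded F_def] K_def] by auto
  have "D_bracket n (pairing G_abs J I) (D_bracket n (pairing G_abs P L) (pairing G_abs Q R)) =
      Sum_any (\<lambda>t. D_bracket n (pairing G_abs J I) (chord_bracket G_abs P L (shift t Q) (shift t R)))"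
    unfolding D_bracket_pairing[OF assms(3-6)] periodic_bracket_def
    by (rule D_bracket_Sum_any_right) (rule finite_chord_support)
  also have "\<dots> = Sum_any (\<lambda>t. Sum_any (\<lambda>s. F s (s + t)))"
    using assms by (simp add: D_bracket_chord F_def snd_shift)
  also have "\<dots> = Sum_any (\<lambda>(t, s). F s (s + t))"
  proof (rule Sum_any.cartesian_product)
    show "finite ({- K..K} \<times> {- 2 * K..2 * K})" by simp
    show "{t. \<exists>s. F s (s + t) \<noteq> 0} \<times> {s. \<exists>t. F s (s + t) \<noteq> 0} \<subseteq> {- K..K} \<times> {- 2 * K..2 * K}"
    proof -
      have "t \<in> {- K..K} \<and> s \<in> {- 2 * K..2 * K}" if "F s (s + t) \<noteq> 0" for s t
        using supp(1,2)[OF that] by (auto simp: abs_le_iff)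
      then show ?thesis by blast
    qed
  qed
  also have "\<dots> = Sum_any (\<lambda>(s, t). F s t)"
    by (rule Sum_any.reindex_cong[symmetric, of "\<lambda>(t, s). (s, s + t)"])
      (auto intro!: bij_betw_byWitness[of _ "\<lambda>(s, t). (t - s, s)"])
  finally show ?thesis by (simp add: F_def)
qed

lemma nested_chord_finite:
  "finite {(s, t). nested_chord G J I (shift s P) (shift s L) (shift t Q) (shift t R) \<noteq> 0}"
proof -
  define K where "K = \<bar>fst J\<bar> + \<bar>fst I\<bar> + \<bar>fst P\<bar> + \<bar>fst L\<bar> + \<bar>fst Q\<bar> + \<bar>fst R\<bar>"
  have "s \<in> {- (2 * K)..2 * K} \<and> t \<in> {- (2 * K)..2 * K}"
    if "nested_chord G J I (shift s P) (shift s L) (shift t Q) (shift t R) \<noteq> 0" for s t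
    using nested_chord_support(2,3)[OF that K_def] by (simp add: abs_le_iff)
  then have "{(s, t). nested_chord G J I (shift s P) (shift s L) (shift t Q) (shift t R) \<noteq> 0}
      \<subseteq> {- (2 * K)..2 * K} \<times> {- (2 * K)..2 * K}"
    by blast
  then show ?thesis by (rule finite_subset) simp
qed

text \<open>After a common shift of the three chords, the three double sums run over the same relative
  positions, and the Jacobi identity for chords applies to each position.\<close>

lemma D_bracket_jacobi_pairing:
  assumes "snd J \<in> {1..n}" "snd I \<in> {1..n}" "snd P \<in> {1..n}" "snd L \<in> {1..n}" "snd Q \<in> {1..n}" "snd R \<in> {1..n}"
  shows "D_bracket n (pairing G_abs J I) (D_bracket n (pairing G_abs P L) (pairing G_abs Q R))
    + D_bracket n (pairing G_abs P L) (D_bracket n (pairing G_abs Q R) (pairing G_abs J I))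
    + D_bracket n (pairing G_abs Q R) (D_bracket n (pairing G_abs J I) (pairing G_abs P L)) = 0"
proof -
  define F1 where "F1 = (\<lambda>(s, t). nested_chord G_abs J I (shift s P) (shift s L) (shift t Q) (shift t R))"
  define F2 where "F2 = (\<lambda>(s, t). nested_chord G_abs (shift s P) (shift s L) (shift t Q) (shift t R) J I)"
  define F3 where "F3 = (\<lambda>(s, t). nested_chord G_abs (shift t Q) (shift t R) J I (shift s P) (shift s L))"
  \<comment> \<open>The shifts that bring the first argument of the second and third term back to a common frame.\<close>
  have bij2: "bij (\<lambda>(s, t). (- t, s - t) :: int \<times> int)"
    by (rule bij_betw_byWitness[of _ "\<lambda>(s, t). (t - s, - s)"]) auto
  have bij3: "bij (\<lambda>(s, t). (t - s, - s) :: int \<times> int)"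
    by (rule bij_betw_byWitness[of _ "\<lambda>(s, t). (- t, s - t)"]) auto
  have eq2: "F2 \<circ> (\<lambda>(s, t). (- t, s - t)) = (\<lambda>(s, t). nested_chord G_abs P L (shift s Q) (shift s R) (shift t J) (shift t I))"
  proof (rule ext, clarify)
    fix s t
    show "(F2 \<circ> (\<lambda>(s, t). (- t, s - t))) (s, t) = nested_chord G_abs P L (shift s Q) (shift s R) (shift t J) (shift t I)"
      using nested_chord_shift[of G_abs t "shift (- t) P" "shift (- t) L" "shift (s - t) Q" "shift (s - t) R" J I]
      by (simp add: F2_def)
  qed
  have eq3: "F3 \<circ> (\<lambda>(s, t). (t - s, - s)) = (\<lambda>(s, t). nested_chord G_abs Q R (shift s J) (shift s I) (shift t P) (shift t L))"
  proof (rule ext, clarify)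
    fix s t
    show "(F3 \<circ> (\<lambda>(s, t). (t - s, - s))) (s, t) = nested_chord G_abs Q R (shift s J) (shift s I) (shift t P) (shift t L)"
      using nested_chord_shift[of G_abs s "shift (- s) Q" "shift (- s) R" J I "shift (t - s) P" "shift (t - s) L"]
      by (simp add: F3_def)
  qed
  have fin: "finite {x. F1 x \<noteq> 0}" "finite {x. (F2 \<circ> (\<lambda>(s, t). (- t, s - t))) x \<noteq> 0}"
    "finite {x. (F3 \<circ> (\<lambda>(s, t). (t - s, - s))) x \<noteq> 0}"
    unfolding eq2 eq3 F1_def
    using nested_chord_finite[of G_abs J I P L Q R] nested_chord_finite[of G_abs P L Q R J I]
      nested_chord_finite[of G_abs Q R J I P L]
    by (simp_all only: case_prod_unfold)
  have fin': "finite {x. F x \<noteq> 0}" if "bij l" "finite {x. (F \<circ> l) x \<noteq> 0}" for F :: "int \<times> int \<Rightarrow> gpoly" and l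
  proof -
    have "{x. F x \<noteq> 0} = l ` {x. (F \<circ> l) x \<noteq> 0}"
      using that(1) by (auto simp: image_iff) (metis bij_pointE)
    then show ?thesis using that(2) by simp
  qed
  have "D_bracket n (pairing G_abs J I) (D_bracket n (pairing G_abs P L) (pairing G_abs Q R))
    + D_bracket n (pairing G_abs P L) (D_bracket n (pairing G_abs Q R) (pairing G_abs J I))
    + D_bracket n (pairing G_abs Q R) (D_bracket n (pairing G_abs J I) (pairing G_abs P L)) = Sum_any F1 + Sum_any F2 + Sum_any F3"
    unfolding D_bracket_twice[OF assms] D_bracket_twice[OF assms(3-6,1,2)] D_bracket_twice[OF assms(5,6,1-4)]
      eq2[symmetric] eq3[symmetric] F1_def[symmetric]
      Sum_any.reindex_cong[OF bij2 refl, symmetric] Sum_any.reindex_cong[OF bij3 refl, symmetric] ..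
  also have "\<dots> = Sum_any (\<lambda>x. F1 x + F2 x + F3 x)"
  proof -
    have f: "finite {x. F2 x \<noteq> 0}" "finite {x. F3 x \<noteq> 0}"
      using fin'[OF bij2 fin(2)] fin'[OF bij3 fin(3)] by simp_all
    have "finite {x. F1 x + F2 x \<noteq> 0}"
      by (rule finite_subset[of _ "{x. F1 x \<noteq> 0} \<union> {x. F2 x \<noteq> 0}"]) (use fin(1) f in auto)
    then show ?thesis by (simp add: Sum_any.distrib fin(1) f)
  qed
  also have "(\<lambda>x. F1 x + F2 x + F3 x) = (\<lambda>_. 0)"
  proof (rule ext)
    fix x :: "int \<times> int"
    obtain s t where "x = (s, t)" by (cases x)
    then show "F1 x + F2 x + F3 x = 0"
      using nested_chord_jacobi[of G_abs J I "shift s P" "shift s L" "shift t Q" "shift t R", OF G_abs_sym]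
      by (simp add: F1_def F2_def F3_def)
  qed
  finally show ?thesis by simp
qed

lemma D_bracket_jacobi: "jacobi_on (D_alg n) (D_bracket n)"
  unfolding jacobi_on_def D_alg_eq D_bracket_def
proof (intro ballI)
  fix f g h assume "f \<in> poly_over (D_gens n)" "g \<in> poly_over (D_gens n)" "h \<in> poly_over (D_gens n)"
  then show "biderivation (D_generator_bracket n) f (biderivation (D_generator_bracket n) g h)
    + biderivation (D_generator_bracket n) g (biderivation (D_generator_bracket n) h f)
    + biderivation (D_generator_bracket n) h (biderivation (D_generator_bracket n) f g) = 0"
  proof (rule biderivation_jacobi[rotated 2])
    show "D_generator_bracket n v u = - D_generator_bracket n u v" for u v
      by (rule D_generator_bracket_skew)
    fix u v w assume gens: "u \<in> D_gens n" "v \<in> D_gens n" "w \<in> D_gens n"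
    have gen: "\<exists>J I. snd J \<in> {1..n} \<and> snd I \<in> {1..n} \<and> gvar u = pairing G_abs J I" if "u \<in> D_gens n" for u
    proof -
      obtain m j i where u: "u = (m, j, i)" by (metis prod_cases3)
      then have "j \<in> {1..n}" "i \<in> {1..n}" using that by (auto simp: D_gens_def)
      then show ?thesis
        using pairing_G_abs_generator[of m j i n] that u by (metis snd_conv)
    qed
    from gen[OF gens(1)] gen[OF gens(2)] gen[OF gens(3)] show
      "biderivation (D_generator_bracket n) (gvar u) (biderivation (D_generator_bracket n) (gvar v) (gvar w))
      + biderivation (D_generator_bracket n) (gvar v) (biderivation (D_generator_bracket n) (gvar w) (gvar u))
      + biderivation (D_generator_bracket n) (gvar w) (biderivation (D_generator_bracket n) (gvar u) (gvar v)) = 0"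
      using D_bracket_jacobi_pairing unfolding D_bracket_def by auto
  qed
qed

section \<open>The relations on monodromy matrices and the abstract algebra\<close>

lemma G_relations_cong:
  assumes "G_relations n G br'"
    and "\<And>m j i k p l. 0 \<le> m \<Longrightarrow> 0 \<le> k \<Longrightarrow> i \<in> {1..n} \<Longrightarrow> j \<in> {1..n} \<Longrightarrow> p \<in> {1..n} \<Longrightarrow> l \<in> {1..n} \<Longrightarrow>
      br m j i k p l = br' m j i k p l"
  shows "G_relations n G br"
  using assms(1) unfolding G_relations_def by (simp add: assms(2))

lemma G_relations_unique:
  assumes "G_relations n G br" "G_relations n G br'" and "0 \<le> m" "m \<le> k"
    and "i \<in> {1..n}" "j \<in> {1..n}" "p \<in> {1..n}" "l \<in> {1..n}"
  shows "br m j i k p l = br' m j i k p l"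
proof (cases "m = 0")
  case True
  then show ?thesis using assms unfolding G_relations_def by simp
next
  case False
  then have "0 < m \<and> m \<le> k" using assms(3,4) by simp
  then show ?thesis
    using assms(1,2)[unfolded G_relations_def, THEN conjunct2, rule_format, OF _ assms(5-8)] by simp
qed

lemma entry_deriv_const: "entry_deriv (\<lambda>X. c) i a b M = 0"
  by (simp add: entry_deriv_def)

lemma ks_bracket_const: "ks_bracket r (\<lambda>X. c) H M = 0" "ks_bracket r F (\<lambda>X. c) M = 0"
  by (simp_all add: ks_bracket_def entry_deriv_const)

lemma G_fun_0_diag:
  assumes "trace (M i) = 0" "det (M i) = 1"
  shows "G_fun n N 0 i i M = 2"
proof -
  have "trace (mat 1 :: mat2) = 2" by (simp add: trace_I)
  then show ?thesis using square_minus_one[OF assms] by (simp add: G_fun_def trace_minus)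
qed

text \<open>The bracket is the periodic bracket, and the constant terms that are \<open>0\<close> or \<open>1\<close> have zero bracket with
  everything.\<close>

lemma ks_relations:
  fixes M :: point
  assumes surface: "\<And>i. i \<in> {1..n + N} \<Longrightarrow> trace (M i) = 0 \<and> det (M i) = 1"
  shows "G_relations n (\<lambda>k i j. G_fun n N k i j M)
      (\<lambda>m j i k p l. ks_bracket (n + N) (G_fun n N m j i) (G_fun n N k p l) M)" (is "G_relations n ?G ?br")
    and "gen_relations n (\<lambda>k i j. G_fun n N k i j M)
          (\<lambda>m j i k p l. ks_bracket (n + N)
             (\<lambda>X. gen_coeff (\<lambda>q a b. G_fun n N q a b X) j i m)
             (\<lambda>X. gen_coeff (\<lambda>q a b. G_fun n N q a b X) p l k) M)"
proof -
  show rel: "G_relations n ?G ?br"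
  proof (rule G_relations_cong)
    show "G_relations n ?G (\<lambda>m j i k p l. periodic_bracket ?G (0, j) (m, i) (0, p) (k, l))"
      by (rule periodic_bracket_relations) (rule G_fun_flip)
    fix m k :: int and j i p l
    assume "0 \<le> m" "0 \<le> k" and ix: "i \<in> {1..n}" "j \<in> {1..n}" "p \<in> {1..n}" "l \<in> {1..n}"
    then show "?br m j i k p l = periodic_bracket ?G (0, j) (m, i) (0, p) (k, l)"
      using ks_bracket_G_fun[of n N M, OF surface ix, where m = "nat m" and k = "nat k"] by simp
  qed
  show "gen_relations n ?G
          (\<lambda>m j i k p l. ks_bracket (n + N)
             (\<lambda>X. gen_coeff (\<lambda>q a b. G_fun n N q a b X) j i m)
             (\<lambda>X. gen_coeff (\<lambda>q a b. G_fun n N q a b X) p l k) M)"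
  proof (rule gen_relations_if_G_relations[OF _ _ rel])
    show "G_fun n N (- k) j i M = G_fun n N k i j M" for k i j by (rule G_fun_flip)
    show "G_fun n N 0 i i M = 2" if "i \<in> {1..n}" for i
      using that surface by (intro G_fun_0_diag) auto
    show "?br k p l m j i = - ?br m j i k p l" for m j i k p l
      by (rule ks_bracket_skew)
    fix m j i k p l
    have "(\<lambda>X. gen_coeff (\<lambda>q a b. G_fun n N q a b X) j i m) = (\<lambda>X. if j = i then 1 else 0)"
      if "m = 0 \<and> \<not> j < i" for j i m :: nat
      using that by (simp add: gen_coeff_def)
    moreover have "(\<lambda>X. gen_coeff (\<lambda>q a b. G_fun n N q a b X) j i m) = G_fun n N (int m) j i"
      if "\<not> (m = 0 \<and> \<not> j < i)" for j i m :: nat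
      using that by (auto simp: gen_coeff_def)
    ultimately show "ks_bracket (n + N) (\<lambda>X. gen_coeff (\<lambda>q a b. G_fun n N q a b X) j i m)
         (\<lambda>X. gen_coeff (\<lambda>q a b. G_fun n N q a b X) p l k) M =
        (if m = 0 \<and> \<not> j < i \<or> k = 0 \<and> \<not> p < l then 0
         else ks_bracket (n + N) (G_fun n N (int m) j i) (G_fun n N (int k) p l) M)"
      by (auto simp: ks_bracket_const)
  qed
qed

lemma infinite_D_gens:
  assumes "1 \<le> n"
  shows "infinite (D_gens n)"
proof -
  have "range (\<lambda>k. (Suc k, 1, 1)) \<subseteq> D_gens n" using assms by (auto simp: D_gens_def)
  moreover have "infinite (range (\<lambda>k. (Suc k, 1 :: nat, 1 :: nat)))"
    by (rule range_inj_infinite) (simp add: inj_def)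
  ultimately show ?thesis using finite_subset by blast
qed

lemma D_gens_indices: "(m, j, i) \<in> D_gens n \<Longrightarrow> j \<in> {1..n} \<and> i \<in> {1..n}"
  by (auto simp: D_gens_def)

lemma pairing_G_abs_closed:
  assumes "snd J \<in> {1..n}" "snd I \<in> {1..n}"
  shows "pairing G_abs J I \<in> poly_over (D_gens n)"
  using assms
proof (induction rule: site_pair_induct)
  case (swap J I)
  then show ?case by (simp add: pairing_sym[of G_abs I J, OF G_abs_sym])
qed (simp_all add: pairing_G_abs_self pairing_G_abs_generator gconst_in_poly_over gvar_in_poly_over)

lemma periodic_bracket_closed:
  assumes "snd J \<in> {1..n}" "snd I \<in> {1..n}" "snd P \<in> {1..n}" "snd L \<in> {1..n}"
  shows "periodic_bracket G_abs J I P L \<in> poly_over (D_gens n)"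
  unfolding periodic_bracket_def Sum_any.expand_set
  using assms
  by (auto intro!: sum_in_poly_over mult_in_poly_over diff_in_poly_over of_int_in_poly_over pairing_G_abs_closed
      simp: chord_bracket_def snd_shift)

lemma D_bracket_biderivation: "skew_biderivation_on (D_alg n) (D_bracket n)"
proof -
  have closed: "D_bracket n f g \<in> poly_over (D_gens n)" if "f \<in> poly_over (D_gens n)" "g \<in> poly_over (D_gens n)" for f g
    unfolding D_bracket_def
  proof (rule biderivation_closed[OF _ that])
    fix u v assume "u \<in> D_gens n" "v \<in> D_gens n"
    moreover obtain m j i k p l where "u = (m, j, i)" "v = (k, p, l)" by (metis prod_cases3)
    ultimately show "D_generator_bracket n u v \<in> poly_over (D_gens n)"
      using D_gens_indices[of m j i n] D_gens_indices[of k p l n]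
      by (simp add: D_generator_bracket_def periodic_bracket_closed)
  qed
  have scale: "D_bracket n (gconst c * f) h = gconst c * D_bracket n f h" for c f h
    by (simp add: D_bracket_def biderivation_mult_left biderivation_gconst_left)
  have add: "D_bracket n (f + g) h = D_bracket n f h + D_bracket n g h"
    and mult: "D_bracket n (f * g) h = f * D_bracket n g h + D_bracket n f h * g" for f g h
    by (simp_all add: D_bracket_def biderivation_add_left biderivation_mult_left)
  show ?thesis
    unfolding skew_biderivation_on_def D_alg_eq
    by (intro conjI ballI allI) (rule closed D_bracket_skew add scale mult; assumption?)+
qed

lemma D_bracket_G_abs:
  assumes "i \<in> {1..n}" "j \<in> {1..n}" "p \<in> {1..n}" "l \<in> {1..n}"
  shows "D_bracket n (G_abs m j i) (G_abs k p l) = periodic_bracket G_abs (0, j) (m, i) (0, p) (k, l)"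
  using D_bracket_pairing[of "(0, j)" n "(m, i)" "(0, p)" "(k, l)"] assms by (simp add: pairing_def)

lemma D_bracket_relations: "G_relations n G_abs (\<lambda>m j i k p l. D_bracket n (G_abs m j i) (G_abs k p l))"
  by (rule G_relations_cong[OF periodic_bracket_relations[of G_abs, OF G_abs_sym]]) (rule D_bracket_G_abs)

lemma D_bracket_gen_relations:
  "gen_relations n G_abs (\<lambda>m j i k p l. D_bracket n (gen_coeff G_abs j i m) (gen_coeff G_abs p l k))"
proof (rule gen_relations_if_G_relations[OF G_abs_sym G_abs_0_diag D_bracket_relations])
  show "D_bracket n (G_abs k p l) (G_abs m j i) = - D_bracket n (G_abs m j i) (G_abs k p l)" for m j i k p l
    by (rule D_bracket_skew)
  fix m j i k p l
  have "gen_coeff G_abs j i m = gconst (if j = i then 1 else 0)" if "m = 0 \<and> \<not> j < i" for j i m :: nat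
    using that by (simp add: gen_coeff_def)
  moreover have "gen_coeff G_abs j i m = G_abs (int m) j i" if "\<not> (m = 0 \<and> \<not> j < i)" for j i m :: nat
    using that by (auto simp: gen_coeff_def)
  ultimately show "D_bracket n (gen_coeff G_abs j i m) (gen_coeff G_abs p l k) =
      (if m = 0 \<and> \<not> j < i \<or> k = 0 \<and> \<not> p < l then 0 else D_bracket n (G_abs (int m) j i) (G_abs (int k) p l))"
    by (auto simp: D_bracket_def biderivation_gconst_left biderivation_gconst_right)
qed

text \<open>A constant has zero bracket, since \<open>B 1 h = B (1 * 1) h = 2 * B 1 h\<close>; the rest is the induction over
  polynomials in each argument.\<close>

lemma skew_biderivation_unique:
  assumes B: "skew_biderivation_on (poly_over V) B" and B': "skew_biderivation_on (poly_over V) B'"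
    and gens: "\<And>u v. u \<in> V \<Longrightarrow> v \<in> V \<Longrightarrow> B' (gvar u) (gvar v) = B (gvar u) (gvar v)"
    and "f \<in> poly_over V" "g \<in> poly_over V"
  shows "B' f g = B f g"
proof -
  have on_const: "C (gconst c) h = 0" if C: "skew_biderivation_on (poly_over V) C" and h: "h \<in> poly_over V" for C c h
  proof -
    have one: "1 \<in> poly_over V" using gconst_in_poly_over[of 1 V] by simp
    have "C (1 * 1) h = 1 * C 1 h + C 1 h * 1"
      using C h one unfolding skew_biderivation_on_def by blast
    then have "C 1 h = 0" by simp
    moreover have "C (gconst c * 1) h = gconst c * C 1 h"
      using C h one unfolding skew_biderivation_on_def by blast
    ultimately show ?thesis by simp
  qed
  have on_add: "C (f + g) h = C f h + C g h" and on_mult: "C (f * g) h = f * C g h + C f h * g" and skew: "C f g = - C g f"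
    if "skew_biderivation_on (poly_over V) C" "f \<in> poly_over V" "g \<in> poly_over V" "h \<in> poly_over V" for C f g h
    using that unfolding skew_biderivation_on_def by blast+
  have extend: "B' f h = B f h" if "f \<in> poly_over V" "h \<in> poly_over V" "\<And>u. u \<in> V \<Longrightarrow> B' (gvar u) h = B (gvar u) h" for f h
    using that(1)
  proof (induction f rule: poly_over_induct)
    case (const c)
    then show ?case using on_const[OF B] on_const[OF B'] that(2) by simp
  next
    case (var u)
    then show ?case by (rule that(3))
  next
    case (add f g)
    then show ?case using on_add[OF B] on_add[OF B'] that(2) by simp
  next
    case (mult f g)
    then show ?case using on_mult[OF B] on_mult[OF B'] that(2) by simp
  qed
  show ?thesis
  proof (rule extend[OF assms(4,5)])
    fix u assume u: "u \<in> V"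
    have "B' g (gvar u) = B g (gvar u)"
      using gens u by (intro extend[OF assms(5)]) (auto intro: gvar_in_poly_over)
    then show "B' (gvar u) g = B (gvar u) g"
      using skew[OF B gvar_in_poly_over[OF u] assms(5,5)] skew[OF B' gvar_in_poly_over[OF u] assms(5,5)] by simp
  qed
qed

text \<open>The relations fix the brackets of generators at levels \<open>m \<le> k\<close>, and skew-symmetry those at levels
  \<open>k < m\<close>.\<close>

lemma D_bracket_unique:
  assumes B': "skew_biderivation_on (D_alg n) B'"
    and rel: "G_relations n G_abs (\<lambda>m j i k p l. B' (G_abs m j i) (G_abs k p l))"
    and "f \<in> D_alg n" "g \<in> D_alg n"
  shows "B' f g = D_bracket n f g"
proof (rule skew_biderivation_unique[OF D_bracket_biderivation[unfolded D_alg_eq] B'[unfolded D_alg_eq] _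
      assms(3,4)[unfolded D_alg_eq]])
  fix u v assume uv: "u \<in> D_gens n" "v \<in> D_gens n"
  obtain m j i k p l where u: "u = (m, j, i)" and v: "v = (k, p, l)" by (metis prod_cases3)
  have gu: "gvar u = G_abs (int m) j i" and gv: "gvar v = G_abs (int k) p l"
    using pairing_G_abs_generator uv u v by (auto simp: pairing_def)
  have ix: "i \<in> {1..n}" "j \<in> {1..n}" "p \<in> {1..n}" "l \<in> {1..n}"
    using uv u v by (auto simp: D_gens_def)
  have skew: "B' f g = - B' g f" if "f \<in> D_alg n" "g \<in> D_alg n" for f g
    using B' that unfolding skew_biderivation_on_def by blast
  have mem: "gvar u \<in> D_alg n" "gvar v \<in> D_alg n"
    using uv by (simp_all add: D_alg_eq gvar_in_poly_over)
  show "B' (gvar u) (gvar v) = D_bracket n (gvar u) (gvar v)"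
  proof (cases "m \<le> k")
    case True
    then show ?thesis
      unfolding gu gv using G_relations_unique[OF rel D_bracket_relations _ _ ix, of "int m" "int k"] by simp
  next
    case False
    then have "B' (gvar v) (gvar u) = D_bracket n (gvar v) (gvar u)"
      unfolding gu gv using G_relations_unique[OF rel D_bracket_relations _ _ ix(4,3,2,1), of "int k" "int m"] by simp
    then show ?thesis
      using skew[OF mem] D_bracket_skew[of n "gvar u" "gvar v"] by simp
  qed
qed

theorem theorem6p1:
  fixes n N :: nat
  assumes "n \<ge> 1" and "N \<ge> 1"
  shows
    "(\<forall>M :: point. (\<forall>i\<in>{1..n + N}. trace (M i) = 0 \<and> det (M i) = 1) \<longrightarrow>
        (\<forall>k. \<forall>i\<in>{1..n}. \<forall>j\<in>{1..n}. G_fun n N k i j M = G_fun n N (- k) j i M) \<and>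
        (\<forall>i\<in>{1..n}. G_fun n N 0 i i M = 2) \<and>
        G_relations n (\<lambda>k i j. G_fun n N k i j M)
          (\<lambda>m j i k p l. ks_bracket (n + N) (G_fun n N m j i) (G_fun n N k p l) M) \<and>
        gen_relations n (\<lambda>k i j. G_fun n N k i j M)
          (\<lambda>m j i k p l. ks_bracket (n + N)
             (\<lambda>X. gen_coeff (\<lambda>q a b. G_fun n N q a b X) j i m)
             (\<lambda>X. gen_coeff (\<lambda>q a b. G_fun n N q a b X) p l k) M)) \<and>
     infinite (D_gens n) \<and>
     (\<exists>B. skew_biderivation_on (D_alg n) B \<and>
          G_relations n G_abs (\<lambda>m j i k p l. B (G_abs m j i) (G_abs k p l)) \<and>
          gen_relations n G_abs
            (\<lambda>m j i k p l. B (gen_coeff G_abs j i m) (gen_coeff G_abs p l k)) \<and>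
          jacobi_on (D_alg n) B \<and>
          (\<forall>B'. skew_biderivation_on (D_alg n) B' \<and>
                G_relations n G_abs (\<lambda>m j i k p l. B' (G_abs m j i) (G_abs k p l)) \<longrightarrow>
                (\<forall>f\<in>D_alg n. \<forall>g\<in>D_alg n. B' f g = B f g)))"
proof (intro conjI allI impI exI[of _ "D_bracket n"])
  show "infinite (D_gens n)" using infinite_D_gens \<open>n \<ge> 1\<close> .
  show "skew_biderivation_on (D_alg n) (D_bracket n)" by (rule D_bracket_biderivation)
  show "G_relations n G_abs (\<lambda>m j i k p l. D_bracket n (G_abs m j i) (G_abs k p l))" by (rule D_bracket_relations)
  show "gen_relations n G_abs (\<lambda>m j i k p l. D_bracket n (gen_coeff G_abs j i m) (gen_coeff G_abs p l k))"
    by (rule D_bracket_gen_relations)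
  show "jacobi_on (D_alg n) (D_bracket n)" by (rule D_bracket_jacobi)
  show "\<forall>f\<in>D_alg n. \<forall>g\<in>D_alg n. B' f g = D_bracket n f g"
    if "skew_biderivation_on (D_alg n) B' \<and> G_relations n G_abs (\<lambda>m j i k p l. B' (G_abs m j i) (G_abs k p l))" for B'
    using that D_bracket_unique by blast
next
  fix M :: point
  assume surface: "\<forall>i\<in>{1..n + N}. trace (M i) = 0 \<and> det (M i) = 1"
  then have surface': "\<And>i. i \<in> {1..n + N} \<Longrightarrow> trace (M i) = 0 \<and> det (M i) = 1" by blast
  show "\<forall>i\<in>{1..n}. \<forall>j\<in>{1..n}. G_fun n N k i j M = G_fun n N (- k) j i M" for k
    by (simp add: G_fun_flip)
  show "\<forall>i\<in>{1..n}. G_fun n N 0 i i M = 2"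
    using surface by (auto intro!: G_fun_0_diag)
  show "G_relations n (\<lambda>k i j. G_fun n N k i j M)
      (\<lambda>m j i k p l. ks_bracket (n + N) (G_fun n N m j i) (G_fun n N k p l) M)"
    by (rule ks_relations(1)[OF surface'])
  show "gen_relations n (\<lambda>k i j. G_fun n N k i j M)
      (\<lambda>m j i k p l. ks_bracket (n + N)
         (\<lambda>X. gen_coeff (\<lambda>q a b. G_fun n N q a b X) j i m)
         (\<lambda>X. gen_coeff (\<lambda>q a b. G_fun n N q a b X) p l k) M)"
    by (rule ks_relations(2)[OF surface'])
qed

end
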